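(* Any nondegenerate holomorphic function $F$ of $m$ complex variables defines a special parabolic sphere of dimension $n=2m$. Conversely, every simply connected special parabolic sphere arises in this way.
   Context: Nondegenerate holomorphic functions. Let $V=T^*\mathbf{C}^m$ with canonical coordinates $(z^1,\ldots,z^m,w_1,\ldots,w_m)$, complex symplectic form $\Omega=\sum_{i=1}^m dz^i\wedge dw_i$, and standard real structure (complex conjugation) $\tau:V\to V$ with fixed point set $V^\tau=T^*\mathbf{R}^m$. Then $\gamma:=\sqrt{-1}\,\Omega(\cdot,\tau\cdot)$ is a Hermitian form of complex signature $(m,m)$. Let $F$ be a holomorphic function on a simply connected domain $U\subset\mathbf{C}^m$. The 1-form $dF$ is regarded as the holomorphic Lagrangian immersion $dF:U\to V$ whose image is given by $w_i=\partial F/\partial z^i$. The function $F$ is called nondegenerate if $(dF)^*\gamma$ is nondegenerate. In that case $g_F:=\mathrm{Re}\,(dF)^*\gamma$ is a (possibly indefinite) Kähler metric on $U$, the functions $\mathrm{Re}\,z^i$ and $\mathrm{Re}\,(\partial F/\partial z^i)$, $i=1,\ldots,m$, are local coordinates near each point of $U$, and $\nabla_F$ denotes the torsionfree flat connection on $U$ for which the differentials of all these functions are parallel. Affine immersions. $\mathbf{R}^{n+1}$ is regarded as affine space with its standard volume form $\det$ and standard flat connection $D$; affine transformations preserving $\det$ are called equiaffine. Let $\varphi:M\to\mathbf{R}^{n+1}$ be an immersion of an $n$-dimensional manifold and $\xi$ a vector field along $\varphi$ transversal to $\varphi$. The formulas $$D_X\varphi_*Y=\varphi_*(\nabla_XY)+g(X,Y)\xi,\qquad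 D_X\xi=-\varphi_*(SX)+\sigma(X)\xi$$ define a torsionfree connection $\nabla$ (the induced connection), a symmetric bilinear form $g$, an endomorphism field $S$ (the shape tensor) and a 1-form $\sigma$; one also has the induced volume form $\theta(X_1,\ldots,X_n)=\det(\xi,\varphi_*X_1,\ldots,\varphi_*X_n)$. If $g$ is nondegenerate (a condition independent of $\xi$), there is a transversal field $\xi$, unique up to sign and called the affine normal, for which the metric volume form $\nu$ of $g$ is $\nabla$-parallel and coincides with $\theta$. The immersion $\varphi$ with the affine normal is called a Blaschke immersion, and the corresponding pseudo-Riemannian metric $g$ its Blaschke metric. A Blaschke immersion is called an affine hypersphere if $S=\lambda\,\mathrm{Id}$ for some $\lambda\in\mathbf{R}$, and it is called parabolic (a parabolic sphere) if $\lambda=0$. A parabolic sphere with induced connection $\nabla$ and Blaschke metric $g$ is called special if there exists an almost complex structure $J$ on $M$ such that $g$ is $J$-Hermitian, i.e. $g(J\cdot,J\cdot)=g$, and the 2-form $\omega:=g(J\cdot,\cdot)$ is $\nabla$-parallel. The way in which $F$ defines a parabolic sphere. A special Kähler manifold $(M,\nabla,g)$ is a (possibly indefinite) Kähler manifold with complex structure $J$, Kähler form $\omega$ and a torsionfree flat connection $\nabla$ such that $\nabla\omega=0$ and $(\nabla_XJ)Y=(\nabla_YJ)X$ for all vector fields $X,Y$. For nondegenerate $F$ the triple $(U,\nabla_F,g_F)$ is a special Kähler manifold. A simply connected special Kähler manifold of real dimension $n=2m$ has a Blaschke immersion into $\mathbf{R}^{n+1}$, unique up to equiaffine transformations, whose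 induced connection and Blaschke metric are the given $\nabla$ and $g$. The parabolic sphere defined by $F$ is the one obtained in this manner from the special Kähler structure $(\nabla_F,g_F)$ induced by $dF$.
   Formalization: A single F on one domain U in C^m need not exist (cover of the punctured elliptic paraboloid by exp); the converse instead gives one global map M → V that near each point is, up to a real symplectic map, dF of a nondegenerate F defining the sphere there. *)

theory Defs
  imports "HOL-Analysis.Analysis"
begin

section \<open>Smooth maps and manifolds\<close>

text \<open>Only used for open \<open>S\<close> in finite-dimensional spaces; there, continuity of all iterated
  directional derivatives is the usual \<open>C\<^sup>k\<close> condition.\<close>

primrec Ck_on ::
    "nat \<Rightarrow> 'a::real_normed_vector set \<Rightarrow> ('a \<Rightarrow> 'b::real_normed_vector) \<Rightarrow> bool" where
  "Ck_on 0 S f \<longleftrightarrow> continuous_on S f"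
| "Ck_on (Suc k) S f \<longleftrightarrow>
     (\<forall>x\<in>S. f differentiable (at x)) \<and>
     (\<forall>v. Ck_on k S (\<lambda>x. frechet_derivative f (at x) v))"

definition smooth_on ::
    "'a::real_normed_vector set \<Rightarrow> ('a \<Rightarrow> 'b::real_normed_vector) \<Rightarrow> bool" where
  "smooth_on S f \<longleftrightarrow> (\<forall>k. Ck_on k S f)"

text \<open>A chart is a pair of its domain (a relatively open subset of the carrier \<open>M\<close>) and its
  coordinate map into a Euclidean space.\<close>

type_synonym ('a, 'e) chart = "'a set \<times> ('a \<Rightarrow> 'e)"

definition chart_image :: "('a, 'e) chart \<Rightarrow> 'e set" where
  "chart_image c = snd c ` fst c"

definition in_chart :: "('a, 'e) chart \<Rightarrow> ('a \<Rightarrow> 'b) \<Rightarrow> 'e \<Rightarrow> 'b" where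
  "in_chart c h = h \<circ> inv_into (fst c) (snd c)"

definition is_chart ::
    "'a::topological_space set \<Rightarrow> ('a, 'e::euclidean_space) chart \<Rightarrow> bool" where
  "is_chart M c \<longleftrightarrow>
     openin (top_of_set M) (fst c) \<and> open (chart_image c) \<and>
     homeomorphism (fst c) (chart_image c) (snd c) (inv_into (fst c) (snd c))"

definition smooth_transition ::
    "('a, 'd::euclidean_space) chart \<Rightarrow> ('a, 'e::euclidean_space) chart \<Rightarrow> bool" where
  "smooth_transition c d \<longleftrightarrow> smooth_on (snd c ` (fst c \<inter> fst d)) (in_chart c (snd d))"

definition smooth_manifold ::
    "'a::{t2_space,second_countable_topology} set \<Rightarrow> ('a, 'e::euclidean_space) chart set \<Rightarrow> bool"
  where
  "smooth_manifold M A \<longleftrightarrow>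
     (\<forall>c\<in>A. is_chart M c) \<and> (\<Union>c\<in>A. fst c) = M \<and> (\<forall>c\<in>A. \<forall>d\<in>A. smooth_transition c d)"

text \<open>The two charts may be modelled on different Euclidean spaces, such as \<open>\<real>\<^sup>2\<^sup>m\<close> and \<open>\<complex>\<^sup>m\<close>.\<close>

definition compatible_chart ::
    "'a::topological_space set \<Rightarrow> ('a, 'd::euclidean_space) chart set
      \<Rightarrow> ('a, 'e::euclidean_space) chart \<Rightarrow> bool" where
  "compatible_chart M A c \<longleftrightarrow>
     is_chart M c \<and> (\<forall>d\<in>A. smooth_transition c d \<and> smooth_transition d c)"


section \<open>Connections on open subsets of a Euclidean space\<close>

text \<open>A connection is represented by its Christoffel map \<open>\<Gamma>\<close>, the difference to the standard flat
  derivative; tensor fields are functions of the point, and \<open>X\<close>, \<open>Y\<close>, \<open>Z\<close> are vector fields.\<close>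

abbreviation ddir :: "('e::real_normed_vector \<Rightarrow> 'b::real_normed_vector) \<Rightarrow> 'e \<Rightarrow> 'e \<Rightarrow> 'b" where
  "ddir f x v \<equiv> frechet_derivative f (at x) v"

definition cov :: "('e::euclidean_space \<Rightarrow> 'e \<Rightarrow> 'e \<Rightarrow> 'e) \<Rightarrow> ('e \<Rightarrow> 'e) \<Rightarrow> ('e \<Rightarrow> 'e) \<Rightarrow> 'e \<Rightarrow> 'e" where
  "cov \<Gamma> X Y x = ddir Y x (X x) + \<Gamma> x (X x) (Y x)"

definition lie_bracket :: "('e::euclidean_space \<Rightarrow> 'e) \<Rightarrow> ('e \<Rightarrow> 'e) \<Rightarrow> 'e \<Rightarrow> 'e" where
  "lie_bracket X Y x = ddir Y x (X x) - ddir X x (Y x)"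

definition connection_on ::
    "'e::euclidean_space set \<Rightarrow> ('e \<Rightarrow> 'e \<Rightarrow> 'e \<Rightarrow> 'e) \<Rightarrow> bool" where
  "connection_on S \<Gamma> \<longleftrightarrow> (\<forall>x\<in>S. bilinear (\<Gamma> x)) \<and> (\<forall>u v. smooth_on S (\<lambda>x. \<Gamma> x u v))"

definition torsionfree_on ::
    "'e::euclidean_space set \<Rightarrow> ('e \<Rightarrow> 'e \<Rightarrow> 'e \<Rightarrow> 'e) \<Rightarrow> bool" where
  "torsionfree_on S \<Gamma> \<longleftrightarrow>
     (\<forall>X Y. smooth_on S X \<longrightarrow> smooth_on S Y \<longrightarrow>
        (\<forall>x\<in>S. cov \<Gamma> X Y x - cov \<Gamma> Y X x = lie_bracket X Y x))"

definition flat_on ::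
    "'e::euclidean_space set \<Rightarrow> ('e \<Rightarrow> 'e \<Rightarrow> 'e \<Rightarrow> 'e) \<Rightarrow> bool" where
  "flat_on S \<Gamma> \<longleftrightarrow>
     (\<forall>X Y Z. smooth_on S X \<longrightarrow> smooth_on S Y \<longrightarrow> smooth_on S Z \<longrightarrow>
        (\<forall>x\<in>S. cov \<Gamma> X (cov \<Gamma> Y Z) x - cov \<Gamma> Y (cov \<Gamma> X Z) x = cov \<Gamma> (lie_bracket X Y) Z x))"

definition parallel_differential ::
    "'e::euclidean_space set \<Rightarrow> ('e \<Rightarrow> 'e \<Rightarrow> 'e \<Rightarrow> 'e) \<Rightarrow> ('e \<Rightarrow> real) \<Rightarrow> bool" where
  "parallel_differential S \<Gamma> h \<longleftrightarrow>
     (\<forall>X Y. smooth_on S X \<longrightarrow> smooth_on S Y \<longrightarrow>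
        (\<forall>x\<in>S. ddir (\<lambda>y. ddir h y (Y y)) x (X x) = ddir h x (cov \<Gamma> X Y x)))"

definition parallel_2form ::
    "'e::euclidean_space set \<Rightarrow> ('e \<Rightarrow> 'e \<Rightarrow> 'e \<Rightarrow> 'e) \<Rightarrow> ('e \<Rightarrow> 'e \<Rightarrow> 'e \<Rightarrow> real) \<Rightarrow> bool" where
  "parallel_2form S \<Gamma> \<omega> \<longleftrightarrow>
     (\<forall>X Y Z. smooth_on S X \<longrightarrow> smooth_on S Y \<longrightarrow> smooth_on S Z \<longrightarrow>
        (\<forall>x\<in>S. ddir (\<lambda>y. \<omega> y (Y y) (Z y)) x (X x)
                = \<omega> x (cov \<Gamma> X Y x) (Z x) + \<omega> x (Y x) (cov \<Gamma> X Z x)))"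

text \<open>Forms of degree \<open>n = CARD('n)\<close> take an \<open>'n\<close>-indexed family of vectors as argument.\<close>

definition parallel_volume ::
    "'e::euclidean_space set \<Rightarrow> ('e \<Rightarrow> 'e \<Rightarrow> 'e \<Rightarrow> 'e) \<Rightarrow> ('e \<Rightarrow> ('n::finite \<Rightarrow> 'e) \<Rightarrow> real) \<Rightarrow> bool"
  where
  "parallel_volume S \<Gamma> \<theta> \<longleftrightarrow>
     (\<forall>Y X. smooth_on S Y \<longrightarrow> (\<forall>i. smooth_on S (X i)) \<longrightarrow>
        (\<forall>x\<in>S. ddir (\<lambda>y. \<theta> y (\<lambda>i. X i y)) x (Y x)
                = (\<Sum>i\<in>UNIV. \<theta> x ((\<lambda>j. X j x)(i := cov \<Gamma> Y (X i) x)))))"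


section \<open>Affine immersions into \<open>\<real>\<^sup>n\<^sup>+\<^sup>1\<close>\<close>

text \<open>With \<open>n = CARD('n)\<close>, the space \<open>\<real>\<^sup>n\<^sup>+\<^sup>1\<close> is \<^typ>\<open>real^('n::finite) option\<close>; in \<open>det\<close> the
  transversal field takes the row \<^term>\<open>None\<close>. The standard basis, ordered by its own index set,
  has determinant 1.\<close>

definition induced_volume ::
    "('e::euclidean_space \<Rightarrow> real^('n::finite) option) \<Rightarrow> ('e \<Rightarrow> real^'n option)
      \<Rightarrow> 'e \<Rightarrow> ('n \<Rightarrow> 'e) \<Rightarrow> real" where
  "induced_volume f \<xi> x X = det (\<chi> i. case i of None \<Rightarrow> \<xi> x | Some j \<Rightarrow> ddir f x (X j))"

definition induced_structure ::
    "'e::euclidean_space set \<Rightarrow> ('e \<Rightarrow> real^('n::finite) option) \<Rightarrow> ('e \<Rightarrow> real^'n option)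
      \<Rightarrow> ('e \<Rightarrow> 'e \<Rightarrow> 'e \<Rightarrow> 'e) \<Rightarrow> ('e \<Rightarrow> 'e \<Rightarrow> 'e \<Rightarrow> real) \<Rightarrow> ('e \<Rightarrow> 'e \<Rightarrow> 'e) \<Rightarrow> ('e \<Rightarrow> 'e \<Rightarrow> real)
      \<Rightarrow> bool" where
  "induced_structure S f \<xi> \<Gamma> g B \<sigma> \<longleftrightarrow>
     connection_on S \<Gamma> \<and>
     (\<forall>x\<in>S. bilinear (g x) \<and> linear (B x) \<and> linear (\<sigma> x)) \<and>
     (\<forall>X Y. smooth_on S X \<longrightarrow> smooth_on S Y \<longrightarrow>
        (\<forall>x\<in>S. ddir (\<lambda>y. ddir f y (Y y)) x (X x)
                 = ddir f x (cov \<Gamma> X Y x) + g x (X x) (Y x) *\<^sub>R \<xi> x)) \<and>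
     (\<forall>X. smooth_on S X \<longrightarrow>
        (\<forall>x\<in>S. ddir \<xi> x (X x) = - ddir f x (B x (X x)) + \<sigma> x (X x) *\<^sub>R \<xi> x))"

text \<open>The metric volume form \<open>\<nu>\<close> of \<open>g\<close> is determined up to sign (orientation) by
  \<open>\<bar>\<nu>(X\<^sub>1,\<dots>,X\<^sub>n)\<bar> = \<bar>det (g(X\<^sub>i,X\<^sub>j))\<bar>\<^sup>1\<^sup>/\<^sup>2\<close>. The condition is that \<open>\<theta>\<close> is one of
  these two forms and is parallel; reversing \<open>\<xi>\<close> preserves it.\<close>

definition Blaschke_on ::
    "'e::euclidean_space set \<Rightarrow> ('e \<Rightarrow> real^('n::finite) option) \<Rightarrow> ('e \<Rightarrow> real^'n option)
      \<Rightarrow> ('e \<Rightarrow> 'e \<Rightarrow> 'e \<Rightarrow> 'e) \<Rightarrow> ('e \<Rightarrow> 'e \<Rightarrow> 'e \<Rightarrow> real) \<Rightarrow> ('e \<Rightarrow> 'e \<Rightarrow> 'e) \<Rightarrow> bool" where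
  "Blaschke_on S f \<xi> \<Gamma> g B \<longleftrightarrow>
     DIM('e) = CARD('n) \<and> smooth_on S f \<and> smooth_on S \<xi> \<and>
     (\<forall>x\<in>S. inj (ddir f x) \<and> \<xi> x \<notin> range (ddir f x)) \<and>
     (\<exists>\<sigma>. induced_structure S f \<xi> \<Gamma> g B \<sigma>) \<and>
     (\<forall>x\<in>S. \<forall>v. (\<forall>u. g x u v = 0) \<longrightarrow> v = 0) \<and>
     (\<forall>x\<in>S. \<forall>X. \<bar>induced_volume f \<xi> x X\<bar> = sqrt \<bar>det (\<chi> i j. g x (X i) (X j))\<bar>) \<and>
     parallel_volume S \<Gamma> (induced_volume f \<xi>)"

text \<open>On a manifold, \<open>\<Gamma>\<close>, \<open>g\<close> and \<open>B\<close> are given by their components in each chart. No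
  transformation rule is imposed on them since they are determined by \<open>\<phi>\<close> and \<open>\<xi>\<close>.\<close>

definition Blaschke_immersion ::
    "'a::{t2_space,second_countable_topology} set \<Rightarrow> ('a, 'e::euclidean_space) chart set
      \<Rightarrow> ('a \<Rightarrow> real^('n::finite) option) \<Rightarrow> ('a \<Rightarrow> real^'n option)
      \<Rightarrow> (('a, 'e) chart \<Rightarrow> 'e \<Rightarrow> 'e \<Rightarrow> 'e \<Rightarrow> 'e)
      \<Rightarrow> (('a, 'e) chart \<Rightarrow> 'e \<Rightarrow> 'e \<Rightarrow> 'e \<Rightarrow> real)
      \<Rightarrow> (('a, 'e) chart \<Rightarrow> 'e \<Rightarrow> 'e \<Rightarrow> 'e) \<Rightarrow> bool" where
  "Blaschke_immersion M A \<phi> \<xi> \<Gamma> g B \<longleftrightarrow>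
     smooth_manifold M A \<and>
     (\<forall>c\<in>A. Blaschke_on (chart_image c) (in_chart c \<phi>) (in_chart c \<xi>) (\<Gamma> c) (g c) (B c))"

definition affine_hypersphere ::
    "'a::{t2_space,second_countable_topology} set \<Rightarrow> ('a, 'e::euclidean_space) chart set
      \<Rightarrow> ('a \<Rightarrow> real^('n::finite) option) \<Rightarrow> ('a \<Rightarrow> real^'n option)
      \<Rightarrow> (('a, 'e) chart \<Rightarrow> 'e \<Rightarrow> 'e \<Rightarrow> 'e \<Rightarrow> 'e)
      \<Rightarrow> (('a, 'e) chart \<Rightarrow> 'e \<Rightarrow> 'e \<Rightarrow> 'e \<Rightarrow> real) \<Rightarrow> real \<Rightarrow> bool" where
  "affine_hypersphere M A \<phi> \<xi> \<Gamma> g lam \<longleftrightarrow>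
     Blaschke_immersion M A \<phi> \<xi> \<Gamma> g (\<lambda>c x v. lam *\<^sub>R v)"

definition parabolic_sphere ::
    "'a::{t2_space,second_countable_topology} set \<Rightarrow> ('a, 'e::euclidean_space) chart set
      \<Rightarrow> ('a \<Rightarrow> real^('n::finite) option) \<Rightarrow> ('a \<Rightarrow> real^'n option)
      \<Rightarrow> (('a, 'e) chart \<Rightarrow> 'e \<Rightarrow> 'e \<Rightarrow> 'e \<Rightarrow> 'e)
      \<Rightarrow> (('a, 'e) chart \<Rightarrow> 'e \<Rightarrow> 'e \<Rightarrow> 'e \<Rightarrow> real) \<Rightarrow> bool" where
  "parabolic_sphere M A \<phi> \<xi> \<Gamma> g \<longleftrightarrow> affine_hypersphere M A \<phi> \<xi> \<Gamma> g 0"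

definition almost_complex_structure ::
    "('a, 'e::euclidean_space) chart set \<Rightarrow> (('a, 'e) chart \<Rightarrow> 'e \<Rightarrow> 'e \<Rightarrow> 'e) \<Rightarrow> bool" where
  "almost_complex_structure A J \<longleftrightarrow>
     (\<forall>c\<in>A. (\<forall>v. smooth_on (chart_image c) (\<lambda>x. J c x v)) \<and>
        (\<forall>x\<in>chart_image c. linear (J c x) \<and> (\<forall>v. J c x (J c x v) = - v))) \<and>
     (\<forall>c\<in>A. \<forall>d\<in>A. \<forall>p\<in>fst c \<inter> fst d. \<forall>v.
        ddir (in_chart c (snd d)) (snd c p) (J c (snd c p) v)
          = J d (snd d p) (ddir (in_chart c (snd d)) (snd c p) v))"

definition special_parabolic_sphere ::
    "'a::{t2_space,second_countable_topology} set \<Rightarrow> ('a, 'e::euclidean_space) chart set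
      \<Rightarrow> ('a \<Rightarrow> real^('n::finite) option) \<Rightarrow> ('a \<Rightarrow> real^'n option) \<Rightarrow> bool" where
  "special_parabolic_sphere M A \<phi> \<xi> \<longleftrightarrow>
     (\<exists>\<Gamma> g J. parabolic_sphere M A \<phi> \<xi> \<Gamma> g \<and> almost_complex_structure A J \<and>
        (\<forall>c\<in>A. (\<forall>x\<in>chart_image c. \<forall>u v. g c x (J c x u) (J c x v) = g c x u v) \<and>
               parallel_2form (chart_image c) (\<Gamma> c) (\<lambda>x u v. g c x (J c x u) v)))"


section \<open>Nondegenerate holomorphic functions\<close>

definition simply_connected_domain :: "(complex^'m::finite) set \<Rightarrow> bool" where
  "simply_connected_domain U \<longleftrightarrow> open U \<and> U \<noteq> {} \<and> simply_connected U"

definition holomorphic_fun_on ::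
    "(complex^'m::finite \<Rightarrow> complex) \<Rightarrow> (complex^'m) set \<Rightarrow> bool" where
  "holomorphic_fun_on F U \<longleftrightarrow>
     (\<forall>z\<in>U. \<exists>a. (F has_derivative (\<lambda>h. \<Sum>i\<in>UNIV. a $ i * h $ i)) (at z))"

definition partial :: "(complex^'m::finite \<Rightarrow> complex) \<Rightarrow> 'm \<Rightarrow> complex^'m \<Rightarrow> complex" where
  "partial F i z = deriv (\<lambda>t. F (z + t *s axis i 1)) 0"

text \<open>A point of \<open>V = T\<^sup>*\<complex>\<^sup>m\<close> is the pair \<open>(z, w)\<close> of its canonical coordinates.\<close>

type_synonym 'm cotangent = "(complex^'m) \<times> (complex^'m)"

definition Omega :: "'m::finite cotangent \<Rightarrow> 'm cotangent \<Rightarrow> complex" where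
  "Omega X Y = (\<Sum>i\<in>UNIV. fst X $ i * snd Y $ i - snd X $ i * fst Y $ i)"

definition conjugation :: "'m::finite cotangent \<Rightarrow> 'm cotangent" where
  "conjugation X = ((\<chi> i. cnj (fst X $ i)), (\<chi> i. cnj (snd X $ i)))"

definition hermitian_form :: "'m::finite cotangent \<Rightarrow> 'm cotangent \<Rightarrow> complex" where
  "hermitian_form X Y = \<i> * Omega X (conjugation Y)"

definition dF_immersion ::
    "(complex^'m::finite \<Rightarrow> complex) \<Rightarrow> complex^'m \<Rightarrow> 'm cotangent" where
  "dF_immersion F z = (z, \<chi> i. partial F i z)"

definition pullback_form ::
    "(complex^'m::finite \<Rightarrow> complex) \<Rightarrow> complex^'m \<Rightarrow> complex^'m \<Rightarrow> complex^'m \<Rightarrow> complex" where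
  "pullback_form F z u v = hermitian_form (ddir (dF_immersion F) z u) (ddir (dF_immersion F) z v)"

definition nondegenerate_on ::
    "(complex^'m::finite) set \<Rightarrow> (complex^'m \<Rightarrow> complex) \<Rightarrow> bool" where
  "nondegenerate_on U F \<longleftrightarrow>
     holomorphic_fun_on F U \<and> (\<forall>z\<in>U. \<forall>v. (\<forall>u. pullback_form F z u v = 0) \<longrightarrow> v = 0)"

definition metric_of ::
    "(complex^'m::finite \<Rightarrow> complex) \<Rightarrow> complex^'m \<Rightarrow> complex^'m \<Rightarrow> complex^'m \<Rightarrow> real" where
  "metric_of F z u v = Re (pullback_form F z u v)"

definition is_connection_of ::
    "(complex^'m::finite) set \<Rightarrow> (complex^'m \<Rightarrow> complex)
      \<Rightarrow> (complex^'m \<Rightarrow> complex^'m \<Rightarrow> complex^'m \<Rightarrow> complex^'m) \<Rightarrow> bool" where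
  "is_connection_of U F \<Gamma> \<longleftrightarrow>
     connection_on U \<Gamma> \<and> torsionfree_on U \<Gamma> \<and> flat_on U \<Gamma> \<and>
     (\<forall>i. parallel_differential U \<Gamma> (\<lambda>z. Re (z $ i)) \<and>
          parallel_differential U \<Gamma> (\<lambda>z. Re (partial F i z)))"

text \<open>\<open>\<phi>\<close> with affine normal \<open>\<xi>\<close> is a Blaschke immersion realising the special Kaehler structure
  of \<open>F\<close>; nothing is required of its shape tensor.\<close>

definition sphere_of_function ::
    "(complex^'m::finite) set \<Rightarrow> (complex^'m \<Rightarrow> complex)
      \<Rightarrow> (complex^'m \<Rightarrow> real^('n::finite) option) \<Rightarrow> (complex^'m \<Rightarrow> real^'n option) \<Rightarrow> bool" where
  "sphere_of_function U F \<phi> \<xi> \<longleftrightarrow>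
     (\<exists>\<Gamma> B. is_connection_of U F \<Gamma> \<and> Blaschke_on U \<phi> \<xi> \<Gamma> (metric_of F) B)"

text \<open>Since the metric volume form is only defined up to orientation, so is the Blaschke immersion
  with given \<open>\<nabla>\<close> and \<open>g\<close>: the linear part preserves \<open>det\<close> up to sign.\<close>

definition equiaffine_related ::
    "'a set \<Rightarrow> ('a \<Rightarrow> real^'k::finite) \<Rightarrow> ('a \<Rightarrow> real^'k) \<Rightarrow> bool" where
  "equiaffine_related U \<phi> \<psi> \<longleftrightarrow> (\<exists>L b. \<bar>det L\<bar> = 1 \<and> (\<forall>x\<in>U. \<psi> x = L *v \<phi> x + b))"

text \<open>Complex linear automorphisms of \<open>(V, \<Omega>, \<tau>)\<close>, i.e. elements of \<open>Sp(2m, \<real>)\<close>.\<close>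

definition real_symplectic :: "('m::finite cotangent \<Rightarrow> 'm cotangent) \<Rightarrow> bool" where
  "real_symplectic T \<longleftrightarrow>
     linear T \<and> (\<forall>c X. T (c *s fst X, c *s snd X) = (c *s fst (T X), c *s snd (T X))) \<and>
     (\<forall>X. T (conjugation X) = conjugation (T X)) \<and>
     (\<forall>X Y. Omega (T X) (T Y) = Omega X Y)"

text \<open>A hypersurface with affine normal arises from nondegenerate holomorphic functions if there is
  one map \<open>f\<close> from all of \<open>M\<close> to \<open>V\<close> which near each point, in a suitable chart \<open>c\<close> with values in
  \<open>\<complex>\<^sup>m\<close> and up to a real symplectic transformation of \<open>V\<close>, is the immersion \<open>dF\<close> of a function \<open>F\<close>
  defining the hypersurface there.

  The functions cannot in general be replaced by a single function on a domain \<open>U \<subseteq> \<complex>\<^sup>m\<close>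
  diffeomorphic to \<open>M\<close>: on \<open>M = \<complex>\<close>, \<open>\<phi>(\<zeta>) = (exp \<zeta>, \<bar>exp \<zeta>\<bar>\<^sup>2)\<close> is a special parabolic sphere (up
  to scale), but all its affine coordinate functions are \<open>2\<pi>\<i>\<close>-periodic. For indefinite
  metrics, moreover, no fixed real symplectic transformation need make the immersion a graph over
  the base at all points.\<close>

definition arises_from_holomorphic_functions ::
    "'m::finite itself \<Rightarrow> 'a::{t2_space,second_countable_topology} set
      \<Rightarrow> ('a, 'e::euclidean_space) chart set
      \<Rightarrow> ('a \<Rightarrow> real^('n::finite) option) \<Rightarrow> ('a \<Rightarrow> real^'n option) \<Rightarrow> bool" where
  "arises_from_holomorphic_functions _ M A \<phi> \<xi> \<longleftrightarrow>
     (\<exists>f :: 'a \<Rightarrow> 'm cotangent. \<forall>p\<in>M.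
        \<exists>(c :: ('a, complex^'m) chart) F T.
          p \<in> fst c \<and> compatible_chart M A c \<and>
          simply_connected_domain (chart_image c) \<and> nondegenerate_on (chart_image c) F \<and>
          real_symplectic T \<and> (\<forall>q\<in>fst c. f q = T (dF_immersion F (snd c q))) \<and>
          sphere_of_function (chart_image c) F (in_chart c \<phi>) (in_chart c \<xi>))"

end

theory Submission
  imports Defs "HOL-Complex_Analysis.Cauchy_Integral_Formula"
begin

text \<open>For nondegenerate \<open>F\<close> the real parts of the components of \<open>dF\<close> are affine coordinates of
  \<open>\<nabla>\<^sub>F\<close>, and the function \<open>2 (Im F - \<Sum> Im z\<^sup>i Re (\<partial>F/\<partial>z\<^sup>i))\<close> has \<open>\<nabla>\<^sub>F\<close>-Hessian \<open>g\<^sub>F\<close>. Its graph over the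
  coordinates \<open>(Re z, 2 Re (\<partial>F/\<partial>z))\<close>, with the constant vertical field as transversal field, is the
  Blaschke immersion; the factor 2 makes the induced volume agree with that of \<open>g\<^sub>F\<close>. Any other
  immersion with the same data has a frame \<open>(\<xi>, \<phi>\<^sub>*)\<close> satisfying the same linear equation, so the two
  differ by an equiaffine transformation.

  Conversely, on a special parabolic sphere \<open>\<xi>\<close> is constant, and the parallel form \<open>\<omega>\<close> becomes a
  constant form on \<open>\<real>\<^sup>n\<^sup>+\<^sup>1\<close> with kernel \<open>\<real>\<xi>\<close>. For constant \<open>b\<close> the function \<open>\<omega>(\<phi>, b) - i \<nu>(b)\<close>, with
  \<open>\<nu>\<close> the conormal map, is holomorphic with respect to \<open>J\<close>. Letting \<open>b\<close> run through a Darboux basis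
  gives a holomorphic Lagrangian immersion into \<open>V\<close>, which locally, after exchanging some of the
  pairs \<open>(z\<^sup>i, w\<^sub>i)\<close> for \<open>(w\<^sub>i, -z\<^sup>i)\<close>, is the graph of a closed holomorphic 1-form \<open>dF\<close>.\<close>

section \<open>Calculus of smooth maps\<close>

text \<open>\<open>sphere_of_function\<close> prescribes no shape tensor. It vanishes because
  flatness turns the Gauss equation into g(v, w) B u = g(u, w) B v, which a nondegenerate g in
  dimension at least 2 allows only for B = 0. This makes \<xi> constant, and a constant vector b
  then splits as r \<xi> + d\<phi>(Y) with Y parallel and dr = - g(_, Y). Both directions rest on
  this splitting: in the uniqueness proof it transports one frame to the other; in the converse r is
  \<nu>(b), and d(\<omega>(\<phi>, b)) = g(J _, Y) is, up to sign, d\<nu>(b) composed with J, which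
  is the Cauchy-Riemann equation. The components of g are given chart by chart without a
  transformation rule, so invariance of \<omega> is obtained by writing it through derivatives of
  the global functions \<nu>(b). The map into V is assembled from \<phi>, \<nu> and one constant
  form, hence is defined on all of M; only the exchanged pairs, the chart and F depend on the point.
  Halving its z-components cancels the 2 in Re \<gamma>(X, Y) = 2 Re-form(iX, Y), valid on
  Lagrangian subspaces, so that the metric is g itself.\<close>

lemma ddir_cong:
  assumes "open S" "x \<in> S" "\<And>y. y \<in> S \<Longrightarrow> f y = g y"
  shows "ddir f x = ddir g x"
proof -
  \<comment> \<open>\<open>frechet_derivative\<close> is a choice among all derivatives, so it
    suffices that both functions have the same ones; this also covers points where there is
    none.\<close>
  have "(f has_derivative D) (at x) \<longleftrightarrow> (g has_derivative D) (at x)" for D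
    using assms has_derivative_transform_within_open[of f D x UNIV S g]
      has_derivative_transform_within_open[of g D x UNIV S f] by auto
  then show ?thesis
    unfolding frechet_derivative_def by presburger
qed

lemma ddir_eqI: "(f has_derivative D) (at x) \<Longrightarrow> ddir f x = D"
  using frechet_derivative_at by metis

lemma Ck_on_congI:
  assumes "open S" "\<And>x. x \<in> S \<Longrightarrow> f x = g x" "Ck_on k S f"
  shows "Ck_on k S g"
  using assms(2,3)
proof (induction k arbitrary: f g)
  case 0
  then show ?case by (metis Ck_on.simps(1) continuous_on_cong)
next
  case (Suc k)
  have "g differentiable (at x)" if "x \<in> S" for x
  proof -
    from Suc.prems that obtain D where "(f has_derivative D) (at x)"
      by (auto simp: differentiable_def)
    then have "(g has_derivative D) (at x)"
      using has_derivative_transform_within_open[of f D x UNIV S g] assms(1) that Suc.prems(1) by auto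
    then show ?thesis by (auto simp: differentiable_def)
  qed
  moreover have "Ck_on k S (\<lambda>x. ddir g x v)" for v
    by (rule Suc.IH[of "\<lambda>x. ddir f x v"])
      (use Suc.prems ddir_cong[OF assms(1), of _ f g] in auto)
  ultimately show ?case by simp
qed

lemma Ck_on_subset: "Ck_on k S f \<Longrightarrow> T \<subseteq> S \<Longrightarrow> Ck_on k T f"
  by (induction k arbitrary: f) (auto intro: continuous_on_subset)

lemma Ck_on_SucD: "Ck_on (Suc k) S f \<Longrightarrow> Ck_on k S f"
proof (induction k arbitrary: f)
  case 0
  then show ?case
    by (auto intro!: continuous_at_imp_continuous_on differentiable_imp_continuous_within)
qed auto

lemma Ck_on_const: "Ck_on k S (\<lambda>x. c)"
  by (induction k arbitrary: c) auto

lemma Ck_on_ident: "Ck_on k S (\<lambda>x. x)"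
  by (cases k) (auto simp: Ck_on_const)

lemma Ck_on_linear:
  assumes L: "bounded_linear L" and S: "open S" and f: "Ck_on k S f"
  shows "Ck_on k S (\<lambda>x. L (f x))"
  using f
proof (induction k arbitrary: f)
  case 0
  then show ?case by (simp add: L linear_continuous_on_compose bounded_linear.continuous_on)
next
  case (Suc k)
  have D: "((\<lambda>x. L (f x)) has_derivative (\<lambda>v. L (ddir f x v))) (at x)" if "x \<in> S" for x
    using Suc.prems that frechet_derivative_works
    by (auto intro!: bounded_linear.has_derivative[OF L])
  have "Ck_on k S (\<lambda>x. ddir (\<lambda>x. L (f x)) x v)" for v
    by (rule Ck_on_congI[OF S _ Suc.IH[of "\<lambda>x. ddir f x v"]])
      (use Suc.prems ddir_eqI[OF D] in auto)
  with D show ?case by (auto simp: differentiable_def)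
qed

lemma Ck_on_add:
  assumes S: "open S" and "Ck_on k S f" "Ck_on k S g"
  shows "Ck_on k S (\<lambda>x. f x + g x)"
  using assms(2,3)
proof (induction k arbitrary: f g)
  case 0
  then show ?case by (auto intro: continuous_intros)
next
  case (Suc k)
  have D: "((\<lambda>x. f x + g x) has_derivative (\<lambda>v. ddir f x v + ddir g x v)) (at x)"
    if "x \<in> S" for x
    using Suc.prems that frechet_derivative_works by (auto intro!: has_derivative_add)
  have "Ck_on k S (\<lambda>x. ddir (\<lambda>x. f x + g x) x v)" for v
    by (rule Ck_on_congI[OF S _ Suc.IH[of "\<lambda>x. ddir f x v" "\<lambda>x. ddir g x v"]])
      (use Suc.prems ddir_eqI[OF D] in auto)
  with D show ?case by (auto simp: differentiable_def)
qed

lemma Ck_on_bilinear: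
  assumes B: "bounded_bilinear B" and S: "open S" and "Ck_on k S f" "Ck_on k S g"
  shows "Ck_on k S (\<lambda>x. B (f x) (g x))"
  using assms(3,4)
proof (induction k arbitrary: f g)
  case 0
  then show ?case by (auto intro: bounded_bilinear.continuous_on[OF B])
next
  case (Suc k)
  have D: "((\<lambda>x. B (f x) (g x)) has_derivative (\<lambda>v. B (f x) (ddir g x v) + B (ddir f x v) (g x))) (at x)"
    if "x \<in> S" for x
    by (rule bounded_bilinear.FDERIV[OF B])
      (use Suc.prems that frechet_derivative_works in force)+
  have "Ck_on k S (\<lambda>x. ddir (\<lambda>x. B (f x) (g x)) x v)" for v
    by (rule Ck_on_congI[OF S _ Ck_on_add[OF S Suc.IH[of f "\<lambda>x. ddir g x v"]
            Suc.IH[of "\<lambda>x. ddir f x v" g]]])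
      (use Suc.prems ddir_eqI[OF D] in \<open>auto intro: Ck_on_SucD\<close>)
  with D show ?case by (auto simp: differentiable_def)
qed

lemma Ck_on_sum:
  assumes S: "open S" and "\<And>i. i \<in> I \<Longrightarrow> Ck_on k S (f i)"
  shows "Ck_on k S (\<lambda>x. \<Sum>i\<in>I. f i x)"
  using assms(2)
  by (induction I rule: infinite_finite_induct) (auto simp: Ck_on_const Ck_on_add[OF S])

lemma linear_euclidean_sum:
  fixes L :: "'e::euclidean_space \<Rightarrow> 'b::real_vector"
  assumes "linear L"
  shows "L v = (\<Sum>b\<in>Basis. (v \<bullet> b) *\<^sub>R L b)"
  by (subst euclidean_representation[of v, symmetric])
    (simp only: linear_sum[OF assms] linear_cmul[OF assms])

lemma Ck_on_compose:
  fixes f :: "'a::real_normed_vector \<Rightarrow> 'e::euclidean_space"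
  assumes S: "open S" and T: "open T" and sub: "f ` S \<subseteq> T" and g: "Ck_on k T g" and f: "Ck_on k S f"
  shows "Ck_on k S (\<lambda>x. g (f x))"
  using g f
proof (induction k arbitrary: g)
  case 0
  then show ?case using sub by (auto intro: continuous_on_compose2)
next
  case (Suc k)
  have D: "((\<lambda>x. g (f x)) has_derivative (\<lambda>v. ddir g (f x) (ddir f x v))) (at x)"
    if "x \<in> S" for x
    by (rule has_derivative_compose[of f _ x UNIV g];
        rule frechet_derivative_works[THEN iffD1]) (use Suc.prems that sub in auto)
  have lin: "linear (ddir g (f x))" if "x \<in> S" for x
    by (rule linear_frechet_derivative) (use Suc.prems that sub in auto)
  have "Ck_on k S (\<lambda>x. ddir (\<lambda>x. g (f x)) x v)" for v
  proof (rule Ck_on_congI[OF S])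
    \<comment> \<open>In the chain rule the direction fed to the derivative of \<open>g\<close>
      varies with x. Expanding it in \<open>Basis\<close> leaves derivatives of \<open>g\<close> in
      fixed directions, to which the induction hypothesis applies.\<close>
    show "Ck_on k S (\<lambda>x. \<Sum>b\<in>Basis. (ddir f x v \<bullet> b) *\<^sub>R ddir g (f x) b)"
      using Suc.prems
      by (intro Ck_on_sum[OF S] Ck_on_bilinear[OF bounded_bilinear_scaleR S] Suc.IH
            Ck_on_linear[OF bounded_linear_inner_left S]) (auto intro: Ck_on_SucD)
    show "(\<Sum>b\<in>Basis. (ddir f x v \<bullet> b) *\<^sub>R ddir g (f x) b) = ddir (\<lambda>x. g (f x)) x v" if "x \<in> S" for x
      using linear_euclidean_sum[OF lin[OF that], of "ddir f x v"] ddir_eqI[OF D[OF that]] by simp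
  qed
  with D show ?case by (auto simp: differentiable_def)
qed

lemma Ck_on_inverse:
  fixes f :: "'a::real_normed_vector \<Rightarrow> real"
  assumes S: "open S" and f: "Ck_on k S f" and nz: "\<And>x. x \<in> S \<Longrightarrow> f x \<noteq> 0"
  shows "Ck_on k S (\<lambda>x. inverse (f x))"
  using f
proof (induction k)
  case 0
  then show ?case using nz by (auto intro!: continuous_intros)
next
  case (Suc k)
  have D: "((\<lambda>x. inverse (f x)) has_derivative (\<lambda>v. - (inverse (f x) * ddir f x v * inverse (f x)))) (at x)"
    if "x \<in> S" for x
    using Suc.prems that frechet_derivative_works nz by (auto intro!: Deriv.has_derivative_inverse)
  note mult = Ck_on_bilinear[OF bounded_bilinear_mult S]
  have "Ck_on k S (\<lambda>x. ddir (\<lambda>x. inverse (f x)) x v)" for v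
  proof (rule Ck_on_congI[OF S])
    show "Ck_on k S (\<lambda>x. - (inverse (f x) * ddir f x v * inverse (f x)))"
      using Suc.IH[OF Ck_on_SucD[OF Suc.prems]] Suc.prems
      by (intro Ck_on_linear[OF bounded_linear_minus[OF bounded_linear_ident] S] mult) auto
    show "- (inverse (f x) * ddir f x v * inverse (f x)) = ddir (\<lambda>x. inverse (f x)) x v" if "x \<in> S" for x
      using ddir_eqI[OF D[OF that]] by simp
  qed
  with D show ?case by (auto simp: differentiable_def)
qed

lemma smooth_onD: "smooth_on S f \<Longrightarrow> x \<in> S \<Longrightarrow> (f has_derivative ddir f x) (at x)"
  using frechet_derivative_works by (fastforce simp: smooth_on_def dest!: spec[of _ "Suc 0"])

lemma smooth_on_linear_ddir: "smooth_on S f \<Longrightarrow> x \<in> S \<Longrightarrow> linear (ddir f x)"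
  using has_derivative_linear smooth_onD by blast

lemma smooth_on_continuous: "smooth_on S f \<Longrightarrow> continuous_on S f"
  by (auto simp: smooth_on_def dest!: spec[of _ 0])

lemma smooth_on_congI:
  "open S \<Longrightarrow> smooth_on S f \<Longrightarrow> (\<And>x. x \<in> S \<Longrightarrow> f x = g x) \<Longrightarrow> smooth_on S g"
  unfolding smooth_on_def using Ck_on_congI by blast

lemma smooth_on_subset: "smooth_on S f \<Longrightarrow> T \<subseteq> S \<Longrightarrow> smooth_on T f"
  unfolding smooth_on_def using Ck_on_subset by blast

lemma smooth_on_const: "smooth_on S (\<lambda>x. c)"
  by (simp add: smooth_on_def Ck_on_const)

lemma smooth_on_ident: "smooth_on S (\<lambda>x. x)"
  by (simp add: smooth_on_def Ck_on_ident)

lemma smooth_on_linear: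
  "bounded_linear L \<Longrightarrow> open S \<Longrightarrow> smooth_on S f \<Longrightarrow> smooth_on S (\<lambda>x. L (f x))"
  by (simp add: smooth_on_def Ck_on_linear)

lemma smooth_on_add:
  "open S \<Longrightarrow> smooth_on S f \<Longrightarrow> smooth_on S g \<Longrightarrow> smooth_on S (\<lambda>x. f x + g x)"
  by (simp add: smooth_on_def Ck_on_add)

lemma smooth_on_minus: "open S \<Longrightarrow> smooth_on S f \<Longrightarrow> smooth_on S (\<lambda>x. - f x)"
  by (rule smooth_on_linear[OF bounded_linear_minus[OF bounded_linear_ident]])

lemma smooth_on_diff:
  "open S \<Longrightarrow> smooth_on S f \<Longrightarrow> smooth_on S g \<Longrightarrow> smooth_on S (\<lambda>x. f x - g x)"
  using smooth_on_add[of S f "\<lambda>x. - g x"] smooth_on_minus[of S g] by simp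

lemma smooth_on_bilinear:
  "bounded_bilinear B \<Longrightarrow> open S \<Longrightarrow> smooth_on S f \<Longrightarrow> smooth_on S g
    \<Longrightarrow> smooth_on S (\<lambda>x. B (f x) (g x))"
  by (simp add: smooth_on_def Ck_on_bilinear)

lemmas smooth_on_mult = smooth_on_bilinear[OF bounded_bilinear_mult]
lemmas smooth_on_scaleR = smooth_on_bilinear[OF bounded_bilinear_scaleR]
lemmas smooth_on_inner = smooth_on_bilinear[OF bounded_bilinear_inner]

lemma smooth_on_sum:
  "open S \<Longrightarrow> (\<And>i. i \<in> I \<Longrightarrow> smooth_on S (f i)) \<Longrightarrow> smooth_on S (\<lambda>x. \<Sum>i\<in>I. f i x)"
  by (simp add: smooth_on_def Ck_on_sum)

lemma smooth_on_prod:
  fixes f :: "'i \<Rightarrow> 'a::real_normed_vector \<Rightarrow> real"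
  assumes "open S" "\<And>i. i \<in> I \<Longrightarrow> smooth_on S (f i)"
  shows "smooth_on S (\<lambda>x. \<Prod>i\<in>I. f i x)"
  using assms(2)
  by (induction I rule: infinite_finite_induct)
    (auto intro: smooth_on_const smooth_on_mult[OF assms(1)])

lemma smooth_on_divide:
  fixes f g :: "'a::real_normed_vector \<Rightarrow> real"
  assumes "open S" "smooth_on S f" "smooth_on S g" "\<And>x. x \<in> S \<Longrightarrow> g x \<noteq> 0"
  shows "smooth_on S (\<lambda>x. f x / g x)"
  unfolding divide_inverse
  using assms by (intro smooth_on_mult) (simp_all add: smooth_on_def Ck_on_inverse)

lemma smooth_on_compose:
  fixes f :: "'a::real_normed_vector \<Rightarrow> 'e::euclidean_space"
  shows "open S \<Longrightarrow> open T \<Longrightarrow> f ` S \<subseteq> T \<Longrightarrow> smooth_on T g \<Longrightarrow> smooth_on S f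
    \<Longrightarrow> smooth_on S (\<lambda>x. g (f x))"
  by (simp add: smooth_on_def Ck_on_compose)

lemma smooth_on_ddir: "smooth_on S f \<Longrightarrow> smooth_on S (\<lambda>x. ddir f x v)"
  unfolding smooth_on_def using Ck_on.simps(2) by blast

text \<open>Expansion in \<open>Basis\<close> reduces a pointwise linear family to finitely many
  smooth coefficients. It bridges the gap between tensors, whose smoothness is known for fixed
  arguments, and their values on vector fields.\<close>

lemma smooth_on_linear_family:
  fixes q :: "'a::real_normed_vector \<Rightarrow> 'e::euclidean_space \<Rightarrow> 'b::real_normed_vector"
  assumes S: "open S" and "\<And>x. x \<in> S \<Longrightarrow> linear (q x)" and "\<And>v. smooth_on S (\<lambda>x. q x v)"
    and "smooth_on S V"
  shows "smooth_on S (\<lambda>x. q x (V x))"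
proof (rule smooth_on_congI[OF S])
  show "smooth_on S (\<lambda>x. \<Sum>b\<in>Basis. (V x \<bullet> b) *\<^sub>R q x b)"
    using assms by (intro smooth_on_sum smooth_on_scaleR smooth_on_inner smooth_on_const) auto
  show "(\<Sum>b\<in>Basis. (V x \<bullet> b) *\<^sub>R q x b) = q x (V x)" if "x \<in> S" for x
    using linear_euclidean_sum[OF assms(2)[OF that], of "V x"] by simp
qed

lemma smooth_on_ddir_field:
  fixes f :: "'e::euclidean_space \<Rightarrow> 'b::real_normed_vector"
  assumes "open S" "smooth_on S f" "smooth_on S V"
  shows "smooth_on S (\<lambda>x. ddir f x (V x))"
  by (rule smooth_on_linear_family[where q = "ddir f", OF assms(1) smooth_on_linear_ddir smooth_on_ddir])
    (use assms in auto)

text \<open>Product rule for evaluation, again by expansion in \<open>Basis\<close>. The derivative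
  of the family is taken with the argument frozen at \<open>V x\<close>, which is the form in which
  Christoffel terms appear later.\<close>

lemma has_derivative_linear_family:
  fixes q :: "'a::real_normed_vector \<Rightarrow> 'e::euclidean_space \<Rightarrow> 'b::real_normed_vector"
  assumes S: "open S" "x \<in> S" and lin: "\<And>x. x \<in> S \<Longrightarrow> linear (q x)"
    and q: "\<And>v. smooth_on S (\<lambda>x. q x v)" and V: "smooth_on S V"
  shows "((\<lambda>x. q x (V x)) has_derivative (\<lambda>u. ddir (\<lambda>y. q y (V x)) x u + q x (ddir V x u))) (at x)"
proof -
  have D: "((\<lambda>x. \<Sum>b\<in>Basis. (V x \<bullet> b) *\<^sub>R q x b) has_derivative
      (\<lambda>u. \<Sum>b\<in>Basis. (V x \<bullet> b) *\<^sub>R ddir (\<lambda>x. q x b) x u + (ddir V x u \<bullet> b) *\<^sub>R q x b)) (at x)"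
    using smooth_onD[OF q S(2)] smooth_onD[OF V S(2)]
    by (auto intro!: derivative_eq_intros simp: fun_eq_iff)
  have D1: "((\<lambda>x. \<Sum>b\<in>Basis. (w \<bullet> b) *\<^sub>R q x b) has_derivative
      (\<lambda>u. \<Sum>b\<in>Basis. (w \<bullet> b) *\<^sub>R ddir (\<lambda>x. q x b) x u)) (at x)" for w
    using smooth_onD[OF q S(2)] by (auto intro!: derivative_eq_intros simp: fun_eq_iff)
  have "((\<lambda>x. q x w) has_derivative (\<lambda>u. \<Sum>b\<in>Basis. (w \<bullet> b) *\<^sub>R ddir (\<lambda>x. q x b) x u)) (at x)" for w
    by (rule has_derivative_transform_within_open[OF D1 S])
      (rule linear_euclidean_sum[OF lin, symmetric])
  then have E: "ddir (\<lambda>x. q x w) x = (\<lambda>u. \<Sum>b\<in>Basis. (w \<bullet> b) *\<^sub>R ddir (\<lambda>x. q x b) x u)" for w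
    by (rule ddir_eqI)
  have "((\<lambda>x. q x (V x)) has_derivative
      (\<lambda>u. \<Sum>b\<in>Basis. (V x \<bullet> b) *\<^sub>R ddir (\<lambda>x. q x b) x u + (ddir V x u \<bullet> b) *\<^sub>R q x b)) (at x)"
    by (rule has_derivative_transform_within_open[OF D S])
      (rule linear_euclidean_sum[OF lin, symmetric])
  moreover have "(\<Sum>b\<in>Basis. (ddir V x u \<bullet> b) *\<^sub>R q x b) = q x (ddir V x u)" for u
    by (rule linear_euclidean_sum[OF lin[OF S(2)], symmetric])
  ultimately show ?thesis
    by (simp add: sum.distrib E[of "V x"])
qed

lemma ddir_linear_family:
  fixes q :: "'a::real_normed_vector \<Rightarrow> 'e::euclidean_space \<Rightarrow> 'b::real_normed_vector"
  assumes "open S" "x \<in> S" "\<And>x. x \<in> S \<Longrightarrow> linear (q x)"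
    "\<And>v. smooth_on S (\<lambda>x. q x v)" "smooth_on S V"
  shows "ddir (\<lambda>x. q x (V x)) x u = ddir (\<lambda>y. q y (V x)) x u + q x (ddir V x u)"
  using ddir_eqI[OF has_derivative_linear_family[OF assms]] by simp

lemma ddir_ddir_field:
  fixes f :: "'e::euclidean_space \<Rightarrow> 'b::real_normed_vector"
  assumes "open S" "x \<in> S" "smooth_on S f" "smooth_on S V"
  shows "ddir (\<lambda>y. ddir f y (V y)) x u = ddir (\<lambda>y. ddir f y (V x)) x u + ddir f x (ddir V x u)"
  by (rule ddir_linear_family[where q = "ddir f", OF assms(1,2) smooth_on_linear_ddir smooth_on_ddir])
    (use assms in auto)

lemma ddir_bounded_linear:
  assumes "bounded_linear L" "smooth_on S f" "x \<in> S"
  shows "ddir (\<lambda>y. L (f y)) x u = L (ddir f x u)"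
  using ddir_eqI[OF bounded_linear.has_derivative[OF assms(1) smooth_onD[OF assms(2,3)]]] by simp

lemma ddir_compose:
  assumes "smooth_on T g" "smooth_on S f" "x \<in> S" "f x \<in> T"
  shows "ddir (\<lambda>y. g (f y)) x u = ddir g (f x) (ddir f x u)"
  using ddir_eqI[OF has_derivative_compose[OF smooth_onD[OF assms(2,3)] smooth_onD[OF assms(1,4)]]] by simp

section \<open>Symmetry of second derivatives\<close>

lemma mixed_difference_mean_value:
  fixes f :: "'e::real_normed_vector \<Rightarrow> real"
  assumes f: "smooth_on S f" and r: "0 < r"
    and sub: "\<And>s t. 0 \<le> s \<Longrightarrow> s \<le> r \<Longrightarrow> 0 \<le> t \<Longrightarrow> t \<le> r \<Longrightarrow> x + s *\<^sub>R u + t *\<^sub>R v \<in> S"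
  shows "\<exists>s t. 0 < s \<and> s < r \<and> 0 < t \<and> t < r \<and>
    f (x + r *\<^sub>R u + r *\<^sub>R v) - f (x + r *\<^sub>R u) - f (x + r *\<^sub>R v) + f x
      = r * r * ddir (\<lambda>y. ddir f y u) (x + s *\<^sub>R u + t *\<^sub>R v) v"
proof -
  have D1: "((\<lambda>s. h (x + s *\<^sub>R u + t *\<^sub>R v)) has_real_derivative ddir h (x + s *\<^sub>R u + t *\<^sub>R v) u) (at s)"
    if "smooth_on S h" "0 \<le> s" "s \<le> r" "0 \<le> t" "t \<le> r" for s t and h :: "'e \<Rightarrow> real"
  proof -
    have h: "(h has_derivative ddir h (x + s *\<^sub>R u + t *\<^sub>R v)) (at (x + s *\<^sub>R u + t *\<^sub>R v))"
      using smooth_onD that sub by blast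
    have "((\<lambda>s. h (x + s *\<^sub>R u + t *\<^sub>R v)) has_derivative (\<lambda>k. ddir h (x + s *\<^sub>R u + t *\<^sub>R v) (k *\<^sub>R u))) (at s)"
      by (rule has_derivative_compose[where f = "\<lambda>s. x + s *\<^sub>R u + t *\<^sub>R v" and g = h, OF _ h])
        (auto intro!: derivative_eq_intros)
    then show ?thesis
      using linear_cmul[OF has_derivative_linear[OF h]]
      by (simp add: has_field_derivative_def mult_commute_abs)
  qed
  have D2: "((\<lambda>t. h (x + s *\<^sub>R u + t *\<^sub>R v)) has_real_derivative ddir h (x + s *\<^sub>R u + t *\<^sub>R v) v) (at t)"
    if "smooth_on S h" "0 \<le> s" "s \<le> r" "0 \<le> t" "t \<le> r" for s t and h :: "'e \<Rightarrow> real"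
  proof -
    have h: "(h has_derivative ddir h (x + s *\<^sub>R u + t *\<^sub>R v)) (at (x + s *\<^sub>R u + t *\<^sub>R v))"
      using smooth_onD that sub by blast
    have "((\<lambda>t. h (x + s *\<^sub>R u + t *\<^sub>R v)) has_derivative (\<lambda>k. ddir h (x + s *\<^sub>R u + t *\<^sub>R v) (k *\<^sub>R v))) (at t)"
      by (rule has_derivative_compose[where f = "\<lambda>t. x + s *\<^sub>R u + t *\<^sub>R v" and g = h, OF _ h])
        (auto intro!: derivative_eq_intros)
    then show ?thesis
      using linear_cmul[OF has_derivative_linear[OF h]]
      by (simp add: has_field_derivative_def mult_commute_abs)
  qed
  \<comment> \<open>The second difference is the increment of this first difference in direction v.
    The mean value theorem is applied to \<open>p\<close> in direction u, then to the derivative of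
    \<open>f\<close> along u in direction v.\<close>
  define p where "p s = f (x + s *\<^sub>R u + r *\<^sub>R v) - f (x + s *\<^sub>R u + 0 *\<^sub>R v)" for s
  have "(p has_real_derivative (ddir f (x + s *\<^sub>R u + r *\<^sub>R v) u - ddir f (x + s *\<^sub>R u + 0 *\<^sub>R v) u)) (at s)"
    if "0 \<le> s" "s \<le> r" for s
    unfolding p_def using r that by (intro DERIV_diff D1[OF f]) auto
  from MVT2[OF r this] obtain s where s: "0 < s" "s < r"
    "p r - p 0 = r * (ddir f (x + s *\<^sub>R u + r *\<^sub>R v) u - ddir f (x + s *\<^sub>R u + 0 *\<^sub>R v) u)"
    by auto
  have "\<exists>t>0. t < r \<and> ddir f (x + s *\<^sub>R u + r *\<^sub>R v) u - ddir f (x + s *\<^sub>R u + 0 *\<^sub>R v) u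
      = (r - 0) * ddir (\<lambda>y. ddir f y u) (x + s *\<^sub>R u + t *\<^sub>R v) v"
    by (rule MVT2[OF r]) (use D2[OF smooth_on_ddir[OF f]] s in auto)
  then obtain t where t: "0 < t" "t < r"
    "ddir f (x + s *\<^sub>R u + r *\<^sub>R v) u - ddir f (x + s *\<^sub>R u + 0 *\<^sub>R v) u
      = r * ddir (\<lambda>y. ddir f y u) (x + s *\<^sub>R u + t *\<^sub>R v) v" by auto
  show ?thesis
    using s t by (intro exI[of _ s] exI[of _ t]) (simp add: p_def)
qed

text \<open>The second difference is symmetric in u and v, so the mean value formula evaluates it in
  two ways, as r * r times either mixed derivative at a point near x. Continuity of both as r
  shrinks gives equality.\<close>

lemma ddir_ddir_commute_real:
  fixes f :: "'e::real_normed_vector \<Rightarrow> real"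
  assumes S: "open S" "x \<in> S" and f: "smooth_on S f"
  shows "ddir (\<lambda>y. ddir f y u) x v = ddir (\<lambda>y. ddir f y v) x u"
proof -
  define a where "a y = ddir (\<lambda>y. ddir f y u) y v" for y
  define b where "b y = ddir (\<lambda>y. ddir f y v) y u" for y
  have "isCont a x" "isCont b x"
    unfolding a_def b_def
    using smooth_on_continuous[OF smooth_on_ddir[OF smooth_on_ddir[OF f]]] S
    by (simp_all add: continuous_on_eq_continuous_at)
  then have cont: "((\<lambda>y. \<bar>a y - a x\<bar>) \<longlongrightarrow> 0) (at x)" "((\<lambda>y. \<bar>b y - b x\<bar>) \<longlongrightarrow> 0) (at x)"
    by (auto simp: isCont_def tendsto_rabs_zero_iff LIM_zero_iff)
  have "\<bar>a x - b x\<bar> \<le> e" if e: "e > 0" for e :: real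
  proof -
    have "\<exists>d>0. \<forall>y. dist y x < d \<longrightarrow> \<bar>a y - a x\<bar> < e / 2"
      using \<open>isCont a x\<close> e unfolding continuous_at_eps_delta dist_real_def
      by (metis half_gt_zero)
    then obtain d1 where d1: "d1 > 0" "\<And>y. dist y x < d1 \<Longrightarrow> \<bar>a y - a x\<bar> < e / 2" by blast
    have "\<exists>d>0. \<forall>y. dist y x < d \<longrightarrow> \<bar>b y - b x\<bar> < e / 2"
      using \<open>isCont b x\<close> e unfolding continuous_at_eps_delta dist_real_def
      by (metis half_gt_zero)
    then obtain d2 where d2: "d2 > 0" "\<And>y. dist y x < d2 \<Longrightarrow> \<bar>b y - b x\<bar> < e / 2" by blast
    obtain d3 where d3: "d3 > 0" "ball x d3 \<subseteq> S" using S openE by blast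
    define d where "d = min d1 (min d2 d3)"
    \<comment> \<open>Chosen so that the whole parallelogram with sides r u and r v stays within
      distance d of x; the summand 1 keeps the denominator positive when u = v = 0.\<close>
    define r where "r = d / (2 * (norm u + norm v + 1))"
    have d: "d > 0" using d1 d2 d3 by (simp add: d_def)
    have r: "r > 0" using d by (simp add: r_def add_nonneg_pos)
    have near: "dist (x + s *\<^sub>R u + t *\<^sub>R v) x < d" if "0 \<le> s" "s \<le> r" "0 \<le> t" "t \<le> r" for s t
    proof -
      have "dist (x + s *\<^sub>R u + t *\<^sub>R v) x = norm (s *\<^sub>R u + t *\<^sub>R v)"
        by (simp add: dist_norm)
      also have "\<dots> \<le> s * norm u + t * norm v"
        using that norm_triangle_ineq[of "s *\<^sub>R u" "t *\<^sub>R v"] by simp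
      also have "\<dots> \<le> r * norm u + r * norm v"
        using that by (intro add_mono mult_right_mono) auto
      also have "\<dots> < r * (2 * (norm u + norm v + 1))"
        proof -
        have "0 \<le> r * norm u" "0 \<le> r * norm v" using r by simp_all
        then have "0 < r * norm u + (r * norm v + r * 2)" using r by linarith
        then show ?thesis by (simp add: algebra_simps)
      qed
      also have "\<dots> = d"
        unfolding r_def using norm_ge_zero[of u] norm_ge_zero[of v]
        by (simp add: add_nonneg_eq_0_iff)
      finally show ?thesis .
    qed
    have S1: "x + s *\<^sub>R u + t *\<^sub>R v \<in> S" if "0 \<le> s" "s \<le> r" "0 \<le> t" "t \<le> r" for s t
      using near[OF that] d3(2) by (auto simp: d_def dist_commute)
    then have S2: "x + s *\<^sub>R v + t *\<^sub>R u \<in> S" if "0 \<le> s" "s \<le> r" "0 \<le> t" "t \<le> r" for s t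
      using that by (metis add.assoc add.commute)
    obtain s t where st: "0 < s" "s < r" "0 < t" "t < r"
      "f (x + r *\<^sub>R u + r *\<^sub>R v) - f (x + r *\<^sub>R u) - f (x + r *\<^sub>R v) + f x
        = r * r * a (x + s *\<^sub>R u + t *\<^sub>R v)"
      using mixed_difference_mean_value[OF f r S1] unfolding a_def by blast
    obtain s' t' where st': "0 < s'" "s' < r" "0 < t'" "t' < r"
      "f (x + r *\<^sub>R v + r *\<^sub>R u) - f (x + r *\<^sub>R v) - f (x + r *\<^sub>R u) + f x
        = r * r * b (x + s' *\<^sub>R v + t' *\<^sub>R u)"
      using mixed_difference_mean_value[OF f r S2] unfolding b_def by blast
    have "r * r * a (x + s *\<^sub>R u + t *\<^sub>R v) = r * r * b (x + s' *\<^sub>R v + t' *\<^sub>R u)"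
      unfolding st(5)[symmetric] st'(5)[symmetric] by (simp add: algebra_simps)
    then have "a (x + s *\<^sub>R u + t *\<^sub>R v) = b (x + t' *\<^sub>R u + s' *\<^sub>R v)"
      using r by (simp add: algebra_simps)
    moreover have "\<bar>a (x + s *\<^sub>R u + t *\<^sub>R v) - a x\<bar> < e / 2" "\<bar>b (x + t' *\<^sub>R u + s' *\<^sub>R v) - b x\<bar> < e / 2"
      using st(1-4) st'(1-4) near[of s t] near[of t' s'] by (auto simp: d_def intro: d1(2) d2(2) simp del: less_divide_eq_numeral1)
    ultimately show ?thesis by linarith
  qed
  then have "\<bar>a x - b x\<bar> \<le> 0" by (rule field_le_epsilon[of _ 0, simplified]) 
  then show ?thesis by (simp add: a_def b_def)
qed

lemma ddir_ddir_commute: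
  fixes f :: "'e::real_normed_vector \<Rightarrow> 'b::euclidean_space"
  assumes S: "open S" "x \<in> S" and f: "smooth_on S f"
  shows "ddir (\<lambda>y. ddir f y u) x v = ddir (\<lambda>y. ddir f y v) x u"
proof (rule euclidean_eqI)
  fix b :: 'b
  have g: "smooth_on S (\<lambda>y. f y \<bullet> b)"
    by (rule smooth_on_linear[OF bounded_linear_inner_left S(1) f])
  have *: "ddir (\<lambda>y. ddir f y w) x w' \<bullet> b = ddir (\<lambda>y. ddir (\<lambda>y. f y \<bullet> b) y w) x w'" for w w'
  proof -
    have "ddir (\<lambda>y. ddir f y w) x w' \<bullet> b = ddir (\<lambda>y. ddir f y w \<bullet> b) x w'"
      by (rule ddir_bounded_linear[OF bounded_linear_inner_left smooth_on_ddir[OF f] S(2), symmetric])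
    also have "\<dots> = ddir (\<lambda>y. ddir (\<lambda>y. f y \<bullet> b) y w) x w'"
      by (rule fun_cong[OF ddir_cong[OF S]])
        (rule ddir_bounded_linear[OF bounded_linear_inner_left f, symmetric])
    finally show ?thesis .
  qed
  show "ddir (\<lambda>y. ddir f y u) x v \<bullet> b = ddir (\<lambda>y. ddir f y v) x u \<bullet> b"
    unfolding * by (rule ddir_ddir_commute_real[OF S g])
qed

text \<open>Each iterated derivative is a second derivative with frozen direction plus a first-order
  term; the second derivatives cancel by symmetry and the first-order terms form the
  bracket.\<close>

lemma ddir_commutator:
  fixes h :: "'e::euclidean_space \<Rightarrow> 'b::euclidean_space"
  assumes "open S" "x \<in> S" "smooth_on S h" "smooth_on S X" "smooth_on S Y"
  shows "ddir (\<lambda>y. ddir h y (Y y)) x (X x) - ddir (\<lambda>y. ddir h y (X y)) x (Y x)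
    = ddir h x (lie_bracket X Y x)"
  using ddir_ddir_field[OF assms(1-3,5), of "X x"] ddir_ddir_field[OF assms(1-4), of "Y x"]
    ddir_ddir_commute[OF assms(1-3), of "Y x" "X x"] smooth_on_linear_ddir[OF assms(3,2)]
  by (simp add: lie_bracket_def linear_diff)

section \<open>Linear isomorphisms and matrices with smooth entries\<close>

lemma linear_injective_imp_surj:
  fixes f :: "'a::euclidean_space \<Rightarrow> 'b::euclidean_space"
  assumes "linear f" "inj f" "DIM('b) = DIM('a)"
  shows "surj f"
proof -
  have "dim (range f) = DIM('b)"
    using dim_image_eq[OF assms(1), of UNIV] assms(2,3) by simp
  then have "span (range f) = UNIV" by (simp only: dim_eq_full)
  moreover have "subspace (range f)"
    using linear_subspace_image[OF assms(1) subspace_UNIV] .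
  ultimately show ?thesis by (metis span_eq_iff)
qed

lemma ex_linear_isomorphism:
  assumes "DIM('a::euclidean_space) = DIM('b::euclidean_space)"
  shows "\<exists>(f :: 'a \<Rightarrow> 'b) f'. linear f \<and> linear f' \<and> (\<forall>v. f' (f v) = v) \<and> (\<forall>v. f (f' v) = v)"
  by (rule isomorphisms_UNIV_UNIV[OF assms]) blast

lemma smooth_on_vec_nth: "open S \<Longrightarrow> smooth_on S f \<Longrightarrow> smooth_on S (\<lambda>x. f x $ i)"
  by (rule smooth_on_linear[OF bounded_linear_vec_nth])

lemma bounded_linear_axis: "bounded_linear (axis i :: 'a::euclidean_space \<Rightarrow> 'a^'n)"
  by (rule linear_conv_bounded_linear[THEN iffD1], rule linearI) (auto simp: axis_def vec_eq_iff)

lemma smooth_on_vec: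
  fixes f :: "'n::finite \<Rightarrow> 'a::real_normed_vector \<Rightarrow> 'b::euclidean_space"
  assumes S: "open S" and f: "\<And>i. smooth_on S (f i)"
  shows "smooth_on S (\<lambda>x. \<chi> i. f i x)"
proof -
  have "(\<chi> i. f i x) = (\<Sum>i\<in>UNIV. axis i (f i x))" for x
    by (simp add: vec_eq_iff axis_def)
  then show ?thesis
    using smooth_on_sum[OF S smooth_on_linear[OF bounded_linear_axis S f], where I = UNIV] by simp
qed

lemma smooth_on_det:
  fixes A :: "'a::real_normed_vector \<Rightarrow> real^'n^'n"
  assumes S: "open S" and A: "\<And>i j. smooth_on S (\<lambda>x. A x $ i $ j)"
  shows "smooth_on S (\<lambda>x. det (A x))"
proof -
  have pr: "smooth_on S (\<lambda>x. \<Prod>i\<in>UNIV. A x $ i $ p i)" for p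
    using smooth_on_prod[OF S, of UNIV "\<lambda>i x. A x $ i $ p i"] A by blast
  have "smooth_on S (\<lambda>x. of_int (sign p) * (\<Prod>i\<in>UNIV. A x $ i $ p i))" for p
    by (rule smooth_on_mult[OF S smooth_on_const pr])
  then have sm: "smooth_on S (\<lambda>x. \<Sum>p | p permutes UNIV. of_int (sign p) * (\<Prod>i\<in>UNIV. A x $ i $ p i))"
    by (rule smooth_on_sum[OF S])
  have "det (A x) = (\<Sum>p | p permutes UNIV. of_int (sign p) * (\<Prod>i\<in>UNIV. A x $ i $ p i))" for x
    by (rule det_def)
  then show ?thesis using sm by (simp only:)
qed

text \<open>Smoothness of the solution follows from Cramer's rule; the type \<open>'k\<close> only
  serves as an index set for matrices.\<close>

lemma smooth_on_linear_solve:
  fixes q :: "'e::real_normed_vector \<Rightarrow> 'a::euclidean_space \<Rightarrow> 'b::euclidean_space"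
  assumes S: "open S" and k: "CARD('k::finite) = DIM('a)" and dim: "DIM('b) = DIM('a)"
    and lin: "\<And>x. x \<in> S \<Longrightarrow> linear (q x)" and inj: "\<And>x. x \<in> S \<Longrightarrow> inj (q x)"
    and q: "\<And>v. smooth_on S (\<lambda>x. q x v)" and h: "smooth_on S h"
    and y: "\<And>x. x \<in> S \<Longrightarrow> q x (y x) = h x"
  shows "smooth_on S y"
proof -
  have dim_k: "DIM(real^'k) = DIM('a)" "DIM('b) = DIM(real^'k)" using k dim by simp_all
  obtain \<alpha> :: "real^'k \<Rightarrow> 'a" and \<alpha>' where \<alpha>: "linear \<alpha>" "linear \<alpha>'" "\<And>v. \<alpha>' (\<alpha> v) = v" "\<And>v. \<alpha> (\<alpha>' v) = v"
    using ex_linear_isomorphism[OF dim_k(1)] by blast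
  obtain \<beta> :: "'b \<Rightarrow> real^'k" and \<beta>' where \<beta>: "linear \<beta>" "linear \<beta>'" "\<And>v. \<beta>' (\<beta> v) = v" "\<And>v. \<beta> (\<beta>' v) = v"
    using ex_linear_isomorphism[OF dim_k(2)] by blast
  define A where "A x = matrix (\<lambda>v. \<beta> (q x (\<alpha> v)))" for x
  have linA: "linear (\<lambda>v. \<beta> (q x (\<alpha> v)))" if "x \<in> S" for x
    using linear_compose[OF linear_compose[OF \<alpha>(1) lin[OF that]] \<beta>(1)] by (simp add: o_def)
  have det: "det (A x) \<noteq> 0" if "x \<in> S" for x
  proof -
    have "inj (\<lambda>v. \<beta> (q x (\<alpha> v)))"
      using inj_compose[OF inj_compose[OF inj_on_inverseI[of UNIV \<beta>' \<beta>] inj[OF that]] inj_on_inverseI[of UNIV \<alpha>' \<alpha>]]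
        \<alpha>(3) \<beta>(3) by (simp add: o_def)
    then show ?thesis using linA[OF that] by (simp add: A_def det_nz_iff_inj)
  qed
  have sol: "y x = \<alpha> (\<chi> k. det (\<chi> i j. if j = k then \<beta> (h x) $ i else A x $ i $ j) / det (A x))" if x: "x \<in> S" for x
  proof -
    have "A x *v \<alpha>' (y x) = \<beta> (h x)"
      using x by (simp add: A_def matrix_works linear_matrix_vector_mul_eq linA \<alpha> y)
    then have *: "\<alpha>' (y x) = (\<chi> k. det (\<chi> i j. if j = k then \<beta> (h x) $ i else A x $ i $ j) / det (A x))"
      by (rule iffD1[OF cramer[OF det[OF x]]])
    show ?thesis unfolding *[symmetric] \<alpha>(4) ..
  qed
  have bl: "bounded_linear \<alpha>" "bounded_linear \<beta>"
    using \<alpha>(1) \<beta>(1) linear_conv_bounded_linear by blast+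
  have "A x $ i $ j = \<beta> (q x (\<alpha> (axis j 1))) $ i" for x i j
    by (simp add: A_def matrix_def)
  then have sA: "smooth_on S (\<lambda>x. A x $ i $ j)" for i j
    using smooth_on_vec_nth[OF S smooth_on_linear[OF bl(2) S q[of "\<alpha> (axis j 1)"]], of i] by simp
  have sh: "smooth_on S (\<lambda>x. \<beta> (h x) $ i)" for i
    by (rule smooth_on_vec_nth[OF S smooth_on_linear[OF bl(2) S h]])
  have "smooth_on S (\<lambda>x. \<alpha> (\<chi> k. det (\<chi> i j. if j = k then \<beta> (h x) $ i else A x $ i $ j) / det (A x)))"
  proof (rule smooth_on_linear[OF bl(1) S])
    show "smooth_on S (\<lambda>x. \<chi> k. det (\<chi> i j. if j = k then \<beta> (h x) $ i else A x $ i $ j) / det (A x))"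
    proof (rule smooth_on_vec[OF S], rule smooth_on_divide[OF S smooth_on_det[OF S] smooth_on_det[OF S]])
      show "smooth_on S (\<lambda>x. (\<chi> i j. if j = k then \<beta> (h x) $ i else A x $ i $ j) $ i $ j)" for k i j
        using sA sh by (cases "j = k") auto
    qed (use sA det in auto)
  qed
  then show ?thesis
    by (rule smooth_on_congI[OF S]) (rule sol[symmetric])
qed

section \<open>Derivatives of determinants and of the induced volume\<close>

lemma has_derivative_det:
  fixes R :: "'k::finite \<Rightarrow> 'a::real_normed_vector \<Rightarrow> real^'k"
  assumes R: "\<And>i. (R i has_derivative R' i) (at x)"
  shows "((\<lambda>y. det (\<chi> i. R i y)) has_derivative
    (\<lambda>u. \<Sum>i\<in>UNIV. det (\<chi> j. if j = i then R' i u else R j x))) (at x)"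
proof -
  have D: "((\<lambda>y. R i y $ j) has_derivative (\<lambda>u. R' i u $ j)) (at x)" for i j
    by (rule bounded_linear.has_derivative[OF bounded_linear_vec_nth R])
  have "((\<lambda>y. \<Sum>p | p permutes (UNIV :: 'k set). of_int (sign p) * (\<Prod>i\<in>UNIV. R i y $ p i)) has_derivative
      (\<lambda>u. \<Sum>p | p permutes (UNIV :: 'k set). of_int (sign p) * (\<Sum>i\<in>UNIV. R' i u $ p i * (\<Prod>j\<in>UNIV - {i}. R j x $ p j)))) (at x)"
    by (intro has_derivative_sum has_derivative_mult_right has_derivative_prod D)
  moreover have "(\<Sum>p | p permutes (UNIV :: 'k set). of_int (sign p) * (\<Sum>i\<in>UNIV. R' i u $ p i * (\<Prod>j\<in>UNIV - {i}. R j x $ p j)))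
      = (\<Sum>i\<in>UNIV. det (\<chi> j. if j = i then R' i u else R j x))" for u
  proof -
    have "R' i u $ p i * (\<Prod>j\<in>UNIV - {i}. R j x $ p j) = (\<Prod>j\<in>UNIV. (if j = i then R' i u else R j x) $ p j)" for i p
      by (subst prod.remove[of UNIV i]) (auto intro: prod.cong)
    then have "of_int (sign p) * (\<Sum>i\<in>UNIV. R' i u $ p i * (\<Prod>j\<in>UNIV - {i}. R j x $ p j))
      = (\<Sum>i\<in>UNIV. of_int (sign p) * (\<Prod>j\<in>UNIV. (if j = i then R' i u else R j x) $ p j))" for p
      by (simp add: sum_distrib_left)
    then show ?thesis
      unfolding det_def by (simp add: sum.swap[of _ _ UNIV])
  qed
  ultimately show ?thesis
    by (simp add: det_def)
qed

lemma sum_option: "(\<Sum>i\<in>(UNIV :: 'n::finite option set). h i) = h None + (\<Sum>j\<in>UNIV. h (Some j))"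
  by (simp add: UNIV_option_conv sum.reindex)

text \<open>The determinant is differentiated row by row, and each row matters only modulo the span
  of the others. In row \<open>None\<close> the tangential vector d\<phi>(w) is a combination of the
  other rows, since w lies in the span of the fields; in row \<open>Some l\<close> the multiple of
  \<xi> is absorbed by row \<open>None\<close>.\<close>

lemma induced_volume_derivative:
  fixes \<phi> \<xi> :: "'e::euclidean_space \<Rightarrow> real^('n::finite) option" and X :: "'n \<Rightarrow> 'e \<Rightarrow> 'e"
  assumes S: "open S" and x: "x \<in> S" and \<phi>: "smooth_on S \<phi>" and \<xi>: "smooth_on S \<xi>"
    and X: "\<And>i. smooth_on S (X i)"
    and dX: "\<And>i. ddir (\<lambda>y. ddir \<phi> y (X i y)) x u = ddir \<phi> x (V i) + k i *\<^sub>R \<xi> x"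
    and d\<xi>: "ddir \<xi> x u = ddir \<phi> x w + s *\<^sub>R \<xi> x" and w: "w \<in> span (range (\<lambda>i. X i x))"
  shows "ddir (\<lambda>y. induced_volume \<phi> \<xi> y (\<lambda>i. X i y)) x u
    = s * induced_volume \<phi> \<xi> x (\<lambda>i. X i x) + (\<Sum>i\<in>UNIV. induced_volume \<phi> \<xi> x ((\<lambda>j. X j x)(i := V i)))"
proof -
  define R where "R i y = (case i of None \<Rightarrow> \<xi> y | Some j \<Rightarrow> ddir \<phi> y (X j y))" for i y
  define R' where "R' i v = (case i of None \<Rightarrow> ddir \<xi> x v | Some j \<Rightarrow> ddir (\<lambda>y. ddir \<phi> y (X j y)) x v)" for i v
  have RD: "(R i has_derivative R' i) (at x)" for i
    unfolding R_def R'_def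
    using smooth_onD[OF \<xi> x] smooth_onD[OF smooth_on_ddir_field[OF S \<phi> X] x]
    by (cases i) auto
  have "ddir \<phi> x w \<in> span (ddir \<phi> x ` range (\<lambda>i. X i x))"
    using w linear_span_image[OF smooth_on_linear_ddir[OF \<phi> x]] by blast
  moreover have "ddir \<phi> x ` range (\<lambda>i. X i x) \<subseteq> {row j (\<chi> i. R i x) |j. j \<noteq> None}"
  proof
    fix z assume "z \<in> ddir \<phi> x ` range (\<lambda>i. X i x)"
    then obtain j where "z = ddir \<phi> x (X j x)" by blast
    then have "z = row (Some j) (\<chi> i. R i x)" by (simp add: row_def R_def vec_eq_iff)
    then show "z \<in> {row j (\<chi> i. R i x) |j. j \<noteq> None}" by blast
  qed
  ultimately have w_rows: "ddir \<phi> x w \<in> span {row j (\<chi> i. R i x) |j. j \<noteq> None}"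
    using span_mono by blast
  have None_row: "det (\<chi> j. if j = None then R' None u else R j x) = s * det (\<chi> j. R j x)"
  proof -
    define A where "A = (\<chi> j. if j = None then s *\<^sub>R \<xi> x else R j x)"
    have rows: "row k A = (if k = None then s *\<^sub>R \<xi> x else R k x)" for k
      by (simp add: A_def row_def vec_eq_iff)
    have "{row j A |j. j \<noteq> None} = {row j (\<chi> i. R i x) |j. j \<noteq> None}"
      by (rule Collect_cong) (auto simp: A_def row_def)
    then have "ddir \<phi> x w \<in> span {row j A |j. j \<noteq> None}"
      using w_rows by simp
    then have "det (\<chi> k. if k = None then row None A + ddir \<phi> x w else row k A) = det A"
      unfolding span_vec_eq[symmetric] by (rule det_row_span)
    moreover have "(\<chi> k. if k = None then row None A + ddir \<phi> x w else row k A)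
        = (\<chi> j. if j = None then R' None u else R j x)"
      by (simp add: rows R'_def d\<xi> vec_eq_iff)
    moreover have "det A = s * det (\<chi> j. if j = None then \<xi> x else R j x)"
      unfolding A_def using det_row_mul[of None s "\<lambda>_. \<xi> x" "\<lambda>j. R j x"]
      by (simp only: scalar_mult_eq_scaleR)
    moreover have "(\<chi> j. if j = None then \<xi> x else R j x) = (\<chi> j. R j x)"
      by (simp add: vec_eq_iff R_def)
    ultimately show ?thesis by simp
  qed
  have Some_row: "det (\<chi> j. if j = Some l then R' (Some l) u else R j x)
      = induced_volume \<phi> \<xi> x ((\<lambda>j. X j x)(l := V l))" for l
  proof -
    define A where "A = (\<chi> j. if j = Some l then ddir \<phi> x (V l) else R j x)"
    have rows: "row i A = (if i = Some l then ddir \<phi> x (V l) else R i x)" for i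
      by (simp add: A_def row_def vec_eq_iff)
    have "\<xi> x = row None A" by (simp add: rows R_def)
    then have "k l *\<^sub>R \<xi> x \<in> span {row j A |j. j \<noteq> Some l}"
      by (intro span_scale span_base) blast
    then have "det (\<chi> i. if i = Some l then row (Some l) A + k l *\<^sub>R \<xi> x else row i A) = det A"
      unfolding span_vec_eq[symmetric] by (rule det_row_span)
    moreover have "(\<chi> i. if i = Some l then row (Some l) A + k l *\<^sub>R \<xi> x else row i A)
        = (\<chi> j. if j = Some l then R' (Some l) u else R j x)"
      by (simp add: rows R'_def dX vec_eq_iff)
    moreover have "det A = induced_volume \<phi> \<xi> x ((\<lambda>j. X j x)(l := V l))"
      unfolding induced_volume_def A_def
      by (rule arg_cong[where f = det]) (auto simp: vec_eq_iff R_def split: option.splits)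
    ultimately show ?thesis by simp
  qed
  have ind: "induced_volume \<phi> \<xi> y (\<lambda>i. X i y) = det (\<chi> i. R i y)" for y
    by (simp add: induced_volume_def R_def)
  show ?thesis
    unfolding ind ddir_eqI[OF has_derivative_det[of R, OF RD]] sum_option None_row Some_row ..
qed

lemma ex_basis_enumeration:
  assumes "DIM('e::euclidean_space) = CARD('n::finite)"
  obtains b :: "'n::finite \<Rightarrow> 'e::euclidean_space" where "bij_betw b UNIV Basis"
  using assms finite_same_card_bij[of "UNIV :: 'n set" "Basis :: 'e set"] by auto

lemma linear_eqI_basis:
  fixes h h' :: "'e::euclidean_space \<Rightarrow> 'b::real_vector"
  assumes "linear h" "linear h'" "bij_betw (b :: 'n \<Rightarrow> 'e) UNIV Basis" "\<And>i. h (b i) = h' (b i)"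
  shows "h = h'"
proof
  fix v
  have "h c = h' c" if "c \<in> Basis" for c
    using assms(3,4) that by (metis (no_types) bij_betw_def imageE)
  then show "h v = h' v"
    using linear_euclidean_sum[OF assms(1)] linear_euclidean_sum[OF assms(2)]
    by (metis (mono_tags, lifting) sum.cong)
qed

text \<open>The coefficients of a null vector of the Gram matrix define a vector that is
  g-orthogonal to the whole basis, hence zero by nondegeneracy.\<close>

lemma det_gram_nonzero:
  fixes g :: "'e::euclidean_space \<Rightarrow> 'e \<Rightarrow> real" and b :: "'n::finite \<Rightarrow> 'e"
  assumes bil: "bilinear g" and nondeg: "\<And>v. (\<And>u. g u v = 0) \<Longrightarrow> v = 0" and b: "bij_betw b UNIV Basis"
  shows "det (\<chi> i j. g (b i) (b j)) \<noteq> 0"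
proof -
  let ?G = "\<chi> i j. g (b i) (b j)"
  have lin: "linear (\<lambda>v. g u v)" "linear (\<lambda>u. g u v)" for u v
    using bil by (auto simp: bilinear_def)
  have "c = 0" if c: "?G *v c = 0" for c
  proof -
    define v where "v = (\<Sum>j\<in>UNIV. c $ j *\<^sub>R b j)"
    have "g (b i) v = (?G *v c) $ i" for i
      unfolding v_def by (simp add: linear_sum[OF lin(1)] linear_cmul[OF lin(1)] matrix_vector_mult_def mult.commute)
    then have "(\<lambda>u. g u v) = (\<lambda>u. 0)"
      by (intro linear_eqI_basis[OF lin(2) linear_zero b]) (simp add: c)
    then have "v = 0" using nondeg by metis
    have "c $ i = v \<bullet> b i" for i
    proof -
      have "b j \<bullet> b i = (if j = i then 1 else 0)" for j
        using inner_Basis[of "b j" "b i"] b unfolding bij_betw_def inj_on_def by force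
      then have "v \<bullet> b i = (\<Sum>j\<in>UNIV. c $ j * (if j = i then 1 else 0))"
        by (simp only: v_def inner_sum_left inner_scaleR_left)
      also have "\<dots> = c $ i"
        by (simp add: if_distrib cong: if_cong)
      finally show ?thesis by simp
    qed
    then show "c = 0" using \<open>v = 0\<close> by (simp add: vec_eq_iff)
  qed
  then have "inj ((*v) ?G)"
    by (subst linear_injective_0) (auto simp: matrix_vector_mul_linear)
  then show ?thesis
    using det_nz_iff_inj[OF matrix_vector_mul_linear, of ?G] by (simp add: matrix_of_matrix_vector_mul)
qed

section \<open>Structure equations of Blaschke immersions\<close>

text \<open>Coordinates of an ambient vector in the moving frame (\<xi>, df). The \<open>inv\<close>
  is a genuine inverse where the frame map is bijective, as it is throughout
  \<open>blaschke_chart\<close>.\<close>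

definition transversal_part :: "('e::euclidean_space \<Rightarrow> 'b::euclidean_space) \<Rightarrow> ('e \<Rightarrow> 'b) \<Rightarrow> 'e \<Rightarrow> 'b \<Rightarrow> real" where
  "transversal_part f \<xi> x a = fst (inv (\<lambda>p. fst p *\<^sub>R \<xi> x + ddir f x (snd p)) a)"

definition tangential_part :: "('e::euclidean_space \<Rightarrow> 'b::euclidean_space) \<Rightarrow> ('e \<Rightarrow> 'b) \<Rightarrow> 'e \<Rightarrow> 'b \<Rightarrow> 'e" where
  "tangential_part f \<xi> x a = snd (inv (\<lambda>p. fst p *\<^sub>R \<xi> x + ddir f x (snd p)) a)"

locale blaschke_chart =
  fixes S :: "'e::euclidean_space set" and f \<xi> :: "'e \<Rightarrow> real^('n::finite) option"
    and \<Gamma> :: "'e \<Rightarrow> 'e \<Rightarrow> 'e \<Rightarrow> 'e" and g :: "'e \<Rightarrow> 'e \<Rightarrow> 'e \<Rightarrow> real" and B :: "'e \<Rightarrow> 'e \<Rightarrow> 'e"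
  assumes open_S: "open S" and blaschke: "Blaschke_on S f \<xi> \<Gamma> g B"
begin

lemma dim: "DIM('e) = CARD('n)" and smooth_f: "smooth_on S f" and smooth_xi: "smooth_on S \<xi>"
  and inj_df: "x \<in> S \<Longrightarrow> inj (ddir f x)" and transversal: "x \<in> S \<Longrightarrow> \<xi> x \<notin> range (ddir f x)"
  and nondegenerate: "x \<in> S \<Longrightarrow> (\<And>u. g x u v = 0) \<Longrightarrow> v = 0"
  and volume: "x \<in> S \<Longrightarrow> \<bar>induced_volume f \<xi> x X\<bar> = sqrt \<bar>det (\<chi> i j. g x (X i) (X j))\<bar>"
  and parallel_vol: "parallel_volume S \<Gamma> (induced_volume f \<xi>)"
  using blaschke unfolding Blaschke_on_def by blast+

lemma linear_df: "x \<in> S \<Longrightarrow> linear (ddir f x)"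
  using smooth_on_linear_ddir[OF smooth_f] .

lemma connection: "connection_on S \<Gamma>"
  using blaschke unfolding Blaschke_on_def induced_structure_def by blast

lemma bilinear_g: "x \<in> S \<Longrightarrow> bilinear (g x)"
  using blaschke unfolding Blaschke_on_def induced_structure_def by blast

lemma bilinear_Gamma: "x \<in> S \<Longrightarrow> bilinear (\<Gamma> x)"
  using connection unfolding connection_on_def by blast

lemma gauss:
  assumes "x \<in> S"
  shows "ddir (\<lambda>y. ddir f y v) x u = ddir f x (\<Gamma> x u v) + g x u v *\<^sub>R \<xi> x"
proof -
  from blaschke obtain \<sigma> where "induced_structure S f \<xi> \<Gamma> g B \<sigma>"
    unfolding Blaschke_on_def by blast
  then have "\<forall>X Y. smooth_on S X \<longrightarrow> smooth_on S Y \<longrightarrow>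
      (\<forall>x\<in>S. ddir (\<lambda>y. ddir f y (Y y)) x (X x) = ddir f x (cov \<Gamma> X Y x) + g x (X x) (Y x) *\<^sub>R \<xi> x)"
    unfolding induced_structure_def by blast
  from this[rule_format, of "\<lambda>_. u" "\<lambda>_. v", OF smooth_on_const smooth_on_const assms]
  show ?thesis by (simp add: cov_def)
qed

lemma frame_inj: "x \<in> S \<Longrightarrow> r *\<^sub>R \<xi> x + ddir f x v = 0 \<Longrightarrow> r = 0 \<and> v = 0"
proof -
  assume x: "x \<in> S" and e: "r *\<^sub>R \<xi> x + ddir f x v = 0"
  have "r = 0"
  proof (rule ccontr)
    assume r: "r \<noteq> 0"
    have "\<xi> x = (1 / r) *\<^sub>R (r *\<^sub>R \<xi> x)" using r by simp
    also have "r *\<^sub>R \<xi> x = - ddir f x v" using e by (simp add: eq_neg_iff_add_eq_0)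
    also have "(1 / r) *\<^sub>R (- ddir f x v) = ddir f x ((- 1 / r) *\<^sub>R v)"
      by (simp only: linear_cmul[OF linear_df[OF x]]) simp
    finally show False using transversal[OF x] by blast
  qed
  moreover from this have "v = 0"
    using e inj_df[OF x] linear_df[OF x] by (simp add: linear_injective_0)
  ultimately show ?thesis by simp
qed

lemma linear_frame: "x \<in> S \<Longrightarrow> linear (\<lambda>p. fst p *\<^sub>R \<xi> x + ddir f x (snd p))"
  using linear_df
  by (auto intro!: linearI simp: linear_add linear_cmul algebra_simps)

lemma inj_frame: "x \<in> S \<Longrightarrow> inj (\<lambda>p. fst p *\<^sub>R \<xi> x + ddir f x (snd p))"
  using frame_inj by (subst linear_injective_0[OF linear_frame]) (auto simp: prod_eq_iff)

lemma frame_unique: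
  "x \<in> S \<Longrightarrow> r *\<^sub>R \<xi> x + ddir f x v = r' *\<^sub>R \<xi> x + ddir f x v' \<Longrightarrow> r = r' \<and> v = v'"
  using injD[OF inj_frame, of x "(r, v)" "(r', v')"] by simp

lemma frame_exists: "x \<in> S \<Longrightarrow> \<exists>r v. a = r *\<^sub>R \<xi> x + ddir f x v"
proof -
  assume x: "x \<in> S"
  have "surj (\<lambda>p. fst p *\<^sub>R \<xi> x + ddir f x (snd p))"
    by (rule linear_injective_imp_surj[OF linear_frame[OF x] inj_frame[OF x]]) (simp add: dim)
  from surjD[OF this, of a] show ?thesis by blast
qed

text \<open>The coefficients solve a linear system whose matrix, the frame, is smooth and
  invertible. The lemma is applied both to second derivatives of \<open>f\<close> and to constant
  vectors.\<close>

lemma frame_smooth: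
  assumes h: "smooth_on S h" and e: "\<And>x. x \<in> S \<Longrightarrow> r x *\<^sub>R \<xi> x + ddir f x (Y x) = h x"
  shows "smooth_on S r" and "smooth_on S Y"
proof -
  have *: "smooth_on S (\<lambda>x. (r x, Y x))"
  \<comment> \<open>The index type \<open>'n option\<close> has n + 1 elements, the dimension of the
    pairs (r, Y).\<close>
  proof (rule smooth_on_linear_solve[where 'k = "'n option" and h = h, OF open_S _ _ linear_frame inj_frame _ h])
    show "smooth_on S (\<lambda>x. fst v *\<^sub>R \<xi> x + ddir f x (snd v))" for v :: "real \<times> 'e"
      by (intro smooth_on_add open_S smooth_on_scaleR smooth_on_const smooth_xi smooth_on_ddir smooth_f)
  qed (use e dim in auto)
  show "smooth_on S r" "smooth_on S Y"
    using smooth_on_linear[OF bounded_linear_fst open_S *] smooth_on_linear[OF bounded_linear_snd open_S *] by simp_all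
qed

lemma parts: "x \<in> S \<Longrightarrow> transversal_part f \<xi> x a *\<^sub>R \<xi> x + ddir f x (tangential_part f \<xi> x a) = a"
  unfolding transversal_part_def tangential_part_def
  using surj_f_inv_f[OF linear_injective_imp_surj[OF linear_frame inj_frame], of x a] dim by simp

lemma parts_unique:
  assumes "x \<in> S" "r *\<^sub>R \<xi> x + ddir f x v = a"
  shows "transversal_part f \<xi> x a = r" and "tangential_part f \<xi> x a = v"
  using frame_unique[OF assms(1), of "transversal_part f \<xi> x a" "tangential_part f \<xi> x a" r v]
    parts[OF assms(1), of a] assms(2) by auto

text \<open>\<open>induced_structure\<close> asks only for bilinearity of g at each point;
  smoothness comes from reading g off as the transversal coefficient of the second derivative of
  \<open>f\<close>.\<close>

lemma smooth_g: "smooth_on S (\<lambda>x. g x u v)"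
  by (rule frame_smooth[OF smooth_on_ddir[OF smooth_on_ddir[OF smooth_f, of v], of u], where Y = "\<lambda>x. \<Gamma> x u v"])
    (simp add: gauss)

lemma g_symmetric: "x \<in> S \<Longrightarrow> g x u v = g x v u"
  using frame_unique[of x "g x u v" "\<Gamma> x u v" "g x v u" "\<Gamma> x v u"]
    ddir_ddir_commute[OF open_S _ smooth_f, of x v u] gauss[of x]
  by (simp add: add.commute)

lemma volume_basis_nonzero:
  assumes "x \<in> S" "bij_betw b UNIV Basis"
  shows "induced_volume f \<xi> x b \<noteq> 0"
  using volume[OF assms(1), of b]
    det_gram_nonzero[OF bilinear_g[OF assms(1)] nondegenerate[OF assms(1)] assms(2)] by auto

text \<open>Parallelism of the volume forces \<sigma> = 0: on constant fields the derivative of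
  \<theta> consists of the connection terms plus \<sigma>(u) \<theta>, and \<theta> does not vanish
  on a basis.\<close>

lemma weingarten:
  assumes x: "x \<in> S"
  shows "ddir \<xi> x u = - ddir f x (B x u)"
proof -
  from blaschke obtain \<sigma> where s: "induced_structure S f \<xi> \<Gamma> g B \<sigma>"
    unfolding Blaschke_on_def by blast
  then have "\<forall>X. smooth_on S X \<longrightarrow>
      (\<forall>x\<in>S. ddir \<xi> x (X x) = - ddir f x (B x (X x)) + \<sigma> x (X x) *\<^sub>R \<xi> x)"
    unfolding induced_structure_def by blast
  from this[rule_format, of "\<lambda>_. u", OF smooth_on_const x]
  have w: "ddir \<xi> x u = - ddir f x (B x u) + \<sigma> x u *\<^sub>R \<xi> x" .
  obtain b :: "'n \<Rightarrow> 'e" where b: "bij_betw b UNIV Basis"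
    using ex_basis_enumeration[OF dim] .
  have "\<forall>Y X. smooth_on S Y \<longrightarrow> (\<forall>i. smooth_on S (X i)) \<longrightarrow>
      (\<forall>x\<in>S. ddir (\<lambda>y. induced_volume f \<xi> y (\<lambda>i. X i y)) x (Y x)
        = (\<Sum>i\<in>UNIV. induced_volume f \<xi> x ((\<lambda>j. X j x)(i := cov \<Gamma> Y (X i) x))))"
    using parallel_vol unfolding parallel_volume_def .
  from this[rule_format, of "\<lambda>_. u" "\<lambda>i _. b i", OF smooth_on_const smooth_on_const x]
  have "ddir (\<lambda>y. induced_volume f \<xi> y b) x u = (\<Sum>i\<in>UNIV. induced_volume f \<xi> x (b(i := \<Gamma> x u (b i))))"
    by (simp add: cov_def)
  moreover have "ddir (\<lambda>y. induced_volume f \<xi> y b) x u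
      = \<sigma> x u * induced_volume f \<xi> x b + (\<Sum>i\<in>UNIV. induced_volume f \<xi> x (b(i := \<Gamma> x u (b i))))"
  proof (rule induced_volume_derivative[where X = "\<lambda>i _. b i", OF open_S x smooth_f smooth_xi smooth_on_const gauss[OF x]])
    show "ddir \<xi> x u = ddir f x (- B x u) + \<sigma> x u *\<^sub>R \<xi> x" by (simp add: w linear_neg[OF linear_df[OF x]])
    show "- B x u \<in> span (range b)" using b by (simp add: bij_betw_def)
  qed
  ultimately have "\<sigma> x u * induced_volume f \<xi> x b = 0" by simp
  then have "\<sigma> x u = 0"
    using volume_basis_nonzero[OF x b] by simp
  then show ?thesis using w by simp
qed

lemma smooth_Gamma: "smooth_on S (\<lambda>x. \<Gamma> x u v)"
  using connection unfolding connection_on_def by blast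

text \<open>The Gauss formula is differentiated once more and resolved in the frame. Symmetry of the
  result in u and v is the Gauss equation in the tangential part and the Codazzi equation in the
  transversal part.\<close>

lemma third_derivative:
  assumes x: "x \<in> S"
  shows "ddir (\<lambda>y. ddir (\<lambda>y. ddir f y w) y v) x u
    = (g x u (\<Gamma> x v w) + ddir (\<lambda>y. g y v w) x u) *\<^sub>R \<xi> x
      + ddir f x (\<Gamma> x u (\<Gamma> x v w) + ddir (\<lambda>y. \<Gamma> y v w) x u - g x v w *\<^sub>R B x u)"
proof -
  have "ddir (\<lambda>y. ddir (\<lambda>y. ddir f y w) y v) x = ddir (\<lambda>y. ddir f y (\<Gamma> y v w) + g y v w *\<^sub>R \<xi> y) x"
    by (rule ddir_cong[OF open_S x]) (simp add: gauss)
  moreover have "((\<lambda>y. ddir f y (\<Gamma> y v w) + g y v w *\<^sub>R \<xi> y) has_derivative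
      (\<lambda>u. ddir (\<lambda>y. ddir f y (\<Gamma> y v w)) x u + (g x v w *\<^sub>R ddir \<xi> x u + ddir (\<lambda>y. g y v w) x u *\<^sub>R \<xi> x))) (at x)"
    by (intro has_derivative_add has_derivative_scaleR smooth_onD[OF _ x] smooth_g smooth_xi
        smooth_on_ddir_field open_S smooth_f smooth_Gamma)
  ultimately have "ddir (\<lambda>y. ddir (\<lambda>y. ddir f y w) y v) x u
      = ddir (\<lambda>y. ddir f y (\<Gamma> y v w)) x u + (g x v w *\<^sub>R ddir \<xi> x u + ddir (\<lambda>y. g y v w) x u *\<^sub>R \<xi> x)"
    by (simp add: ddir_eqI)
  then show ?thesis
    by (simp add: ddir_ddir_field[OF open_S x smooth_f smooth_Gamma] gauss[OF x] weingarten[OF x]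
        linear_add[OF linear_df[OF x]] linear_diff[OF linear_df[OF x]] linear_cmul[OF linear_df[OF x]]
        algebra_simps)
qed

lemma gauss_equation:
  assumes x: "x \<in> S"
  shows "(\<Gamma> x u (\<Gamma> x v w) + ddir (\<lambda>y. \<Gamma> y v w) x u) - (\<Gamma> x v (\<Gamma> x u w) + ddir (\<lambda>y. \<Gamma> y u w) x v)
    = g x v w *\<^sub>R B x u - g x u w *\<^sub>R B x v"
proof -
  have "ddir (\<lambda>y. ddir (\<lambda>y. ddir f y w) y v) x u = ddir (\<lambda>y. ddir (\<lambda>y. ddir f y w) y u) x v"
    by (rule ddir_ddir_commute[OF open_S x smooth_on_ddir[OF smooth_f]])
  from this[unfolded third_derivative[OF x]] show ?thesis
    using frame_unique[OF x] by (fastforce simp: algebra_simps)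
qed

text \<open>For flat \<nabla> the Gauss equation reads g(v, w) B u = g(u, w) B v. If B u were
  nonzero, g(u, w) = 0 would give g(v, w) = 0 for all v and hence w = 0, so the linear functional
  g(u, _) would be injective on a space of dimension at least 2.\<close>

lemma shape_zero:
  assumes flat: "flat_on S \<Gamma>" and dim2: "2 \<le> CARD('n)" and x: "x \<in> S"
  shows "B x u = 0"
proof (rule ccontr)
  assume Bu: "B x u \<noteq> 0"
  have "g x v w *\<^sub>R B x u = g x u w *\<^sub>R B x v" for v w
  proof -
    have "\<forall>X Y Z. smooth_on S X \<longrightarrow> smooth_on S Y \<longrightarrow> smooth_on S Z \<longrightarrow>
        (\<forall>x\<in>S. cov \<Gamma> X (cov \<Gamma> Y Z) x - cov \<Gamma> Y (cov \<Gamma> X Z) x = cov \<Gamma> (lie_bracket X Y) Z x)"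
      using flat unfolding flat_on_def .
    from this[rule_format, of "\<lambda>_. u" "\<lambda>_. v" "\<lambda>_. w", OF smooth_on_const smooth_on_const smooth_on_const x]
    have "(\<Gamma> x u (\<Gamma> x v w) + ddir (\<lambda>y. \<Gamma> y v w) x u) - (\<Gamma> x v (\<Gamma> x u w) + ddir (\<lambda>y. \<Gamma> y u w) x v) = 0"
      using bilinear_lzero[OF bilinear_Gamma[OF x]]
      by (simp add: cov_def[abs_def] lie_bracket_def[abs_def] add.commute)
    then show ?thesis using gauss_equation[OF x, of u v w] by simp
  qed
  note eq = this
  have lin: "linear (\<lambda>w. g x u w)"
    using bilinear_g[OF x] by (simp add: bilinear_def)
  have "w = 0" if "g x u w = 0" for w
  proof (rule nondegenerate[OF x])
    show "g x v w = 0" for v using eq[of v w] that Bu by simp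
  qed
  then have "inj (\<lambda>w. g x u w)" by (simp add: linear_injective_0[OF lin])
  then have "dim (range (\<lambda>w. g x u w)) = DIM('e)"
    using dim_image_eq[OF lin, of UNIV] by simp
  moreover have "dim (range (\<lambda>w. g x u w)) \<le> DIM(real)" by (rule dim_subset_UNIV)
  ultimately show False using dim2 dim by simp
qed

text \<open>The \<open>\<nabla>\<close>-parallel vector fields of a parabolic sphere are the tangential parts of
  constant vectors, and the transversal part \<open>r\<close> is a component of the conormal map.\<close>

lemma parallel_frame:
  assumes xi0: "\<And>y u. y \<in> S \<Longrightarrow> ddir \<xi> y u = 0"
    and a: "\<And>y. y \<in> S \<Longrightarrow> r y *\<^sub>R \<xi> y + ddir f y (Y y) = a" and x: "x \<in> S"
  shows "ddir r x u = - g x u (Y x)" and "ddir Y x u = - \<Gamma> x u (Y x)"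
proof -
  have r: "smooth_on S r" and Y: "smooth_on S Y"
    using frame_smooth[OF smooth_on_const a] by auto
  have "ddir (\<lambda>y. r y *\<^sub>R \<xi> y + ddir f y (Y y)) x = ddir (\<lambda>y. a) x"
    by (rule ddir_cong[OF open_S x a])
  moreover have "((\<lambda>y. r y *\<^sub>R \<xi> y + ddir f y (Y y)) has_derivative
      (\<lambda>u. (r x *\<^sub>R ddir \<xi> x u + ddir r x u *\<^sub>R \<xi> x) + ddir (\<lambda>y. ddir f y (Y y)) x u)) (at x)"
    by (intro has_derivative_add has_derivative_scaleR smooth_onD[OF _ x] r smooth_xi
        smooth_on_ddir_field open_S smooth_f Y)
  ultimately have "ddir r x u *\<^sub>R \<xi> x + ddir (\<lambda>y. ddir f y (Y y)) x u = 0"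
    by (simp add: ddir_eqI xi0[OF x] fun_eq_iff)
  then have "(ddir r x u + g x u (Y x)) *\<^sub>R \<xi> x + ddir f x (\<Gamma> x u (Y x) + ddir Y x u) = 0"
    by (simp add: ddir_ddir_field[OF open_S x smooth_f Y] gauss[OF x] linear_add[OF linear_df[OF x]] algebra_simps)
  note * = frame_inj[OF x this]
  from conjunct1[OF *] show "ddir r x u = - g x u (Y x)"
    by (simp add: eq_neg_iff_add_eq_0)
  from conjunct2[OF *] show "ddir Y x u = - \<Gamma> x u (Y x)"
    by (simp add: eq_neg_iff_add_eq_0 add.commute)
qed

end

section \<open>Uniqueness up to equiaffine transformations\<close>

lemma ddir_frame:
  fixes \<eta> \<psi> :: "'e::euclidean_space \<Rightarrow> 'b::real_normed_vector"
  assumes S: "open S" "x \<in> S" and s: "smooth_on S r" "smooth_on S Y" "smooth_on S \<eta>" "smooth_on S \<psi>"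
  shows "((\<lambda>y. r y *\<^sub>R \<eta> y + ddir \<psi> y (Y y)) has_derivative
    (\<lambda>u. (r x *\<^sub>R ddir \<eta> x u + ddir r x u *\<^sub>R \<eta> x)
      + (ddir (\<lambda>y. ddir \<psi> y (Y x)) x u + ddir \<psi> x (ddir Y x u)))) (at x)"
  by (intro has_derivative_add has_derivative_scaleR smooth_onD[OF _ S(2)] s
      has_derivative_linear_family[where q = "ddir \<psi>"] S smooth_on_linear_ddir[OF s(4)] smooth_on_ddir) (use S s in auto)

lemma equiaffine_unique:
  fixes \<phi> \<xi> \<psi> \<eta> :: "'e::euclidean_space \<Rightarrow> real^('n::finite) option"
  assumes S: "open S" "connected S"
    and \<phi>: "Blaschke_on S \<phi> \<xi> \<Gamma> g B" "\<And>x u. x \<in> S \<Longrightarrow> ddir \<xi> x u = 0"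
    and \<psi>: "Blaschke_on S \<psi> \<eta> \<Gamma>' g B'" "\<And>x u. x \<in> S \<Longrightarrow> ddir \<eta> x u = 0"
    and \<Gamma>: "\<And>x u v. x \<in> S \<Longrightarrow> \<Gamma>' x u v = \<Gamma> x u v"
  shows "equiaffine_related S \<phi> \<psi>"
proof (cases "S = {}")
  case True
  then show ?thesis unfolding equiaffine_related_def by (intro exI[of _ "mat 1"]) simp
next
  case False
  then obtain x0 where x0: "x0 \<in> S" by blast
  interpret P: blaschke_chart S \<phi> \<xi> \<Gamma> g B using S(1) \<phi>(1) by unfold_locales
  interpret Q: blaschke_chart S \<psi> \<eta> \<Gamma>' g B' using S(1) \<psi>(1) by unfold_locales
  have "\<exists>c. \<forall>x\<in>S. \<exists>r v. a = r *\<^sub>R \<xi> x + ddir \<phi> x v \<and> c = r *\<^sub>R \<eta> x + ddir \<psi> x v" for a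
  proof -
    define r where "r x = transversal_part \<phi> \<xi> x a" for x
    define Y where "Y x = tangential_part \<phi> \<xi> x a" for x
    have rY: "r x *\<^sub>R \<xi> x + ddir \<phi> x (Y x) = a" if "x \<in> S" for x
      using P.parts[OF that] by (simp add: r_def Y_def)
    have rs: "smooth_on S r" and Ys: "smooth_on S Y"
      using P.frame_smooth[OF smooth_on_const rY] by auto
    \<comment> \<open>The derivatives of r and Y involve only g and the connection, which both
      immersions share. Hence coefficients that represent a constant vector in the first frame also
      represent one in the second.\<close>
    have "((\<lambda>y. r y *\<^sub>R \<eta> y + ddir \<psi> y (Y y)) has_derivative (\<lambda>u. 0)) (at x)" if x: "x \<in> S" for x
      using ddir_frame[OF S(1) x rs Ys Q.smooth_xi Q.smooth_f]
      by (simp add: P.parallel_frame[OF \<phi>(2) rY x] \<psi>(2)[OF x] Q.gauss[OF x] \<Gamma>[OF x] linear_neg[OF Q.linear_df[OF x]])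
    then have "r x *\<^sub>R \<eta> x + ddir \<psi> x (Y x) = r x0 *\<^sub>R \<eta> x0 + ddir \<psi> x0 (Y x0)" if "x \<in> S" for x
      using has_derivative_zero_unique_connected[OF S _ that x0, of "\<lambda>y. r y *\<^sub>R \<eta> y + ddir \<psi> y (Y y)"] by simp
    then have "a = r x *\<^sub>R \<xi> x + ddir \<phi> x (Y x)
        \<and> r x0 *\<^sub>R \<eta> x0 + ddir \<psi> x0 (Y x0) = r x *\<^sub>R \<eta> x + ddir \<psi> x (Y x)" if "x \<in> S" for x
      using rY[OF that] that by simp
    then have "\<forall>x\<in>S. \<exists>r' v. a = r' *\<^sub>R \<xi> x + ddir \<phi> x v
        \<and> r x0 *\<^sub>R \<eta> x0 + ddir \<psi> x0 (Y x0) = r' *\<^sub>R \<eta> x + ddir \<psi> x v"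
      by blast
    then show ?thesis ..
  qed
  then have "\<forall>a. \<exists>c. \<forall>x\<in>S. \<exists>r v. a = r *\<^sub>R \<xi> x + ddir \<phi> x v \<and> c = r *\<^sub>R \<eta> x + ddir \<psi> x v"
    by blast
  from choice[OF this] obtain c where c: "\<And>a x. x \<in> S \<Longrightarrow> \<exists>r v. a = r *\<^sub>R \<xi> x + ddir \<phi> x v \<and> c a = r *\<^sub>R \<eta> x + ddir \<psi> x v"
    by blast
  \<comment> \<open>The map \<open>c\<close> carries the first frame to the second at every point
    simultaneously; linearity, the relation between the differentials and the determinant are all
    consequences.\<close>
  have cf: "c (r *\<^sub>R \<xi> x + ddir \<phi> x v) = r *\<^sub>R \<eta> x + ddir \<psi> x v" if xS: "x \<in> S" for x r v
  proof -
    obtain r' v' where *: "r *\<^sub>R \<xi> x + ddir \<phi> x v = r' *\<^sub>R \<xi> x + ddir \<phi> x v'"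
      "c (r *\<^sub>R \<xi> x + ddir \<phi> x v) = r' *\<^sub>R \<eta> x + ddir \<psi> x v'"
      using c[OF xS, of "r *\<^sub>R \<xi> x + ddir \<phi> x v"] by blast
    show ?thesis using P.frame_unique[OF xS *(1)] *(2) by simp
  qed
  have "linear c"
  proof (rule linearI)
    fix a b :: "real^'n option" and k :: real
    obtain r v where a: "a = r *\<^sub>R \<xi> x0 + ddir \<phi> x0 v" using P.frame_exists[OF x0] by blast
    obtain s w where b: "b = s *\<^sub>R \<xi> x0 + ddir \<phi> x0 w" using P.frame_exists[OF x0] by blast
    have "a + b = (r + s) *\<^sub>R \<xi> x0 + ddir \<phi> x0 (v + w)"
      by (simp add: a b linear_add[OF P.linear_df[OF x0]] algebra_simps)
    then have "c (a + b) = (r + s) *\<^sub>R \<eta> x0 + ddir \<psi> x0 (v + w)"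
      by (simp only: cf[OF x0])
    then show "c (a + b) = c a + c b"
      unfolding a b cf[OF x0] by (simp add: linear_add[OF Q.linear_df[OF x0]] algebra_simps)
    have "k *\<^sub>R a = (k * r) *\<^sub>R \<xi> x0 + ddir \<phi> x0 (k *\<^sub>R v)"
      by (simp add: a linear_cmul[OF P.linear_df[OF x0]] algebra_simps)
    then have "c (k *\<^sub>R a) = (k * r) *\<^sub>R \<eta> x0 + ddir \<psi> x0 (k *\<^sub>R v)"
      by (simp only: cf[OF x0])
    then show "c (k *\<^sub>R a) = k *\<^sub>R c a"
      unfolding a cf[OF x0] by (simp add: linear_cmul[OF Q.linear_df[OF x0]] algebra_simps)
  qed
  have cv: "matrix c *v a = c a" for a
    using matrix_works[of c a] \<open>linear c\<close> by (simp add: linear_matrix_vector_mul_eq)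
  have "((\<lambda>x. \<psi> x - c (\<phi> x)) has_derivative (\<lambda>u. 0)) (at x)" if x: "x \<in> S" for x
  proof -
    have "((\<lambda>x. \<psi> x - c (\<phi> x)) has_derivative (\<lambda>u. ddir \<psi> x u - c (ddir \<phi> x u))) (at x)"
      using \<open>linear c\<close>
      by (intro has_derivative_diff smooth_onD[OF Q.smooth_f x]
          bounded_linear.has_derivative[OF _ smooth_onD[OF P.smooth_f x]])
        (simp add: linear_conv_bounded_linear)
    moreover have "c (ddir \<phi> x u) = ddir \<psi> x u" for u using cf[OF x, of 0 u] by simp
    ultimately show ?thesis by simp
  qed
  then have "\<psi> x - c (\<phi> x) = \<psi> x0 - c (\<phi> x0)" if "x \<in> S" for x
    using has_derivative_zero_unique_connected[OF S _ that x0, of "\<lambda>x. \<psi> x - c (\<phi> x)"] by simp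
  then have aff: "\<psi> x = matrix c *v \<phi> x + (\<psi> x0 - c (\<phi> x0))" if "x \<in> S" for x
    using that by (simp add: cv algebra_simps) 
  obtain b :: "'n \<Rightarrow> 'e" where b: "bij_betw b UNIV Basis"
    using ex_basis_enumeration[OF P.dim] .
  define N where "N = (\<chi> i. case i of None \<Rightarrow> \<xi> x0 | Some j \<Rightarrow> ddir \<phi> x0 (b j))"
  \<comment> \<open>Frame vectors are rows, so applying \<open>c\<close> to each of them is right
    multiplication by the transpose. Both volumes have the absolute value determined by the common
    metric, which gives determinant 1 up to sign.\<close>
  have "(\<chi> i. case i of None \<Rightarrow> \<eta> x0 | Some j \<Rightarrow> ddir \<psi> x0 (b j)) = N ** transpose (matrix c)"
  proof -
    have "(N ** transpose (matrix c)) $ i = matrix c *v (N $ i)" for i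
      by (simp add: vec_eq_iff matrix_matrix_mult_def matrix_vector_mult_def transpose_def mult.commute)
    moreover have "c (N $ i) = (case i of None \<Rightarrow> \<eta> x0 | Some j \<Rightarrow> ddir \<psi> x0 (b j))" for i
      using cf[OF x0, of 1 0] cf[OF x0, of 0] linear_0[OF P.linear_df[OF x0]] linear_0[OF Q.linear_df[OF x0]]
      by (cases i) (simp_all add: N_def)
    ultimately show ?thesis by (simp add: vec_eq_iff cv)
  qed
  then have "induced_volume \<psi> \<eta> x0 b = induced_volume \<phi> \<xi> x0 b * det (matrix c)"
    by (simp add: induced_volume_def N_def det_mul)
  then have "\<bar>induced_volume \<phi> \<xi> x0 b\<bar> * \<bar>det (matrix c)\<bar> = \<bar>induced_volume \<phi> \<xi> x0 b\<bar>"
    using P.volume[OF x0, of b] Q.volume[OF x0, of b] by (simp add: abs_mult)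
  then have "\<bar>det (matrix c)\<bar> = 1"
    using P.volume_basis_nonzero[OF x0 b] by simp
  then show ?thesis unfolding equiaffine_related_def using aff by blast
qed

section \<open>Holomorphic functions of several variables\<close>

lemma continuous_on_slice:
  assumes "continuous_on (V \<times> T) (\<lambda>(z, t). f z t)" "z \<in> V"
  shows "continuous_on T (f z)"
proof -
  have "continuous_on T (\<lambda>t. (\<lambda>(z, t). f z t) (z, t))"
    by (rule continuous_on_compose2[OF assms(1)]) (use assms(2) in \<open>auto intro!: continuous_on_Pair continuous_on_const continuous_on_id\<close>)
  then show ?thesis by simp
qed

text \<open>Differentiation under the integral for derivatives given by coefficients: they are
  packaged as bounded linear maps \<open>fx\<close>, and the integral of \<open>fx\<close> is
  evaluated coefficient by coefficient.\<close>

lemma leibniz_rule_complex_linear: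
  fixes f :: "complex^'m::finite \<Rightarrow> real \<Rightarrow> complex"
  assumes V: "open V" "convex V" "z \<in> V"
    and D: "\<And>z t. z \<in> V \<Longrightarrow> t \<in> {0..1} \<Longrightarrow> ((\<lambda>z. f z t) has_derivative (\<lambda>h. \<Sum>j\<in>UNIV. c j z t * h $ j)) (at z)"
    and cont: "\<And>z. z \<in> V \<Longrightarrow> continuous_on {0..1} (f z)"
    and contc: "\<And>j. continuous_on (V \<times> {0..1}) (\<lambda>(z, t). c j z t)"
  shows "((\<lambda>z. integral {0..1} (f z)) has_derivative (\<lambda>h. \<Sum>j\<in>UNIV. integral {0..1} (c j z) * h $ j)) (at z)"
proof -
  define E :: "'m \<Rightarrow> ((complex^'m) \<Rightarrow>\<^sub>L complex)" where "E j = Blinfun (\<lambda>h. h $ j)" for j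
  have E: "blinfun_apply (E j) = (\<lambda>h. h $ j)" for j
    unfolding E_def by (rule bounded_linear_Blinfun_apply[OF bounded_linear_vec_nth])
  define fx where "fx z t = (\<Sum>j\<in>UNIV. blinfun_mult_right (c j z t) o\<^sub>L E j)" for z t
  have fx: "blinfun_apply (fx z t) h = (\<Sum>j\<in>UNIV. c j z t * h $ j)" for z t h
    by (simp add: fx_def blinfun.sum_left E)
  have cf: "continuous_on (V \<times> cbox 0 1) (\<lambda>(z, t). fx z t)"
  proof -
    have "continuous_on (V \<times> cbox 0 1) (\<lambda>p. c j (fst p) (snd p))" for j
      using contc[of j] by (simp add: case_prod_unfold)
    then show ?thesis
      unfolding fx_def case_prod_unfold by (intro continuous_intros)
  qed
  have *: "((\<lambda>z. integral (cbox 0 1) (f z)) has_derivative integral (cbox 0 1) (fx z)) (at z within V)"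
  proof (rule leibniz_rule[OF _ _ cf V(3,2)])
    show "((\<lambda>z. f z t) has_derivative blinfun_apply (fx z t)) (at z within V)" if "z \<in> V" "t \<in> cbox 0 1" for z t
      using has_derivative_at_withinI[OF D, of z t V] that by (simp add: fx[abs_def] eta_contract_eq)
    show "f z integrable_on cbox 0 1" if "z \<in> V" for z
      using integrable_continuous_interval[OF cont[OF that]] by simp
  qed
  have ints: "fx z integrable_on cbox 0 1"
    by (rule integrable_continuous[OF continuous_on_slice[OF cf V(3)]])
  have intc: "c j z integrable_on {0..1}" for j
    by (rule integrable_continuous_interval[OF continuous_on_slice[OF contc V(3)]])
  have "blinfun_apply (integral (cbox 0 1) (fx z)) h = (\<Sum>j\<in>UNIV. integral {0..1} (c j z) * h $ j)" for h
  proof -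
    have "blinfun_apply (integral (cbox 0 1) (fx z)) h = integral (cbox 0 1) (\<lambda>t. blinfun_apply (fx z t) h)"
      using integral_linear[OF ints blinfun.bounded_linear_left[of h]] by (simp add: o_def)
    also have "\<dots> = (\<Sum>j\<in>UNIV. integral {0..1} (\<lambda>t. c j z t * h $ j))"
      unfolding fx cbox_interval by (rule integral_sum) (auto intro!: integrable_continuous_interval continuous_intros
          continuous_on_slice[OF contc V(3)])
    finally show ?thesis by simp
  qed
  then have "blinfun_apply (integral (cbox 0 1) (fx z)) = (\<lambda>h. \<Sum>j\<in>UNIV. integral {0..1} (c j z) * h $ j)" ..
  with * show ?thesis
    using at_within_open[OF V(3,1)] by simp
qed

lemma axis_line_derivative:
  fixes F :: "complex^'m::finite \<Rightarrow> complex"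
  assumes "(F has_derivative (\<lambda>h. \<Sum>j\<in>UNIV. a $ j * h $ j)) (at (z + t *s axis i 1))"
  shows "((\<lambda>t. F (z + t *s axis i 1)) has_field_derivative a $ i) (at t)"
proof -
  have lin: "bounded_linear (\<lambda>t. t *s axis i (1::complex))"
    by (rule linear_conv_bounded_linear[THEN iffD1], rule linearI)
      (auto simp: vec_eq_iff vector_scalar_mult_def axis_def algebra_simps)
  have "((\<lambda>t. F (z + t *s axis i 1)) has_derivative (\<lambda>k. \<Sum>j\<in>UNIV. a $ j * (k *s axis i 1) $ j)) (at t)"
    by (rule has_derivative_compose[where f = "\<lambda>t. z + t *s axis i 1" and g = F, OF _ assms])
      (use has_derivative_add[OF has_derivative_const bounded_linear_imp_has_derivative[OF lin]] in simp)
  moreover have "(\<Sum>j\<in>UNIV. a $ j * (k *s axis i 1) $ j) = a $ i * k" for k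
  proof -
    have "(\<Sum>j\<in>UNIV. a $ j * (k *s axis i 1) $ j) = (\<Sum>j\<in>UNIV. if j = i then a $ i * k else 0)"
      by (rule sum.cong) (auto simp: axis_def)
    then show ?thesis by simp
  qed
  ultimately show ?thesis
    by (simp add: has_field_derivative_def)
qed

lemma partial_eqI:
  assumes "(F has_derivative (\<lambda>h. \<Sum>j\<in>UNIV. a $ j * h $ j)) (at z)"
  shows "partial F i z = a $ i"
  unfolding partial_def using axis_line_derivative[of F a z 0 i] assms
  by (intro DERIV_imp_deriv) simp

lemma holomorphic_has_derivative:
  assumes "holomorphic_fun_on F U" "z \<in> U"
  shows "(F has_derivative (\<lambda>h. \<Sum>j\<in>UNIV. partial F j z * h $ j)) (at z)"
proof -
  obtain a where a: "(F has_derivative (\<lambda>h. \<Sum>j\<in>UNIV. a $ j * h $ j)) (at z)"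
    using assms unfolding holomorphic_fun_on_def by blast
  show ?thesis
    using a by (simp add: partial_eqI[OF a])
qed

lemma holomorphic_fun_onI:
  assumes "\<And>z. z \<in> U \<Longrightarrow> (F has_derivative (\<lambda>h. \<Sum>j\<in>UNIV. a j z * h $ j)) (at z)"
  shows "holomorphic_fun_on F U"
  unfolding holomorphic_fun_on_def
proof
  fix z assume "z \<in> U"
  then show "\<exists>a. (F has_derivative (\<lambda>h. \<Sum>j\<in>UNIV. a $ j * h $ j)) (at z)"
    using assms[of z] by (intro exI[of _ "\<chi> j. a j z"]) simp
qed

lemma holomorphic_continuous_on:
  "holomorphic_fun_on F U \<Longrightarrow> continuous_on U F"
  by (intro continuous_at_imp_continuous_on ballI has_derivative_continuous[OF holomorphic_has_derivative])

lemma norm_axis_scale: "norm (t *s axis i (1::complex) :: complex^'m::finite) = norm t"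
proof -
  have "(t *s axis i 1 :: complex^'m) = axis i t" by (simp add: vec_eq_iff axis_def)
  then show ?thesis by (simp add: norm_eq_sqrt_inner inner_axis_axis)
qed

text \<open>The centre may move by less than r and the disc around it reaches r further; this is the
  origin of the radius 2 r in the Cauchy lemmas.\<close>

lemma disc_subset:
  fixes z0 :: "complex^'m::finite"
  assumes "cball z0 (2 * r) \<subseteq> U" "z \<in> ball z0 r" "norm t \<le> r"
  shows "z + t *s axis i 1 \<in> U"
proof -
  have "dist z0 (z + t *s axis i 1) \<le> dist z0 z + norm (t *s axis i (1::complex) :: complex^'m)"
    using norm_triangle_ineq4[of "z0 - z" "t *s axis i 1"] by (simp add: dist_norm algebra_simps)
  also have "\<dots> \<le> 2 * r" using assms(2,3) by (simp add: norm_axis_scale)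
  finally show ?thesis using assms(1) by auto
qed

lemma norm_circlepath: "0 < r \<Longrightarrow> norm (circlepath 0 r t) = r"
  by (simp add: circlepath norm_mult)

text \<open>Cauchy's formula for the derivative along the i-th axis. On the circle du = 2 pi i u dt,
  so 2 pi i and one of the two factors u in the denominator cancel. The point z now enters only as
  an argument of F, ready for differentiation under the integral.\<close>

lemma partial_Cauchy:
  assumes F: "holomorphic_fun_on F U" and r: "0 < r" and sub: "cball z0 (2 * r) \<subseteq> U" and z: "z \<in> ball z0 r"
  shows "partial F i z = integral {0..1} (\<lambda>t. F (z + circlepath 0 r t *s axis i 1) / circlepath 0 r t)"
proof -
  note inU = disc_subset[OF sub z]
  have D: "((\<lambda>t. F (z + t *s axis i 1)) has_field_derivative partial F i (z + t *s axis i 1)) (at t)" if "norm t \<le> r" for t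
    using axis_line_derivative[of F "\<chi> j. partial F j (z + t *s axis i 1)" z t i]
      holomorphic_has_derivative[OF F inU[OF that]] by simp
  have "(\<lambda>t. F (z + t *s axis i 1)) holomorphic_on cball 0 r"
    by (rule holomorphic_onI) (use D in \<open>auto simp: field_differentiable_def intro: has_field_derivative_at_within\<close>)
  then have "contour_integral (circlepath 0 r) (\<lambda>u. F (z + u *s axis i 1) / (u - 0) ^ 2) = 2 * pi * \<i> * deriv (\<lambda>t. F (z + t *s axis i 1)) 0"
    using r by (intro Cauchy_contour_integral_circlepath_2)
      (auto intro: holomorphic_on_imp_continuous_on holomorphic_on_subset)
  also have "contour_integral (circlepath 0 r) (\<lambda>u. F (z + u *s axis i 1) / (u - 0) ^ 2)
      = integral {0..1} (\<lambda>t. F (z + circlepath 0 r t *s axis i 1) / (circlepath 0 r t)\<^sup>2 * (2 * pi * \<i> * circlepath 0 r t))"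
  proof -
    have "vector_derivative (circlepath 0 r) (at t) = 2 * pi * \<i> * circlepath 0 r t" for t
      unfolding circlepath_def vector_derivative_part_circlepath by (simp add: part_circlepath_def)
    then show ?thesis by (simp only: contour_integral_integral diff_0_right)
  qed
  also have "\<dots> = integral {0..1} (\<lambda>t. (2 * pi * \<i>) * (F (z + circlepath 0 r t *s axis i 1) / circlepath 0 r t))"
    using r by (intro integral_cong) (simp add: power2_eq_square circlepath)
  also have "\<dots> = (2 * pi * \<i>) * integral {0..1} (\<lambda>t. F (z + circlepath 0 r t *s axis i 1) / circlepath 0 r t)"
    by (rule integral_mult_right)
  finally show ?thesis by (simp add: partial_def)
qed

lemma continuous_on_Cauchy_kernel:
  fixes F :: "complex^'m::finite \<Rightarrow> complex"
  assumes "continuous_on U F" and r: "0 < r" and sub: "cball z0 (2 * r) \<subseteq> U"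
  shows "continuous_on (ball z0 r \<times> {0..1}) (\<lambda>(z, t). F (z + circlepath 0 r t *s axis i 1) / circlepath 0 r t)"
proof -
  have c: "continuous_on UNIV (\<lambda>p :: (complex^'m) \<times> real. circlepath 0 r (snd p))"
    unfolding circlepath by (intro continuous_intros)
  have "(t *s axis i 1 :: complex^'m) = axis i t" for t by (simp add: vec_eq_iff axis_def)
  then have c2: "continuous_on UNIV (\<lambda>p :: (complex^'m) \<times> real. fst p + circlepath 0 r (snd p) *s axis i 1)"
    using bounded_linear.continuous_on[OF bounded_linear_axis c] by (auto intro!: continuous_intros)
  have sub2: "(\<lambda>p. fst p + circlepath 0 r (snd p) *s axis i 1) ` (ball z0 r \<times> {0..1}) \<subseteq> U"
  proof -
    have "z + circlepath 0 r t *s axis i 1 \<in> U" if "z \<in> ball z0 r" for z t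
      using disc_subset[OF sub that] r by (simp add: norm_circlepath)
    then show ?thesis by auto
  qed
  show ?thesis
    unfolding case_prod_unfold
    by (intro continuous_on_divide continuous_on_compose2[OF assms(1) continuous_on_subset[OF c2] sub2]
        continuous_on_subset[OF c]) (use r in \<open>auto simp: circlepath\<close>)
qed

text \<open>Continuity has to precede differentiability: the derivative of the Cauchy integral
  involves the partial derivatives on the circle, and the Leibniz rule requires them to be jointly
  continuous.\<close>

lemma partial_continuous_on:
  assumes "open U" and F: "holomorphic_fun_on F U"
  shows "continuous_on U (partial F i)"
proof (intro continuous_at_imp_continuous_on ballI)
  fix z0 assume "z0 \<in> U"
  then obtain e where e: "e > 0" "cball z0 e \<subseteq> U" using assms(1) open_contains_cball by blast
  define r where "r = e / 2"
  have r: "0 < r" "cball z0 (2 * r) \<subseteq> U" using e by (auto simp: r_def)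
  have "continuous_on (ball z0 r) (\<lambda>z. integral (cbox 0 1) (\<lambda>t. F (z + circlepath 0 r t *s axis i 1) / circlepath 0 r t))"
    using continuous_on_Cauchy_kernel[OF holomorphic_continuous_on[OF F] r]
    by (intro integral_continuous_on_param) simp
  then have "continuous_on (ball z0 r) (partial F i)"
    by (rule continuous_on_eq) (use partial_Cauchy[OF F r] in simp)
  then show "isCont (partial F i) z0"
    using r by (simp add: continuous_on_eq_continuous_at)
qed

lemma holomorphic_partial:
  assumes U: "open U" and F: "holomorphic_fun_on F U"
  shows "holomorphic_fun_on (partial F i) U"
  unfolding holomorphic_fun_on_def
proof
  fix z0 assume "z0 \<in> U"
  then obtain e where e: "e > 0" "cball z0 e \<subseteq> U" using U open_contains_cball by blast
  define r where "r = e / 2"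
  have r: "0 < r" "cball z0 (2 * r) \<subseteq> U" using e by (auto simp: r_def)
  define G where "G z = integral {0..1} (\<lambda>t. F (z + circlepath 0 r t *s axis i 1) / circlepath 0 r t)" for z
  have inU: "z + circlepath 0 r t *s axis i 1 \<in> U" if "z \<in> ball z0 r" for z t
    using disc_subset[OF r(2) that] r by (simp add: norm_circlepath)
  have "(G has_derivative (\<lambda>h. \<Sum>j\<in>UNIV. integral {0..1} (\<lambda>t. partial F j (z0 + circlepath 0 r t *s axis i 1) / circlepath 0 r t) * h $ j)) (at z0)"
    unfolding G_def
  proof (rule leibniz_rule_complex_linear[OF open_ball convex_ball])
    show "z0 \<in> ball z0 r" using r by simp
    show "continuous_on (ball z0 r \<times> {0..1}) (\<lambda>(z, t). partial F j (z + circlepath 0 r t *s axis i 1) / circlepath 0 r t)" for j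
      by (rule continuous_on_Cauchy_kernel[OF partial_continuous_on[OF U F] r])
    show "continuous_on {0..1} (\<lambda>t. F (z + circlepath 0 r t *s axis i 1) / circlepath 0 r t)" if "z \<in> ball z0 r" for z
      by (rule continuous_on_slice[OF continuous_on_Cauchy_kernel[OF holomorphic_continuous_on[OF F] r] that])
    show "((\<lambda>z. F (z + circlepath 0 r t *s axis i 1) / circlepath 0 r t) has_derivative
        (\<lambda>h. \<Sum>j\<in>UNIV. partial F j (z + circlepath 0 r t *s axis i 1) / circlepath 0 r t * h $ j)) (at z)"
      if "z \<in> ball z0 r" for z t
    proof -
      have "((\<lambda>z. F (z + circlepath 0 r t *s axis i 1)) has_derivative
          (\<lambda>h. \<Sum>j\<in>UNIV. partial F j (z + circlepath 0 r t *s axis i 1) * h $ j)) (at z)"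
        by (rule has_derivative_compose[where f = "\<lambda>z. z + circlepath 0 r t *s axis i 1" and g = F,
              OF _ holomorphic_has_derivative[OF F inU[OF that]]]) (auto intro!: derivative_eq_intros)
      from has_derivative_mult_left[OF this, of "inverse (circlepath 0 r t)"]
      show ?thesis by (simp add: divide_inverse sum_distrib_left algebra_simps)
    qed
  qed
  then have "(partial F i has_derivative (\<lambda>h. \<Sum>j\<in>UNIV. integral {0..1} (\<lambda>t. partial F j (z0 + circlepath 0 r t *s axis i 1) / circlepath 0 r t) * h $ j)) (at z0)"
    by (rule has_derivative_transform_within_open[OF _ open_ball[of z0 r]]) (use r partial_Cauchy[OF F r] in \<open>auto simp: G_def\<close>)
  then show "\<exists>a. (partial F i has_derivative (\<lambda>h. \<Sum>j\<in>UNIV. a $ j * h $ j)) (at z0)"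
    by (intro exI[of _ "\<chi> j. integral {0..1} (\<lambda>t. partial F j (z0 + circlepath 0 r t *s axis i 1) / circlepath 0 r t)"]) simp
qed

lemma ddir_holomorphic:
  "holomorphic_fun_on F U \<Longrightarrow> z \<in> U \<Longrightarrow> ddir F z h = (\<Sum>j\<in>UNIV. partial F j z * h $ j)"
  using ddir_eqI[OF holomorphic_has_derivative] by metis

text \<open>A derivative in a fixed direction is a constant combination of the partial derivatives,
  which are holomorphic again, so the order of differentiability can be raised indefinitely.\<close>

lemma holomorphic_smooth_on:
  assumes U: "open U" and F: "holomorphic_fun_on F U"
  shows "smooth_on U F"
  unfolding smooth_on_def
proof
  fix k
  show "Ck_on k U F"
    using F
  proof (induction k arbitrary: F)
    case 0
    then show ?case by (simp add: holomorphic_continuous_on)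
  next
    case (Suc k)
    have "Ck_on k U (\<lambda>x. ddir F x v)" for v
    proof (rule Ck_on_congI[OF U])
      show "Ck_on k U (\<lambda>x. \<Sum>j\<in>UNIV. partial F j x * v $ j)"
        by (intro Ck_on_sum[OF U] Ck_on_bilinear[OF bounded_bilinear_mult U] Ck_on_const Suc.IH
            holomorphic_partial[OF U Suc.prems])
    qed (simp add: ddir_holomorphic[OF Suc.prems])
    then show ?case
      using holomorphic_has_derivative[OF Suc.prems] by (auto simp: differentiable_def)
  qed
qed

lemma partial_eq_ddir:
  assumes "holomorphic_fun_on F U" "z \<in> U"
  shows "partial F i z = ddir F z (axis i 1)"
proof -
  have "(\<Sum>j\<in>UNIV. partial F j z * axis i 1 $ j) = (\<Sum>j\<in>UNIV. if j = i then partial F j z else 0)"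
    by (rule sum.cong) (auto simp: axis_def)
  then show ?thesis by (simp add: ddir_holomorphic[OF assms])
qed

lemma partial_partial_commute:
  assumes U: "open U" and F: "holomorphic_fun_on F U" and z: "z \<in> U"
  shows "partial (partial F i) j z = partial (partial F j) i z"
proof -
  have "partial (partial F i) j z = ddir (\<lambda>y. ddir F y (axis i 1)) z (axis j 1)" for i j
  proof -
    have "partial (partial F i) j z = ddir (partial F i) z (axis j 1)"
      by (rule partial_eq_ddir[OF holomorphic_partial[OF U F] z])
    also have "ddir (partial F i) z = ddir (\<lambda>y. ddir F y (axis i 1)) z"
      by (rule ddir_cong[OF U z partial_eq_ddir[OF F]])
    finally show ?thesis .
  qed
  then show ?thesis
    using ddir_ddir_commute[OF U z holomorphic_smooth_on[OF U F]] by simp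
qed

text \<open>F is the integral of the form along the rays from z0. By symmetry of the derivatives of
  w, the j-th derivative of the integrand is d/dt (t w j (p z t)), called \<open>c j z t\<close>,
  and its integral over [0, 1] is w j z.\<close>

lemma holomorphic_Poincare:
  fixes w :: "'m::finite \<Rightarrow> complex^'m \<Rightarrow> complex"
  assumes w: "\<And>i. holomorphic_fun_on (w i) (ball z0 r)"
    and sym: "\<And>i j z. z \<in> ball z0 r \<Longrightarrow> partial (w i) j z = partial (w j) i z"
  obtains F where "holomorphic_fun_on F (ball z0 r)" "\<And>i z. z \<in> ball z0 r \<Longrightarrow> partial F i z = w i z"
proof -
  define p where "p z t = z0 + t *\<^sub>R (z - z0)" for z :: "complex^'m" and t :: real
  have p: "p z t \<in> ball z0 r" if "z \<in> ball z0 r" "t \<in> {0..1}" for z t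
  proof -
    have "norm (t *\<^sub>R (z - z0)) \<le> 1 * norm (z - z0)"
      unfolding norm_scaleR using that by (intro mult_right_mono) auto
    then show ?thesis using that by (simp add: p_def dist_norm norm_minus_commute)
  qed
  have contp: "continuous_on A (\<lambda>q. p (fst q) (snd q))" for A
    unfolding p_def by (intro continuous_intros)
  have cw: "continuous_on (ball z0 r \<times> {0..1}) (\<lambda>q. h (p (fst q) (snd q)))" if "continuous_on (ball z0 r) h" for h :: "complex^'m \<Rightarrow> complex"
    by (rule continuous_on_compose2[OF that contp]) (use p in auto)
  define c where "c j z t = w j (p z t) + t *\<^sub>R (\<Sum>i\<in>UNIV. partial (w j) i (p z t) * (z - z0) $ i)" for j z t
  define F where "F z = integral {0..1} (\<lambda>t. \<Sum>i\<in>UNIV. w i (p z t) * (z - z0) $ i)" for z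
  have D: "(F has_derivative (\<lambda>h. \<Sum>j\<in>UNIV. integral {0..1} (c j z) * h $ j)) (at z)" if z: "z \<in> ball z0 r" for z
    unfolding F_def
  proof (rule leibniz_rule_complex_linear[OF open_ball convex_ball z])
    show "continuous_on (ball z0 r \<times> {0..1}) (\<lambda>(z, t). c j z t)" for j
      unfolding c_def case_prod_unfold
      by (intro continuous_intros cw holomorphic_continuous_on[OF w] partial_continuous_on[OF open_ball w])
    show "continuous_on {0..1} (\<lambda>t. \<Sum>i\<in>UNIV. w i (p z t) * (z - z0) $ i)" if "z \<in> ball z0 r" for z
    proof -
      have "continuous_on {0..1} (\<lambda>t. w i (p z t))" for i
        using continuous_on_slice[of "ball z0 r" "{0..1}" "\<lambda>z t. w i (p z t)", OF _ that]
          cw[OF holomorphic_continuous_on[OF w]] by (simp add: case_prod_unfold)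
      then show ?thesis by (intro continuous_intros)
    qed
    show "((\<lambda>z. \<Sum>i\<in>UNIV. w i (p z t) * (z - z0) $ i) has_derivative (\<lambda>h. \<Sum>j\<in>UNIV. c j z t * h $ j)) (at z)"
      if "z \<in> ball z0 r" "t \<in> {0..1}" for z t
    proof -
      have "((\<lambda>z. w i (p z t)) has_derivative (\<lambda>h. \<Sum>j\<in>UNIV. partial (w i) j (p z t) * (t *\<^sub>R h) $ j)) (at z)" for i
        by (rule has_derivative_compose[where f = "\<lambda>z. p z t" and g = "w i", OF _ holomorphic_has_derivative[OF w p[OF that]]])
          (auto simp: p_def intro!: derivative_eq_intros)
      moreover have "((\<lambda>z. (z - z0) $ i) has_derivative (\<lambda>h. h $ i)) (at z)" for i
        by (rule bounded_linear.has_derivative[OF bounded_linear_vec_nth]) (auto intro!: derivative_eq_intros)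
      ultimately have "((\<lambda>z. \<Sum>i\<in>UNIV. w i (p z t) * (z - z0) $ i) has_derivative
          (\<lambda>h. \<Sum>i\<in>UNIV. w i (p z t) * h $ i + (\<Sum>j\<in>UNIV. partial (w i) j (p z t) * (t *\<^sub>R h) $ j) * (z - z0) $ i)) (at z)"
        by (intro has_derivative_sum has_derivative_mult)
      moreover have "(\<Sum>i\<in>UNIV. w i (p z t) * h $ i + (\<Sum>j\<in>UNIV. partial (w i) j (p z t) * (t *\<^sub>R h) $ j) * (z - z0) $ i)
          = (\<Sum>j\<in>UNIV. c j z t * h $ j)" for h
      proof -
        have "(\<Sum>i\<in>UNIV. (\<Sum>j\<in>UNIV. partial (w i) j (p z t) * (t *\<^sub>R h) $ j) * (z - z0) $ i)
          = (\<Sum>i\<in>UNIV. \<Sum>j\<in>UNIV. (t *\<^sub>R (partial (w j) i (p z t) * (z - z0) $ i)) * h $ j)"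
          by (simp add: sum_distrib_right sum_distrib_left sym[OF p[OF that]] scaleR_conv_of_real[where 'a = complex] mult_ac)
        also have "\<dots> = (\<Sum>j\<in>UNIV. (t *\<^sub>R (\<Sum>i\<in>UNIV. partial (w j) i (p z t) * (z - z0) $ i)) * h $ j)"
          by (subst sum.swap) (simp only: scaleR_sum_right sum_distrib_right)
        finally show ?thesis
          by (simp only: c_def sum.distrib distrib_right)
      qed
      ultimately show ?thesis by simp
    qed
  qed
  have "integral {0..1} (c j z) = w j z" if z: "z \<in> ball z0 r" for j z
  proof -
    have "((\<lambda>t. t *\<^sub>R w j (p z t)) has_vector_derivative c j z t) (at t within {0..1})" if t: "t \<in> {0..1}" for t
    proof -
      have "((\<lambda>t. w j (p z t)) has_derivative (\<lambda>k. \<Sum>i\<in>UNIV. partial (w j) i (p z t) * (k *\<^sub>R (z - z0)) $ i)) (at t)"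
        by (rule has_derivative_compose[where f = "\<lambda>t. p z t" and g = "w j", OF _ holomorphic_has_derivative[OF w p[OF z t]]])
          (auto simp: p_def intro!: derivative_eq_intros)
      then have "((\<lambda>t. w j (p z t)) has_vector_derivative (\<Sum>i\<in>UNIV. partial (w j) i (p z t) * (z - z0) $ i)) (at t)"
        by (simp add: has_vector_derivative_def scaleR_sum_right)
      then have "((\<lambda>t. t *\<^sub>R w j (p z t)) has_vector_derivative
          t *\<^sub>R (\<Sum>i\<in>UNIV. partial (w j) i (p z t) * (z - z0) $ i) + 1 *\<^sub>R w j (p z t)) (at t)"
        by (intro has_vector_derivative_scaleR) auto
      then show ?thesis
        by (simp add: c_def add.commute has_vector_derivative_at_within)
    qed
    from integral_unique[OF fundamental_theorem_of_calculus[OF _ this]] show ?thesis by (simp add: p_def)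
  qed
  with D have D': "(F has_derivative (\<lambda>h. \<Sum>j\<in>UNIV. w j z * h $ j)) (at z)" if "z \<in> ball z0 r" for z
    using D[OF that] that by simp
  show ?thesis
  proof
    show "holomorphic_fun_on F (ball z0 r)" by (rule holomorphic_fun_onI[OF D'])
    show "partial F i z = w i z" if "z \<in> ball z0 r" for i z
      using partial_eqI[of F "\<chi> j. w j z" z i] D'[OF that] by simp
  qed
qed

section \<open>Criteria and determinants for parabolic spheres\<close>

text \<open>A nonzero determinant makes the rows a basis, and expanding v in \<open>b\<close> turns
  the relation into one between rows. This yields injectivity of L and transversality of \<zeta> at
  once.\<close>

lemma rows_independent:
  fixes L :: "'e::euclidean_space \<Rightarrow> real^('n::finite) option"
  assumes L: "linear L" and b: "bij_betw b UNIV Basis"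
    and det: "det (\<chi> i. case i of None \<Rightarrow> \<zeta> | Some j \<Rightarrow> L (b j)) \<noteq> 0"
    and rel: "c *\<^sub>R \<zeta> + L v = 0"
  shows "c = 0 \<and> v = 0"
proof -
  define N where "N = (\<chi> i. case i of None \<Rightarrow> \<zeta> | Some j \<Rightarrow> L (b j))"
  define w where "w = (\<chi> i. case i of None \<Rightarrow> c | Some j \<Rightarrow> v \<bullet> b j)"
  have inj: "inj ((*v) (transpose N))"
  proof -
    have "det (transpose N) \<noteq> 0" using det by (simp add: N_def)
    then show ?thesis
      using det_nz_iff_inj[OF matrix_vector_mul_linear, of "transpose N"]
      unfolding matrix_of_matrix_vector_mul by blast
  qed
  have "v = (\<Sum>j\<in>UNIV. (v \<bullet> b j) *\<^sub>R b j)"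
    using euclidean_representation[of v] sum.reindex_bij_betw[OF b, of "\<lambda>e. (v \<bullet> e) *\<^sub>R e"] by simp
  then have Lv: "L v = (\<Sum>j\<in>UNIV. (v \<bullet> b j) *\<^sub>R L (b j))"
    by (metis (no_types, lifting) L linear_cmul linear_sum sum.cong)
  have "transpose N *v w = c *\<^sub>R \<zeta> + (\<Sum>j\<in>UNIV. (v \<bullet> b j) *\<^sub>R L (b j))"
    by (simp add: vec_eq_iff matrix_vector_mult_def transpose_def sum_option N_def w_def mult.commute)
  then have "transpose N *v w = transpose N *v 0"
    using rel Lv by simp
  then have "w = 0" by (rule injD[OF inj])
  then have "w $ None = 0" "w $ Some j = 0" for j by simp_all
  then have c: "c = 0" and vb: "v \<bullet> b j = 0" for j by (simp_all add: w_def)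
  have "v = 0"
    using \<open>v = (\<Sum>j\<in>UNIV. (v \<bullet> b j) *\<^sub>R b j)\<close> by (simp add: vb)
  with c show ?thesis by simp
qed

text \<open>With constant \<xi> little remains to be checked: the volume formula and nondegeneracy
  of g give a nonzero frame determinant, hence immersion and transversality, and the Gauss formula
  gives parallelism of the volume because \<xi> contributes no derivative.\<close>

lemma Blaschke_onI:
  fixes S :: "'e::euclidean_space set" and \<phi> \<xi> :: "'e \<Rightarrow> real^('n::finite) option"
  assumes dim: "DIM('e) = CARD('n)" and S: "open S" and \<phi>: "smooth_on S \<phi>" and \<xi>: "smooth_on S \<xi>"
    and xi0: "\<And>x u. x \<in> S \<Longrightarrow> ddir \<xi> x u = 0"
    and conn: "connection_on S \<Gamma>" and bil: "\<And>x. x \<in> S \<Longrightarrow> bilinear (g x)"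
    and nondeg: "\<And>x v. x \<in> S \<Longrightarrow> (\<And>u. g x u v = 0) \<Longrightarrow> v = 0"
    and gauss: "\<And>x u v. x \<in> S \<Longrightarrow> ddir (\<lambda>y. ddir \<phi> y v) x u = ddir \<phi> x (\<Gamma> x u v) + g x u v *\<^sub>R \<xi> x"
    and vol: "\<And>x X. x \<in> S \<Longrightarrow> \<bar>induced_volume \<phi> \<xi> x X\<bar> = sqrt \<bar>det (\<chi> i j. g x (X i) (X j))\<bar>"
  shows "Blaschke_on S \<phi> \<xi> \<Gamma> g (\<lambda>x v. 0)"
proof -
  have lin: "linear (ddir \<phi> x)" if "x \<in> S" for x by (rule smooth_on_linear_ddir[OF \<phi> that])
  obtain b :: "'n \<Rightarrow> 'e" where b: "bij_betw b UNIV Basis"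
    using ex_basis_enumeration[OF dim] .
  have indep: "c = 0 \<and> v = 0" if x: "x \<in> S" and "c *\<^sub>R \<xi> x + ddir \<phi> x v = 0" for x c v
  proof (rule rows_independent[OF lin[OF x] b _ that(2)])
    show "det (\<chi> i. case i of None \<Rightarrow> \<xi> x | Some j \<Rightarrow> ddir \<phi> x (b j)) \<noteq> 0"
      using vol[OF x, of b] det_gram_nonzero[OF bil[OF x] nondeg[OF x] b]
      by (auto simp: induced_volume_def)
  qed
  have inj: "inj (ddir \<phi> x)" if "x \<in> S" for x
    using indep[OF that, of 0] by (simp add: linear_injective_0[OF lin[OF that]])
  have trans: "\<xi> x \<notin> range (ddir \<phi> x)" if x: "x \<in> S" for x
  proof
    assume "\<xi> x \<in> range (ddir \<phi> x)"
    then obtain v where "\<xi> x = ddir \<phi> x v" by blast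
    then have "1 *\<^sub>R \<xi> x + ddir \<phi> x (- v) = 0" by (simp add: linear_neg[OF lin[OF x]])
    from indep[OF x this] show False by simp
  qed
  have gauss': "ddir (\<lambda>y. ddir \<phi> y (Y y)) x (X x) = ddir \<phi> x (cov \<Gamma> X Y x) + g x (X x) (Y x) *\<^sub>R \<xi> x"
    if "x \<in> S" "smooth_on S Y" for x X Y
    by (simp add: ddir_ddir_field[OF S that(1) \<phi> that(2)] gauss[OF that(1)] cov_def linear_add[OF lin[OF that(1)]])
  have str: "induced_structure S \<phi> \<xi> \<Gamma> g (\<lambda>x v. 0) (\<lambda>x v. 0)"
    unfolding induced_structure_def
    using conn bil gauss' xi0 linear_0[OF lin] by (auto simp: linear_zero)
  have par: "parallel_volume S \<Gamma> (induced_volume \<phi> \<xi>)"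
    unfolding parallel_volume_def
  proof (intro allI impI ballI)
    fix Y :: "'e \<Rightarrow> 'e" and X :: "'n \<Rightarrow> 'e \<Rightarrow> 'e" and x
    assume Y: "smooth_on S Y" and X: "\<forall>i. smooth_on S (X i)" and x: "x \<in> S"
    show "ddir (\<lambda>y. induced_volume \<phi> \<xi> y (\<lambda>i. X i y)) x (Y x)
        = (\<Sum>i\<in>UNIV. induced_volume \<phi> \<xi> x ((\<lambda>j. X j x)(i := cov \<Gamma> Y (X i) x)))"
      using induced_volume_derivative[OF S x \<phi> \<xi>, where X = X and u = "Y x" and w = 0 and s = 0
          and V = "\<lambda>i. cov \<Gamma> Y (X i) x" and k = "\<lambda>i. g x (Y x) (X i x)"] X gauss'[OF x]
      by (simp add: xi0[OF x] linear_0[OF lin[OF x]] span_zero)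
  qed
  show ?thesis
    unfolding Blaschke_on_def
    using dim \<phi> \<xi> inj trans str nondeg vol par by blast
qed

lemma sign_map_option: "p permutes (UNIV :: 'n::finite set) \<Longrightarrow> sign (map_option p) = sign p"
proof -
  assume p: "p permutes (UNIV :: 'n set)"
  have "map_option p = map_permutation UNIV Some p"
  proof
    fix x show "map_option p x = map_permutation UNIV Some p x"
      by (cases x) (auto simp: map_permutation_def restrict_id_def)
  qed
  then show ?thesis using sign_map_permutation[of Some UNIV p] p by simp
qed

text \<open>Row \<open>None\<close> is a unit vector, so only permutations fixing
  \<open>None\<close> contribute. They are exactly the maps \<open>map_option q\<close>, with the
  sign of q.\<close>

lemma det_option_block:
  fixes R :: "'n::finite \<Rightarrow> real^'n option"
  shows "det (\<chi> i. case i of None \<Rightarrow> axis None 1 | Some j \<Rightarrow> R j) = det (\<chi> j a. R j $ Some a)"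
proof -
  define A where "A = (\<chi> i. case i of None \<Rightarrow> axis None 1 | Some j \<Rightarrow> R j)"
  define P where "P = {p. p permutes (UNIV :: 'n option set)}"
  define Q where "Q = {q. q permutes (UNIV :: 'n set)}"
  have A: "A $ None $ k = (if k = None then 1 else 0)" "A $ Some j $ k = R j $ k" for j k
    by (simp_all add: A_def axis_def)
  have prod: "(\<Prod>i\<in>UNIV. A $ i $ p i) = A $ None $ p None * (\<Prod>j\<in>UNIV. R j $ p (Some j))" for p
    by (simp add: UNIV_option_conv prod.reindex A)
  have inj: "inj_on map_option Q"
  proof (intro inj_onI ext)
    fix f h :: "'n \<Rightarrow> 'n" and x assume "map_option f = map_option h"
    then have "map_option f (Some x) = map_option h (Some x)" by simp
    then show "f x = h x" by simp
  qed
  have img: "map_option ` Q = {p \<in> P. p None = None}"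
  proof (intro equalityI subsetI)
    fix p assume "p \<in> map_option ` Q"
    then obtain q where "q \<in> Q" and p: "p = map_option q" by blast
    then have q: "bij q" by (simp add: Q_def permutes_bij)
    have "bij (map_option q)"
    proof (rule bijI)
      show "inj (map_option q)" using q by (simp add: bij_is_inj option.inj_map)
      then show "surj (map_option q)" by (rule finite_UNIV_inj_surj[OF finite])
    qed
    then have "map_option q permutes UNIV" by (rule bij_imp_permutes) simp
    then show "p \<in> {p \<in> P. p None = None}" using p by (simp add: P_def)
  next
    fix p assume p: "p \<in> {p \<in> P. p None = None}"
    then have bij: "bij p" and pN: "p None = None" by (auto simp: P_def permutes_bij)
    have nz: "p (Some x) \<noteq> None" for x
      using injD[OF bij_is_inj[OF bij], of "Some x" None] pN by auto
    define q where "q x = the (p (Some x))" for x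
    have pq: "p (Some x) = Some (q x)" for x using nz[of x] by (simp add: q_def)
    have "p = map_option q"
    proof
      fix x show "p x = map_option q x" by (cases x) (simp_all add: pN pq)
    qed
    moreover have "q permutes UNIV"
    proof (rule bij_imp_permutes[OF bijI])
      show "inj q"
      proof (rule injI)
        fix x y assume "q x = q y"
        then have "p (Some x) = p (Some y)" by (simp add: pq)
        then show "x = y" using injD[OF bij_is_inj[OF bij]] by blast
      qed
      then show "surj q" by (simp add: finite_UNIV_inj_surj)
    qed simp
    ultimately show "p \<in> map_option ` Q" by (auto simp: Q_def)
  qed
  have "det A = (\<Sum>p\<in>P. of_int (sign p) * (\<Prod>i\<in>UNIV. A $ i $ p i))"
    unfolding P_def by (rule det_def)
  also have "\<dots> = (\<Sum>p\<in>{p \<in> P. p None = None}. of_int (sign p) * (\<Prod>i\<in>UNIV. A $ i $ p i))"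
    by (rule sum.mono_neutral_right) (auto simp: P_def finite_permutations prod A)
  also have "\<dots> = (\<Sum>q\<in>Q. of_int (sign (map_option q)) * (\<Prod>i\<in>UNIV. A $ i $ map_option q i))"
    unfolding img[symmetric] by (rule sum.reindex[OF inj, unfolded o_def])
  also have "\<dots> = (\<Sum>q\<in>Q. of_int (sign q) * (\<Prod>j\<in>UNIV. R j $ Some (q j)))"
    by (rule sum.cong) (simp_all add: Q_def sign_map_option prod A)
  also have "\<dots> = (\<Sum>q\<in>Q. of_int (sign q) * (\<Prod>j\<in>UNIV. (\<chi> j a. R j $ Some a) $ j $ q j))"
    by simp
  also have "\<dots> = det (\<chi> j a. R j $ Some a)"
    unfolding Q_def by (rule det_def[symmetric])
  finally show ?thesis by (simp only: A_def)
qed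

text \<open>Phrased with the fourth power so that it applies to matrices of square -1 without
  discussing the sign of det(-1), that is, the parity of the dimension.\<close>

lemma abs_det_eq_1:
  fixes A :: "real^'n^'n"
  assumes "(A ** A) ** (A ** A) = mat 1"
  shows "\<bar>det A\<bar> = 1"
proof -
  have "(det A * det A) * (det A * det A) = 1"
    using arg_cong[OF assms, of det] by (simp only: det_mul det_I)
  then have "det A * det A = 1 \<or> det A * det A = - 1" by (simp only: square_eq_1_iff)
  moreover have "0 \<le> det A * det A" by simp
  ultimately have "det A * det A = 1" by linarith
  then have "det A = 1 \<or> det A = - 1" by (simp only: square_eq_1_iff)
  then show ?thesis by auto
qed

text \<open>If \<open>g(u, v) = \<omega>(I u, v)\<close> with \<open>I\<^sup>2 = -1\<close> and \<open>\<omega>\<close> is the standard symplectic form in the linear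
  coordinates \<open>p\<close>, then both \<open>I\<close> and the matrix of \<open>\<omega>\<close> have determinant \<open>\<plusminus>1\<close>, so the Gram determinant
  of \<open>g\<close> is \<open>\<plusminus>\<close> the square of the determinant of the coordinates.\<close>

lemma gram_det_symplectic:
  fixes p I :: "'e::euclidean_space \<Rightarrow> 'e" and P :: "'e \<Rightarrow> real^'n::finite"
  assumes P: "linear P" "inj P" and dim: "DIM('e) = CARD('n)" and I: "linear I" "\<And>v. I (I v) = - v"
    and s: "\<And>a. s (s a) = a" and e: "\<And>a. e a * e (s a) = - 1"
    and g: "\<And>u v. g u v = (\<Sum>a\<in>UNIV. e a * P (I u) $ a * P v $ s a)"
  shows "\<bar>det (\<chi> i j. g (X i) (X j))\<bar> = (det (\<chi> i. P (X i)))\<^sup>2"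
proof -
  define M where "M = (\<chi> i. P (X i))"
  \<comment> \<open>The matrix of the symplectic form in the coordinates P: \<open>s\<close> pairs
    conjugate coordinates and \<open>e\<close> carries the sign.\<close>
  define K :: "real^'n^'n" where "K = (\<chi> a b. if b = s a then e a else 0)"
  have Kv: "(K *v w) $ a = e a * w $ s a" for w a
    by (simp add: K_def matrix_vector_mult_def if_distrib[of "\<lambda>x. x * _"] cong: if_cong)
  have "K *v (K *v w) = - w" for w
    by (simp add: vec_eq_iff Kv s e flip: mult.assoc)
  then have K1: "\<bar>det K\<bar> = 1"
    by (intro abs_det_eq_1) (simp add: matrix_eq flip: matrix_vector_mul_assoc)
  have surj: "surj P" using linear_injective_imp_surj[OF P] dim by simp
  define J where "J = matrix (\<lambda>w. P (I (inv P w)))"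
  have invP: "inv P (P v) = v" "P (inv P w) = w" for v w
    using P(2) surj by (simp_all add: surj_f_inv_f)
  have "linear (inv P)"
  proof (rule linearI)
    show "inv P (a + b) = inv P a + inv P b" for a b
      using invP(1)[of "inv P a + inv P b"] by (simp add: linear_add[OF P(1)] invP(2))
    show "inv P (c *\<^sub>R a) = c *\<^sub>R inv P a" for c a
      using invP(1)[of "c *\<^sub>R inv P a"] by (simp add: linear_cmul[OF P(1)] invP(2))
  qed
  then have linJ: "linear (\<lambda>w. P (I (inv P w)))"
    using linear_compose[OF linear_compose[OF _ I(1)] P(1), of "inv P"] by (simp add: o_def)
  have Jv: "J *v w = P (I (inv P w))" for w
    unfolding J_def using matrix_works[of "\<lambda>w. P (I (inv P w))" w] linJ by (simp add: linear_matrix_vector_mul_eq)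
  have "J *v (J *v w) = - w" for w
    by (simp add: Jv invP I(2) linear_neg[OF P(1)])
  then have J1: "\<bar>det J\<bar> = 1"
    by (intro abs_det_eq_1) (simp add: matrix_eq flip: matrix_vector_mul_assoc)
  \<comment> \<open>J is the map I expressed in the coordinates P, so the rows of M times the
    transpose of J are the coordinates of I (X i). The Gram matrix thus factors through M twice,
    with two factors of determinant 1 or -1 in between.\<close>
  have "(\<chi> i j. g (X i) (X j)) = (M ** transpose J) ** (K ** transpose M)"
  proof -
    have 1: "(M ** transpose J) $ i $ a = P (I (X i)) $ a" for i a
    proof -
      have "(M ** transpose J) $ i $ a = (J *v P (X i)) $ a"
        by (simp add: M_def matrix_matrix_mult_def matrix_vector_mult_def transpose_def mult.commute)
      then show ?thesis by (simp add: Jv invP)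
    qed
    have 2: "(K ** transpose M) $ a $ j = e a * P (X j) $ s a" for a j
    proof -
      have "(K ** transpose M) $ a $ j = (K *v P (X j)) $ a"
        by (simp add: M_def matrix_matrix_mult_def matrix_vector_mult_def transpose_def)
      then show ?thesis by (simp add: Kv)
    qed
    have "((M ** transpose J) ** (K ** transpose M)) $ i $ j = (\<Sum>a\<in>UNIV. (M ** transpose J) $ i $ a * (K ** transpose M) $ a $ j)" for i j
      by (simp add: matrix_matrix_mult_def[of "M ** transpose J"])
    then show ?thesis by (simp add: vec_eq_iff g 1 2 mult_ac)
  qed
  then have "\<bar>det (\<chi> i j. g (X i) (X j))\<bar> = \<bar>det M\<bar> * \<bar>det J\<bar> * (\<bar>det K\<bar> * \<bar>det M\<bar>)"
    by (simp add: det_mul abs_mult)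
  then show ?thesis by (simp add: J1 K1 M_def power2_eq_square flip: abs_mult)
qed

section \<open>The sphere defined by a nondegenerate function\<close>

definition cscale :: "complex \<Rightarrow> 'm::finite cotangent \<Rightarrow> 'm cotangent" where
  "cscale c X = (c *s fst X, c *s snd X)"

definition re_part :: "'m::finite cotangent \<Rightarrow> (real^'m) \<times> (real^'m)" where
  "re_part X = ((\<chi> i. Re (fst X $ i)), (\<chi> i. Re (snd X $ i)))"

text \<open>The restriction of \<Omega> to the real points of V.\<close>

definition real_form :: "(real^'m::finite) \<times> (real^'m) \<Rightarrow> (real^'m) \<times> (real^'m) \<Rightarrow> real" where
  "real_form a b = (\<Sum>i\<in>UNIV. fst a $ i * snd b $ i - snd a $ i * fst b $ i)"

lemma bounded_linear_re_part: "bounded_linear re_part"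
  by (rule linear_conv_bounded_linear[THEN iffD1], rule linearI) (auto simp: re_part_def vec_eq_iff)

lemma linear_re_part: "linear re_part"
  using bounded_linear_re_part linear_conv_bounded_linear by blast

lemma bounded_linear_cscale: "bounded_linear (cscale c)"
  by (rule linear_conv_bounded_linear[THEN iffD1], rule linearI)
    (auto simp: cscale_def vec_eq_iff algebra_simps)

lemma bounded_bilinear_real_form: "bounded_bilinear real_form"
proof (rule bilinear_conv_bounded_bilinear[THEN iffD1])
  show "bilinear (real_form :: (real^'m::finite) \<times> (real^'m) \<Rightarrow> (real^'m) \<times> (real^'m) \<Rightarrow> real)"
    unfolding bilinear_def
    by (auto intro!: linearI simp: real_form_def sum.distrib[symmetric] sum_distrib_left algebra_simps
        simp flip: sum_subtractf)
qed

lemma Omega_cscale: "Omega (cscale c X) Y = c * Omega X Y" "Omega X (cscale c Y) = c * Omega X Y"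
  by (simp_all add: Omega_def cscale_def sum_distrib_left algebra_simps)

text \<open>Re \<gamma> is a difference of two sums, of products Re times Im and of products Im
  times Re, whose total is Im \<Omega>(X, Y). When this total vanishes the sums are opposite, and Re
  \<gamma> is twice one of them.\<close>

lemma Re_hermitian_form:
  assumes "Omega X Y = 0"
  shows "Re (hermitian_form X Y) = 2 * real_form (re_part (cscale \<i> X)) (re_part Y)"
proof -
  have "Im (Omega X Y) = 0" using assms by simp
  then have "(\<Sum>i\<in>UNIV. Re (fst X $ i) * Im (snd Y $ i) + Im (fst X $ i) * Re (snd Y $ i)
      - (Re (snd X $ i) * Im (fst Y $ i) + Im (snd X $ i) * Re (fst Y $ i))) = 0"
    by (simp add: Omega_def)
  moreover have "Re (hermitian_form X Y) = (\<Sum>i\<in>UNIV. Re (fst X $ i) * Im (snd Y $ i) - Im (fst X $ i) * Re (snd Y $ i)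
      - (Re (snd X $ i) * Im (fst Y $ i) - Im (snd X $ i) * Re (fst Y $ i)))"
    by (simp add: hermitian_form_def Omega_def conjugation_def flip: sum_negf) (simp add: algebra_simps)
  moreover have "2 * real_form (re_part (cscale \<i> X)) (re_part Y)
    = (\<Sum>i\<in>UNIV. 2 * (Im (snd X $ i) * Re (fst Y $ i) - Im (fst X $ i) * Re (snd Y $ i)))"
    by (simp add: real_form_def re_part_def cscale_def sum_distrib_left)
  moreover have "(\<Sum>i\<in>UNIV. 2 * (Im (snd X $ i) * Re (fst Y $ i) - Im (fst X $ i) * Re (snd Y $ i)))
     = (\<Sum>i\<in>UNIV. Re (fst X $ i) * Im (snd Y $ i) - Im (fst X $ i) * Re (snd Y $ i)
      - (Re (snd X $ i) * Im (fst Y $ i) - Im (snd X $ i) * Re (fst Y $ i)))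
     - (\<Sum>i\<in>UNIV. Re (fst X $ i) * Im (snd Y $ i) + Im (fst X $ i) * Re (snd Y $ i)
      - (Re (snd X $ i) * Im (fst Y $ i) + Im (snd X $ i) * Re (fst Y $ i)))"
    by (simp flip: sum_subtractf)
  ultimately show ?thesis by linarith
qed

lemma smooth_on_Pair:
  fixes f :: "'a::real_normed_vector \<Rightarrow> 'b::euclidean_space" and g :: "'a \<Rightarrow> 'c::euclidean_space"
  assumes "open S" "smooth_on S f" "smooth_on S g"
  shows "smooth_on S (\<lambda>x. (f x, g x))"
proof -
  have "bounded_linear (\<lambda>v :: 'b. (v, 0 :: 'c))" "bounded_linear (\<lambda>v :: 'c. (0 :: 'b, v))"
    by (auto intro!: bounded_linear_Pair bounded_linear_ident bounded_linear_zero)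
  from smooth_on_add[OF assms(1) smooth_on_linear[OF this(1) assms(1,2)] smooth_on_linear[OF this(2) assms(1,3)]]
  show ?thesis by simp
qed

lemma dim_complex_vec: "DIM(complex^'m::finite) = 2 * CARD('m)"
  and dim_real_pair: "DIM((real^'m::finite) \<times> (real^'m)) = 2 * CARD('m)"
  by simp_all

section \<open>Metric and flat connection of a nondegenerate function\<close>

locale nondegenerate_function =
  fixes U :: "(complex^'m::finite) set" and F :: "complex^'m \<Rightarrow> complex"
  assumes open_U: "open U" and nondegenerate: "nondegenerate_on U F"
begin

lemma hol: "holomorphic_fun_on F U"
  using nondegenerate unfolding nondegenerate_on_def by blast

lemma smooth_partial: "smooth_on U (partial F i)"
  by (rule holomorphic_smooth_on[OF open_U holomorphic_partial[OF open_U hol]])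

lemma smooth_dF: "smooth_on U (dF_immersion F)"
  unfolding dF_immersion_def[abs_def]
  by (rule smooth_on_Pair[OF open_U smooth_on_ident smooth_on_vec[OF open_U smooth_partial]])

lemma dF_derivative:
  assumes z: "z \<in> U"
  shows "ddir (dF_immersion F) z u = (u, \<chi> i. \<Sum>j\<in>UNIV. partial (partial F i) j z * u $ j)"
proof (rule prod_eqI)
  show "fst (ddir (dF_immersion F) z u) = fst (u, \<chi> i. \<Sum>j\<in>UNIV. partial (partial F i) j z * u $ j)"
    using ddir_bounded_linear[OF bounded_linear_fst smooth_dF z, of u] by (simp add: dF_immersion_def)
  show "snd (ddir (dF_immersion F) z u) = snd (u, \<chi> i. \<Sum>j\<in>UNIV. partial (partial F i) j z * u $ j)"
  proof (rule vec_eq_iff[THEN iffD2], rule allI)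
    fix i
    have "snd (ddir (dF_immersion F) z u) $ i = ddir (partial F i) z u"
      using ddir_bounded_linear[OF bounded_linear_compose[OF bounded_linear_vec_nth bounded_linear_snd] smooth_dF z, of i u]
      by (simp add: dF_immersion_def)
    then show "snd (ddir (dF_immersion F) z u) $ i = snd (u, \<chi> i. \<Sum>j\<in>UNIV. partial (partial F i) j z * u $ j) $ i"
      using ddir_holomorphic[OF holomorphic_partial[OF open_U hol] z] by simp
  qed
qed

lemma dF_derivative_cscale: "z \<in> U \<Longrightarrow> ddir (dF_immersion F) z (c *s u) = cscale c (ddir (dF_immersion F) z u)"
  by (simp add: dF_derivative cscale_def vec_eq_iff sum_distrib_left algebra_simps)

text \<open>Symmetry of the second partial derivatives, i.e. closedness of dF.\<close>

lemma dF_Lagrangian: "z \<in> U \<Longrightarrow> Omega (ddir (dF_immersion F) z u) (ddir (dF_immersion F) z v) = 0"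
proof -
  assume z: "z \<in> U"
  have "(\<Sum>i\<in>UNIV. (\<Sum>j\<in>UNIV. partial (partial F i) j z * u $ j) * v $ i)
      = (\<Sum>i\<in>UNIV. \<Sum>j\<in>UNIV. u $ j * (partial (partial F j) i z * v $ i))"
    by (simp add: sum_distrib_right sum_distrib_left mult_ac partial_partial_commute[OF open_U hol z])
  also have "\<dots> = (\<Sum>j\<in>UNIV. \<Sum>i\<in>UNIV. u $ j * (partial (partial F j) i z * v $ i))"
    by (rule sum.swap)
  finally show ?thesis
    by (simp add: Omega_def dF_derivative[OF z] sum_subtractf sum_distrib_left)
qed

text \<open>The differential of the affine coordinates (Re z, Re w), used as a moving frame in which
  covariant differentiation becomes ordinary differentiation.\<close>

definition q :: "complex^'m \<Rightarrow> complex^'m \<Rightarrow> (real^'m) \<times> (real^'m)" where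
  "q z u = re_part (ddir (dF_immersion F) z u)"

lemma linear_q: "z \<in> U \<Longrightarrow> linear (q z)"
  using linear_compose[OF smooth_on_linear_ddir[OF smooth_dF] linear_re_part] unfolding q_def[abs_def] o_def .

lemma smooth_q: "smooth_on U (\<lambda>z. q z v)"
  unfolding q_def by (rule smooth_on_linear[OF bounded_linear_re_part open_U smooth_on_ddir[OF smooth_dF]])

lemma metric_eq: "z \<in> U \<Longrightarrow> metric_of F z u v = 2 * real_form (q z (\<i> *s u)) (q z v)"
  unfolding metric_of_def pullback_form_def q_def
  by (simp add: Re_hermitian_form[OF dF_Lagrangian] dF_derivative_cscale)

lemma linear_mult_i: "linear (\<lambda>u :: complex^'m. \<i> *s u)"
  by (rule linearI) (simp_all add: vec_eq_iff algebra_simps)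

lemma bilinear_metric: "z \<in> U \<Longrightarrow> bilinear (metric_of F z)"
proof -
  assume z: "z \<in> U"
  have bil: "bilinear (real_form :: (real^'m) \<times> (real^'m) \<Rightarrow> (real^'m) \<times> (real^'m) \<Rightarrow> real)"
    using bounded_bilinear_real_form bilinear_conv_bounded_bilinear by blast
  note lin = linear_q[OF z]
  have 1: "\<i> *s (u + v) = \<i> *s u + \<i> *s v" "\<i> *s (c *\<^sub>R u) = c *\<^sub>R (\<i> *s u)" for u v :: "complex^'m" and c :: real
    using linear_mult_i by (simp_all add: linear_add linear_cmul)
  have "metric_of F z = (\<lambda>u v. 2 * real_form (q z (\<i> *s u)) (q z v))"
    using metric_eq[OF z] by (intro ext)
  then show ?thesis
    unfolding bilinear_def
    by (auto intro!: linearI simp: 1 linear_add[OF lin] linear_cmul[OF lin] bilinear_ladd[OF bil] bilinear_radd[OF bil]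
        bilinear_lmul[OF bil] bilinear_rmul[OF bil] algebra_simps)
qed

text \<open>The real part determines the whole form: replacing u by i u multiplies the form by i and
  so exposes its imaginary part.\<close>

lemma metric_nondegenerate:
  assumes z: "z \<in> U" and v: "\<And>u. metric_of F z u v = 0"
  shows "v = 0"
proof -
  have "pullback_form F z u v = 0" for u
  proof -
    have "pullback_form F z (\<i> *s u) v = \<i> * pullback_form F z u v"
      by (simp add: pullback_form_def dF_derivative_cscale[OF z] hermitian_form_def Omega_cscale)
    then have "Im (pullback_form F z u v) = 0"
      using v[of "\<i> *s u"] by (simp add: metric_of_def)
    then show ?thesis using v[of u] by (simp add: metric_of_def complex_eq_iff)
  qed
  then show ?thesis
    using nondegenerate z unfolding nondegenerate_on_def by blast
qed

text \<open>The metric depends on v only through q v, so a vector killed by q is g-null. This is the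
  reason why Re z and Re w are local coordinates.\<close>

lemma inj_q: "z \<in> U \<Longrightarrow> inj (q z)"
proof -
  assume z: "z \<in> U"
  have "v = 0" if "q z v = 0" for v
  proof (rule metric_nondegenerate[OF z])
    show "metric_of F z u v = 0" for u
      by (simp add: metric_eq[OF z] that bounded_bilinear.zero_right[OF bounded_bilinear_real_form])
  qed
  then show ?thesis by (simp add: linear_injective_0[OF linear_q[OF z]])
qed

lemma surj_q: "z \<in> U \<Longrightarrow> surj (q z)"
  by (rule linear_injective_imp_surj[OF linear_q inj_q]) (simp_all add: dim_complex_vec dim_real_pair)

text \<open>Flatness of the coordinates \<open>Re z\<close>, \<open>Re w\<close> says \<open>D(q)(u) v = q(\<Gamma>(u, v))\<close>, which determines
  the connection.\<close>

definition Gam :: "complex^'m \<Rightarrow> complex^'m \<Rightarrow> complex^'m \<Rightarrow> complex^'m" where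
  "Gam z u v = inv (q z) (ddir (\<lambda>y. q y v) z u)"

lemma q_Gam: "z \<in> U \<Longrightarrow> q z (Gam z u v) = ddir (\<lambda>y. q y v) z u"
  unfolding Gam_def by (rule surj_f_inv_f[OF surj_q])

lemma ddir_coordinates: "z \<in> U \<Longrightarrow> ddir (\<lambda>y. re_part (dF_immersion F y)) z u = q z u"
  unfolding q_def by (rule ddir_bounded_linear[OF bounded_linear_re_part smooth_dF])

lemma smooth_coordinates: "smooth_on U (\<lambda>y. re_part (dF_immersion F y))"
  by (rule smooth_on_linear[OF bounded_linear_re_part open_U smooth_dF])

lemma q_derivative_symmetric:
  assumes z: "z \<in> U"
  shows "ddir (\<lambda>y. q y v) z u = ddir (\<lambda>y. q y u) z v"
proof -
  have "ddir (\<lambda>y. q y w) z = ddir (\<lambda>y. ddir (\<lambda>y. re_part (dF_immersion F y)) y w) z" for w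
    by (rule ddir_cong[OF open_U z]) (simp add: ddir_coordinates)
  then show ?thesis
    using ddir_ddir_commute[OF open_U z smooth_coordinates, of v u] by simp
qed

lemma q_derivative_linear: "z \<in> U \<Longrightarrow> linear (\<lambda>u. ddir (\<lambda>y. q y v) z u)"
  by (rule smooth_on_linear_ddir[OF smooth_q])

lemma bilinear_Gam: "z \<in> U \<Longrightarrow> bilinear (Gam z)"
proof -
  assume z: "z \<in> U"
  note inj = injD[OF inj_q[OF z]]
  note l = linear_add[OF linear_q[OF z]] linear_cmul[OF linear_q[OF z]] q_Gam[OF z]
    linear_add[OF q_derivative_linear[OF z]] linear_cmul[OF q_derivative_linear[OF z]]
  have left: "linear (\<lambda>u. Gam z u v)" for v
    by (rule linearI; rule inj; simp add: l)
  have sym: "Gam z u v = Gam z v u" for u v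
    by (rule inj) (simp add: q_Gam[OF z] q_derivative_symmetric[OF z, of v u])
  show ?thesis
    unfolding bilinear_def using left by (simp add: sym[of _ ] ) 
qed

lemma Gam_symmetric: "z \<in> U \<Longrightarrow> Gam z u v = Gam z v u"
  by (simp add: Gam_def q_derivative_symmetric[of z v u])

lemma smooth_Gam: "smooth_on U (\<lambda>z. Gam z u v)"
proof (rule smooth_on_linear_solve[where 'k = "'m + 'm" and q = q and h = "\<lambda>z. ddir (\<lambda>y. q y v) z u"])
  show "smooth_on U (\<lambda>z. ddir (\<lambda>y. q y v) z u)" by (rule smooth_on_ddir[OF smooth_q])
qed (simp_all add: open_U dim_complex_vec dim_real_pair linear_q inj_q smooth_q q_Gam)

lemma connection_Gam: "connection_on U Gam"
  unfolding connection_on_def using bilinear_Gam smooth_Gam by blast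

text \<open>Seen through q, the covariant derivative is the derivative of a vector-valued function.
  The relation between \<Gamma> and q is an assumption, so that the lemma serves \<open>Gam\<close>
  and any other connection of F alike.\<close>

lemma q_field:
  assumes z: "z \<in> U" and Y: "smooth_on U Y"
    and \<Gamma>: "\<And>u v. q z (\<Gamma> z u v) = ddir (\<lambda>y. q y v) z u"
  shows "ddir (\<lambda>y. q y (Y y)) z (X z) = q z (cov \<Gamma> X Y z)"
  using ddir_linear_family[where q = q, OF open_U z linear_q smooth_q Y]
  by (simp add: cov_def linear_add[OF linear_q[OF z]] \<Gamma>)

lemma smooth_cov: "smooth_on U X \<Longrightarrow> smooth_on U Y \<Longrightarrow> smooth_on U (cov Gam X Y)"
proof -
  assume X: "smooth_on U X" and Y: "smooth_on U Y"
  have 1: "smooth_on U (\<lambda>x. Gam x (X x) v)" for v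
    by (rule smooth_on_linear_family[where q = "\<lambda>x u. Gam x u v", OF open_U _ smooth_Gam X])
      (use bilinear_Gam in \<open>auto simp: bilinear_def\<close>)
  have 2: "smooth_on U (\<lambda>x. Gam x (X x) (Y x))"
    by (rule smooth_on_linear_family[where q = "\<lambda>x v. Gam x (X x) v", OF open_U _ 1 Y])
      (use bilinear_Gam in \<open>auto simp: bilinear_def\<close>)
  show ?thesis
    unfolding cov_def[abs_def]
    by (rule smooth_on_add[OF open_U smooth_on_ddir_field[OF open_U Y X] 2])
qed

lemma torsionfree_Gam: "torsionfree_on U Gam"
  unfolding torsionfree_on_def cov_def lie_bracket_def by (simp add: Gam_symmetric)

text \<open>For h = q Z, iterated covariant derivatives of Z become iterated derivatives of h. The
  curvature identity is then the commutator identity for h, pulled back through the injective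
  q.\<close>

lemma flat_Gam: "flat_on U Gam"
  unfolding flat_on_def
proof (intro allI impI ballI)
  fix X Y Z :: "complex^'m \<Rightarrow> complex^'m" and x assume X: "smooth_on U X" and Y: "smooth_on U Y" and Z: "smooth_on U Z" and x: "x \<in> U"
  define h where "h y = q y (Z y)" for y
  have h: "smooth_on U h"
    unfolding h_def[abs_def] by (rule smooth_on_linear_family[where q = q, OF open_U linear_q smooth_q Z])
  have hq: "ddir h y (W y) = q y (cov Gam W Z y)" if "y \<in> U" for y W
    unfolding h_def[abs_def] by (rule q_field[where \<Gamma> = Gam, OF that Z q_Gam[OF that]])
  have qq: "q x (cov Gam W (cov Gam W' Z) x) = ddir (\<lambda>y. ddir h y (W' y)) x (W x)"
    if W: "smooth_on U W" and W': "smooth_on U W'" for W W'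
  proof -
    have "q x (cov Gam W (cov Gam W' Z) x) = ddir (\<lambda>y. q y (cov Gam W' Z y)) x (W x)"
      by (rule q_field[where \<Gamma> = Gam, OF x smooth_cov[OF W' Z] q_Gam[OF x], symmetric])
    also have "ddir (\<lambda>y. q y (cov Gam W' Z y)) x = ddir (\<lambda>y. ddir h y (W' y)) x"
      by (rule ddir_cong[OF open_U x]) (simp add: hq)
    finally show ?thesis .
  qed
  have "q x (cov Gam X (cov Gam Y Z) x - cov Gam Y (cov Gam X Z) x) = q x (cov Gam (lie_bracket X Y) Z x)"
    using ddir_commutator[OF open_U x h X Y]
    by (simp add: linear_diff[OF linear_q[OF x]] qq X Y hq[OF x])
  then show "cov Gam X (cov Gam Y Z) x - cov Gam Y (cov Gam X Z) x = cov Gam (lie_bracket X Y) Z x"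
    by (rule injD[OF inj_q[OF x]])
qed

lemma parallel_coordinate:
  fixes L :: "(real^'m) \<times> (real^'m) \<Rightarrow> real"
  assumes L: "bounded_linear L"
  shows "parallel_differential U Gam (\<lambda>z. L (re_part (dF_immersion F z)))"
  unfolding parallel_differential_def
proof (intro allI impI ballI)
  fix X Y :: "complex^'m \<Rightarrow> complex^'m" and x assume X: "smooth_on U X" and Y: "smooth_on U Y" and x: "x \<in> U"
  have d: "ddir (\<lambda>z. L (re_part (dF_immersion F z))) y v = L (q y v)" if "y \<in> U" for y v
    using ddir_bounded_linear[OF L smooth_coordinates that] ddir_coordinates[OF that] by simp
  have "ddir (\<lambda>y. ddir (\<lambda>z. L (re_part (dF_immersion F z))) y (Y y)) x = ddir (\<lambda>y. L (q y (Y y))) x"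
    by (rule ddir_cong[OF open_U x]) (simp add: d)
  moreover have "ddir (\<lambda>y. L (q y (Y y))) x (X x) = L (ddir (\<lambda>y. q y (Y y)) x (X x))"
    by (rule ddir_bounded_linear[OF L smooth_on_linear_family[where q = q, OF open_U linear_q smooth_q Y] x])
  ultimately show "ddir (\<lambda>y. ddir (\<lambda>z. L (re_part (dF_immersion F z))) y (Y y)) x (X x)
      = ddir (\<lambda>z. L (re_part (dF_immersion F z))) x (cov Gam X Y x)"
    using q_field[where \<Gamma> = Gam, OF x Y q_Gam[OF x]] by (simp add: d[OF x])
qed

lemma is_connection_Gam: "is_connection_of U F Gam"
proof -
  have "parallel_differential U Gam (\<lambda>z. Re (z $ i))" for i
    using parallel_coordinate[OF bounded_linear_compose[OF bounded_linear_vec_nth bounded_linear_fst], of i]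
    by (simp add: re_part_def dF_immersion_def)
  moreover have "parallel_differential U Gam (\<lambda>z. Re (partial F i z))" for i
    using parallel_coordinate[OF bounded_linear_compose[OF bounded_linear_vec_nth bounded_linear_snd], of i]
    by (simp add: re_part_def dF_immersion_def)
  ultimately show ?thesis
    unfolding is_connection_of_def using connection_Gam torsionfree_Gam flat_Gam by blast
qed

text \<open>Testing the parallel differentials on constant fields u and v gives this equation one
  coordinate at a time; with q injective it determines the connection.\<close>

lemma connection_q:
  assumes \<Gamma>: "is_connection_of U F \<Gamma>" and z: "z \<in> U"
  shows "q z (\<Gamma> z u v) = ddir (\<lambda>y. q y v) z u"
proof -
  have *: "L (q z (\<Gamma> z u v)) = L (ddir (\<lambda>y. q y v) z u)"
    if L: "bounded_linear L" and par: "parallel_differential U \<Gamma> (\<lambda>z. L (re_part (dF_immersion F z)))"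
    for L :: "(real^'m) \<times> (real^'m) \<Rightarrow> real"
  proof -
    have d: "ddir (\<lambda>z. L (re_part (dF_immersion F z))) y v = L (q y v)" if "y \<in> U" for y v
      using ddir_bounded_linear[OF L smooth_coordinates that] ddir_coordinates[OF that] by simp
    have "\<forall>X Y. smooth_on U X \<longrightarrow> smooth_on U Y \<longrightarrow> (\<forall>x\<in>U. ddir (\<lambda>y. ddir (\<lambda>z. L (re_part (dF_immersion F z))) y (Y y)) x (X x)
        = ddir (\<lambda>z. L (re_part (dF_immersion F z))) x (cov \<Gamma> X Y x))"
      using par unfolding parallel_differential_def .
    from this[rule_format, of "\<lambda>_. u" "\<lambda>_. v", OF smooth_on_const smooth_on_const z]
    have "ddir (\<lambda>y. ddir (\<lambda>z. L (re_part (dF_immersion F z))) y v) z u = L (q z (\<Gamma> z u v))"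
      by (simp add: cov_def d[OF z])
    moreover have "ddir (\<lambda>y. ddir (\<lambda>z. L (re_part (dF_immersion F z))) y v) z = ddir (\<lambda>y. L (q y v)) z"
      by (rule ddir_cong[OF open_U z]) (simp add: d)
    moreover have "ddir (\<lambda>y. L (q y v)) z u = L (ddir (\<lambda>y. q y v) z u)"
      by (rule ddir_bounded_linear[OF L smooth_q z])
    ultimately show ?thesis by simp
  qed
  have "parallel_differential U \<Gamma> (\<lambda>z. Re (z $ i))" "parallel_differential U \<Gamma> (\<lambda>z. Re (partial F i z))" for i
    using \<Gamma> unfolding is_connection_of_def by auto
  then have "fst (q z (\<Gamma> z u v)) $ i = fst (ddir (\<lambda>y. q y v) z u) $ i"
    "snd (q z (\<Gamma> z u v)) $ i = snd (ddir (\<lambda>y. q y v) z u) $ i" for i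
    using *[OF bounded_linear_compose[OF bounded_linear_vec_nth bounded_linear_fst], of i]
      *[OF bounded_linear_compose[OF bounded_linear_vec_nth bounded_linear_snd], of i]
    by (simp_all add: re_part_def dF_immersion_def)
  then show ?thesis by (simp add: prod_eq_iff vec_eq_iff)
qed

lemma connection_unique: "is_connection_of U F \<Gamma> \<Longrightarrow> z \<in> U \<Longrightarrow> \<Gamma> z u v = Gam z u v"
  using connection_q[of \<Gamma> z u v] q_Gam[of z u v] injD[OF inj_q[of z]] by simp

section \<open>Uniqueness and special structure of the spheres of F\<close>

lemma sphere_xi_constant:
  fixes \<phi> \<xi> :: "complex^'m \<Rightarrow> real^('n::finite) option"
  assumes conn: "is_connection_of U F \<Gamma>" and bl: "Blaschke_on U \<phi> \<xi> \<Gamma> (metric_of F) B" and x: "x \<in> U"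
  shows "ddir \<xi> x u = 0"
proof -
  interpret blaschke_chart U \<phi> \<xi> \<Gamma> "metric_of F" B using open_U bl by unfold_locales
  \<comment> \<open>The index type \<open>'m\<close> is nonempty, so n = 2 m is at least 2, as
    \<open>shape_zero\<close> demands.\<close>
  have "2 \<le> CARD('n)"
    using dim dim_complex_vec[where 'm = 'm] zero_less_card_finite[where 'a = 'm] by linarith
  then have "B x u = 0"
    using conn by (intro shape_zero[OF _ _ x]) (simp_all add: is_connection_of_def)
  then show ?thesis
    using weingarten[OF x, of u] linear_0[OF linear_df[OF x]] by simp
qed

lemma sphere_unique:
  fixes \<phi> \<xi> \<psi> \<eta> :: "complex^'m \<Rightarrow> real^('n::finite) option"
  assumes U: "connected U" and "sphere_of_function U F \<phi> \<xi>" "sphere_of_function U F \<psi> \<eta>"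
  shows "equiaffine_related U \<phi> \<psi>"
proof -
  obtain \<Gamma> B where 1: "is_connection_of U F \<Gamma>" "Blaschke_on U \<phi> \<xi> \<Gamma> (metric_of F) B"
    using assms(2) unfolding sphere_of_function_def by blast
  obtain \<Gamma>' B' where 2: "is_connection_of U F \<Gamma>'" "Blaschke_on U \<psi> \<eta> \<Gamma>' (metric_of F) B'"
    using assms(3) unfolding sphere_of_function_def by blast
  show ?thesis
  proof (rule equiaffine_unique[OF open_U U 1(2) _ 2(2)])
    show "\<Gamma>' x u v = \<Gamma> x u v" if "x \<in> U" for x u v
      using connection_unique[OF 1(1) that] connection_unique[OF 2(1) that] by simp
  qed (rule sphere_xi_constant[OF 1] sphere_xi_constant[OF 2], assumption)+
qed

text \<open>J is multiplication by i, and g(i u, v) = - 2 \<open>real_form (q u) (q v)\<close> has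
  constant coefficients in the flat coordinates, hence is parallel. The chart map is the identity,
  but its \<open>inv_into\<close> agrees with the identity only on U, so data are moved to the chart
  by congruence on U.\<close>

lemma sphere_special:
  fixes \<phi> \<xi> :: "complex^'m \<Rightarrow> real^('n::finite) option"
  assumes "sphere_of_function U F \<phi> \<xi>"
  shows "special_parabolic_sphere U {(U, id)} \<phi> \<xi>"
proof -
  obtain \<Gamma> B where 1: "is_connection_of U F \<Gamma>" "Blaschke_on U \<phi> \<xi> \<Gamma> (metric_of F) B"
    using assms unfolding sphere_of_function_def by blast
  interpret blaschke_chart U \<phi> \<xi> \<Gamma> "metric_of F" B using open_U 1(2) by unfold_locales
  let ?c = "(U, id) :: (complex^'m, complex^'m) chart"
  have img: "chart_image ?c = U" by (simp add: chart_image_def)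
  have inc: "in_chart ?c h y = h y" if "y \<in> U" for h :: "complex^'m \<Rightarrow> 'z" and y
    using that by (simp add: in_chart_def)
  have sm: "smooth_on U (in_chart ?c h)" if "smooth_on U h" for h :: "complex^'m \<Rightarrow> 'z::real_normed_vector"
    by (rule smooth_on_congI[OF open_U that]) (simp add: inc)
  have dd: "ddir (in_chart ?c h) y = ddir h y" if "y \<in> U" for h :: "complex^'m \<Rightarrow> 'z::real_normed_vector" and y
    by (rule ddir_cong[OF open_U that]) (simp add: inc)
  have inv: "inv_into U id y = y" if "y \<in> U" for y using that by simp
  have man: "smooth_manifold U {?c}"
    unfolding smooth_manifold_def is_chart_def smooth_transition_def
  proof (intro conjI ballI; (elim singletonE)?; (hypsubst)?)
    show "homeomorphism (fst ?c) (chart_image ?c) (snd ?c) (inv_into (fst ?c) (snd ?c))"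
      by (rule homeomorphismI) (auto simp: img intro: continuous_on_eq[OF continuous_on_id])
    show "smooth_on (snd ?c ` (fst ?c \<inter> fst ?c)) (in_chart ?c (snd ?c))"
      using sm[OF smooth_on_ident] by (simp add: id_def)
  qed (simp_all add: img open_U)
  have "Blaschke_on U (in_chart ?c \<phi>) (in_chart ?c \<xi>) \<Gamma> (metric_of F) (\<lambda>x v. 0)"
  proof (rule Blaschke_onI[OF dim open_U sm[OF smooth_f] sm[OF smooth_xi] _ connection bilinear_metric metric_nondegenerate])
    show "ddir (in_chart ?c \<xi>) x u = 0" if "x \<in> U" for x u
      using sphere_xi_constant[OF 1 that] by (simp add: dd[OF that])
    show "ddir (\<lambda>y. ddir (in_chart ?c \<phi>) y v) x u
        = ddir (in_chart ?c \<phi>) x (\<Gamma> x u v) + metric_of F x u v *\<^sub>R in_chart ?c \<xi> x" if x: "x \<in> U" for x u v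
    proof -
      have "ddir (\<lambda>y. ddir (in_chart ?c \<phi>) y v) x = ddir (\<lambda>y. ddir \<phi> y v) x"
        by (rule ddir_cong[OF open_U x]) (simp add: dd)
      then show ?thesis by (simp add: gauss[OF x] dd[OF x] inc[OF x])
    qed
    show "\<bar>induced_volume (in_chart ?c \<phi>) (in_chart ?c \<xi>) x X\<bar> = sqrt \<bar>det (\<chi> i j. metric_of F x (X i) (X j))\<bar>"
      if x: "x \<in> U" for x X
      using volume[OF x, of X] by (simp add: induced_volume_def inc[OF x] dd[OF x] cong: option.case_cong)
  qed
  moreover have "(*\<^sub>R) 0 = (\<lambda>v :: complex^'m. 0)" by (simp add: fun_eq_iff)
  ultimately have par: "parabolic_sphere U {?c} \<phi> \<xi> (\<lambda>_. \<Gamma>) (\<lambda>_. metric_of F)"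
    unfolding parabolic_sphere_def affine_hypersphere_def Blaschke_immersion_def
    using man by (simp add: img)
  have ac: "almost_complex_structure {?c} (\<lambda>_ x v. \<i> *s v)"
  proof -
    have "ddir (in_chart ?c id) p = (\<lambda>v. v)" if "p \<in> U" for p
      using dd[OF that, of "\<lambda>x. x"] by (simp add: id_def)
    moreover have "\<i> *s (\<i> *s v) = - v" for v :: "complex^'m" by (simp add: vec_eq_iff)
    ultimately show ?thesis
      unfolding almost_complex_structure_def using linear_mult_i by (simp add: img smooth_on_const)
  qed
  have herm: "metric_of F x (\<i> *s u) (\<i> *s v) = metric_of F x u v" if x: "x \<in> U" for x u v
  proof -
    have "\<i> * a * (\<i> * b) = - (a * b)" for a b
      by (simp add: complex_eq_iff algebra_simps)
    then have "pullback_form F x (\<i> *s u) (\<i> *s v) = pullback_form F x u v"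
      by (simp add: pullback_form_def dF_derivative_cscale[OF x] hermitian_form_def Omega_def conjugation_def cscale_def)
    then show ?thesis by (simp add: metric_of_def)
  qed
  have om: "metric_of F x (\<i> *s u) v = - 2 * real_form (q x u) (q x v)" if x: "x \<in> U" for x u v
  proof -
    have "\<i> *s (\<i> *s u) = - u" by (simp add: vec_eq_iff)
    then show ?thesis
      by (simp add: metric_eq[OF x] linear_neg[OF linear_q[OF x]] bounded_bilinear.minus_left[OF bounded_bilinear_real_form])
  qed
  have par2: "parallel_2form U \<Gamma> (\<lambda>x u v. metric_of F x (\<i> *s u) v)"
    unfolding parallel_2form_def
  proof (intro allI impI ballI)
    fix X Y Z :: "complex^'m \<Rightarrow> complex^'m" and x assume Y: "smooth_on U Y" and Z: "smooth_on U Z" and x: "x \<in> U"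
    have sq: "smooth_on U (\<lambda>x. q x (V x))" if "smooth_on U V" for V
      by (rule smooth_on_linear_family[where q = q, OF open_U linear_q smooth_q that])
    have "ddir (\<lambda>y. metric_of F y (\<i> *s Y y) (Z y)) x = ddir (\<lambda>y. - 2 * real_form (q y (Y y)) (q y (Z y))) x"
      by (rule ddir_cong[OF open_U x]) (simp add: om)
    moreover have "((\<lambda>y. - 2 * real_form (q y (Y y)) (q y (Z y))) has_derivative
        (\<lambda>u. - 2 * (real_form (q x (Y x)) (ddir (\<lambda>y. q y (Z y)) x u) + real_form (ddir (\<lambda>y. q y (Y y)) x u) (q x (Z x))))) (at x)"
      by (intro has_derivative_mult_right bounded_bilinear.FDERIV[OF bounded_bilinear_real_form]
          smooth_onD[OF sq[OF Y] x] smooth_onD[OF sq[OF Z] x])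
    ultimately show "ddir (\<lambda>y. metric_of F y (\<i> *s Y y) (Z y)) x (X x)
        = metric_of F x (\<i> *s cov \<Gamma> X Y x) (Z x) + metric_of F x (\<i> *s Y x) (cov \<Gamma> X Z x)"
      using q_field[where \<Gamma> = \<Gamma>, OF x Y connection_q[OF 1(1) x], of X] q_field[where \<Gamma> = \<Gamma>, OF x Z connection_q[OF 1(1) x], of X]
      by (simp add: ddir_eqI om[OF x])
  qed
  show ?thesis
    unfolding special_parabolic_sphere_def
    using par ac herm par2
    by (intro exI[of _ "\<lambda>_. \<Gamma>"] exI[of _ "\<lambda>_. metric_of F"] exI[of _ "\<lambda>_ x v. \<i> *s v"]) (simp add: img)
qed

section \<open>The Hesse potential and its graph\<close>

definition potential :: "complex^'m \<Rightarrow> real" where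
  "potential z = 2 * (Im (F z) - (\<Sum>i\<in>UNIV. Im (z $ i) * Re (partial F i z)))"

lemma smooth_potential: "smooth_on U potential"
  unfolding potential_def[abs_def]
  by (intro smooth_on_mult smooth_on_const smooth_on_diff smooth_on_sum open_U
      smooth_on_linear[OF bounded_linear_Im] smooth_on_linear[OF bounded_linear_Re]
      smooth_on_vec_nth smooth_on_ident smooth_partial holomorphic_smooth_on hol)

text \<open>Subtracting Im z^i Re w_i cancels the terms containing d Im z^i. What remains is a
  combination of d Re z^i and d Re w_i alone, the differentials of the affine coordinates, with the
  imaginary parts of z and w as coefficients.\<close>

lemma ddir_potential:
  assumes z: "z \<in> U"
  shows "ddir potential z v = 2 * real_form (re_part (cscale \<i> (dF_immersion F z))) (q z v)"
proof -
  have "(potential has_derivative (\<lambda>v. 2 * (Im (ddir F z v) - (\<Sum>i\<in>UNIV. Im (z $ i) * Re (ddir (partial F i) z v) + Im (v $ i) * Re (partial F i z))))) (at z)"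
    unfolding potential_def[abs_def]
    by (intro has_derivative_mult_right has_derivative_diff has_derivative_sum has_derivative_mult
        bounded_linear.has_derivative[OF bounded_linear_Im] bounded_linear.has_derivative[OF bounded_linear_Re]
        bounded_linear.has_derivative[OF bounded_linear_vec_nth] has_derivative_ident
        smooth_onD[OF holomorphic_smooth_on[OF open_U hol] z] smooth_onD[OF smooth_partial z])
  from ddir_eqI[OF this] show ?thesis
    by (simp add: ddir_holomorphic[OF hol z] ddir_holomorphic[OF holomorphic_partial[OF open_U hol] z]
        real_form_def re_part_def cscale_def dF_immersion_def q_def dF_derivative[OF z]
        sum_distrib_left algebra_simps sum_subtractf sum.distrib sum_negf)
qed

text \<open>In the formula for the differential, differentiating the factor q v gives the connection
  term. Differentiating the coefficient vector gives q (i u), whose pairing with q v is half the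
  metric.\<close>

lemma hessian_potential:
  assumes z: "z \<in> U"
  shows "ddir (\<lambda>y. ddir potential y v) z u = ddir potential z (Gam z u v) + metric_of F z u v"
proof -
  have bl: "bounded_linear (\<lambda>X :: 'm cotangent. re_part (cscale \<i> X))"
    by (rule bounded_linear_compose[OF bounded_linear_re_part bounded_linear_cscale])
  have "ddir (\<lambda>y. ddir potential y v) z = ddir (\<lambda>y. 2 * real_form (re_part (cscale \<i> (dF_immersion F y))) (q y v)) z"
    by (rule ddir_cong[OF open_U z ddir_potential])
  moreover have "((\<lambda>y. 2 * real_form (re_part (cscale \<i> (dF_immersion F y))) (q y v)) has_derivative
      (\<lambda>u. 2 * (real_form (re_part (cscale \<i> (dF_immersion F z))) (ddir (\<lambda>y. q y v) z u)
        + real_form (re_part (cscale \<i> (ddir (dF_immersion F) z u))) (q z v)))) (at z)"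
    by (intro has_derivative_mult_right bounded_bilinear.FDERIV[OF bounded_bilinear_real_form]
        bounded_linear.has_derivative[OF bl] smooth_onD[OF smooth_dF z] smooth_onD[OF smooth_q z])
  ultimately have "ddir (\<lambda>y. ddir potential y v) z u = 2 * (real_form (re_part (cscale \<i> (dF_immersion F z))) (ddir (\<lambda>y. q y v) z u)
        + real_form (re_part (cscale \<i> (ddir (dF_immersion F) z u))) (q z v))"
    by (simp add: ddir_eqI)
  then show ?thesis
    unfolding ddir_potential[OF z] q_Gam[OF z] metric_eq[OF z]
    by (simp add: q_def dF_derivative_cscale[OF z] algebra_simps)
qed

lemma sphere_exists:
  assumes card: "CARD('n::finite) = 2 * CARD('m)"
  shows "\<exists>(\<phi> :: complex^'m \<Rightarrow> real^'n option) \<xi>. sphere_of_function U F \<phi> \<xi>"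
proof -
  have "CARD('n) = CARD('m + 'm)" using card by simp
  then obtain \<beta> :: "'n \<Rightarrow> 'm + 'm" where \<beta>: "bij \<beta>"
    using finite_same_card_bij[of "UNIV :: 'n set" "UNIV :: ('m + 'm) set"] by auto
  define L :: "'n \<Rightarrow> (real^'m) \<times> (real^'m) \<Rightarrow> real"
    where "L a X = (case \<beta> a of Inl i \<Rightarrow> fst X $ i | Inr i \<Rightarrow> 2 * snd X $ i)" for a X
  have L: "bounded_linear (L a)" for a
    unfolding L_def
    by (cases "\<beta> a")
      (auto intro!: bounded_linear_compose[OF bounded_linear_vec_nth bounded_linear_fst]
        bounded_linear_const_mult bounded_linear_compose[OF bounded_linear_vec_nth bounded_linear_snd])
  define \<phi> :: "complex^'m \<Rightarrow> real^'n option"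
    where "\<phi> z = (\<chi> k. case k of None \<Rightarrow> potential z | Some a \<Rightarrow> L a (re_part (dF_immersion F z)))" for z
  define \<xi> :: "complex^'m \<Rightarrow> real^'n option" where "\<xi> z = axis None 1" for z
  have smL: "smooth_on U (\<lambda>z. L a (re_part (dF_immersion F z)))" for a
    by (rule smooth_on_linear[OF L open_U smooth_coordinates])
  have sm: "smooth_on U \<phi>"
    unfolding \<phi>_def[abs_def]
  proof (rule smooth_on_vec[OF open_U])
    show "smooth_on U (\<lambda>z. case k of None \<Rightarrow> potential z | Some a \<Rightarrow> L a (re_part (dF_immersion F z)))" for k
      using smooth_potential smL by (cases k) simp_all
  qed
  have nth: "ddir \<phi> z u $ k = ddir (\<lambda>z. \<phi> z $ k) z u" if "z \<in> U" for z u k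
    by (rule ddir_bounded_linear[OF bounded_linear_vec_nth sm that, symmetric])
  have d_None: "ddir \<phi> z u $ None = ddir potential z u" if "z \<in> U" for z u
    unfolding nth[OF that] by (simp add: \<phi>_def)
  have d_Some: "ddir \<phi> z u $ Some a = L a (q z u)" if "z \<in> U" for z u a
    unfolding nth[OF that] using ddir_bounded_linear[OF L smooth_coordinates that] by (simp add: \<phi>_def ddir_coordinates[OF that])
  have gauss: "ddir (\<lambda>y. ddir \<phi> y v) z u = ddir \<phi> z (Gam z u v) + metric_of F z u v *\<^sub>R \<xi> z" if z: "z \<in> U" for z u v
  proof (rule vec_eq_iff[THEN iffD2], rule allI)
    fix k
    have nth2: "ddir (\<lambda>y. ddir \<phi> y v) z u $ k = ddir (\<lambda>y. ddir \<phi> y v $ k) z u"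
      by (rule ddir_bounded_linear[OF bounded_linear_vec_nth smooth_on_ddir[OF sm] z, symmetric])
    show "ddir (\<lambda>y. ddir \<phi> y v) z u $ k = (ddir \<phi> z (Gam z u v) + metric_of F z u v *\<^sub>R \<xi> z) $ k"
    proof (cases k)
      case None
      have "ddir (\<lambda>y. ddir \<phi> y v $ None) z = ddir (\<lambda>y. ddir potential y v) z"
        by (rule ddir_cong[OF open_U z d_None])
      then show ?thesis using nth2 by (simp add: None d_None[OF z] hessian_potential[OF z] \<xi>_def)
    next
      case (Some a)
      have "ddir (\<lambda>y. ddir \<phi> y v $ Some a) z = ddir (\<lambda>y. L a (q y v)) z"
        by (rule ddir_cong[OF open_U z d_Some])
      then show ?thesis using nth2 ddir_bounded_linear[OF L smooth_q z]
        by (simp add: Some d_Some[OF z] q_Gam[OF z] \<xi>_def axis_def)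
    qed
  qed
  \<comment> \<open>The data for \<open>gram_det_symplectic\<close>: \<open>s\<close> exchanges the
    coordinates Re z^i and 2 Re w_i, and \<open>e\<close> is the sign with which each enters the
    symplectic form.\<close>
  define s where "s a = inv \<beta> (case \<beta> a of Inl i \<Rightarrow> Inr i | Inr i \<Rightarrow> Inl i)" for a
  define e :: "'n \<Rightarrow> real" where "e a = (case \<beta> a of Inl i \<Rightarrow> 1 | Inr i \<Rightarrow> - 1)" for a
  have \<beta>_inv: "\<beta> (inv \<beta> x) = x" "inv \<beta> (\<beta> a) = a" for x a
    using \<beta> by (simp_all add: bij_is_surj surj_f_inv_f bij_is_inj)
  have s: "s (s a) = a" for a
    by (cases "\<beta> a") (simp_all add: s_def \<beta>_inv, metis \<beta>_inv(2), metis \<beta>_inv(2))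
  have e: "e a * e (s a) = - 1" for a
    by (cases "\<beta> a") (simp_all add: s_def e_def \<beta>_inv)
  have metric_sum: "metric_of F z u v = (\<Sum>a\<in>UNIV. e a * L a (q z (\<i> *s u)) * L (s a) (q z v))" if "z \<in> U" for z u v
  proof -
    have "(\<Sum>a\<in>UNIV. e a * L a (q z (\<i> *s u)) * L (s a) (q z v))
      = (\<Sum>x\<in>UNIV. (\<lambda>x. e (inv \<beta> x) * L (inv \<beta> x) (q z (\<i> *s u)) * L (s (inv \<beta> x)) (q z v)) x)"
      using sum.reindex_bij_betw[OF \<beta>, of "\<lambda>x. e (inv \<beta> x) * L (inv \<beta> x) (q z (\<i> *s u)) * L (s (inv \<beta> x)) (q z v)"]
      by (simp add: \<beta>_inv)
    also have "\<dots> = (\<Sum>i\<in>UNIV. fst (q z (\<i> *s u)) $ i * (2 * snd (q z v) $ i))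
        + (\<Sum>i\<in>UNIV. - (2 * snd (q z (\<i> *s u)) $ i * fst (q z v) $ i))"
      unfolding UNIV_Plus_UNIV[symmetric] by (subst sum.Plus) (simp_all add: e_def L_def s_def \<beta>_inv)
    also have "\<dots> = metric_of F z u v"
      by (simp add: metric_eq[OF that] real_form_def sum_distrib_left algebra_simps sum_subtractf sum_negf)
    finally show ?thesis ..
  qed
  have vol: "\<bar>induced_volume \<phi> \<xi> z X\<bar> = sqrt \<bar>det (\<chi> i j. metric_of F z (X i) (X j))\<bar>" if z: "z \<in> U" for z X
  proof -
    define P where "P u = (\<chi> a. L a (q z u))" for u
    have linL: "linear (L a)" for a using L linear_conv_bounded_linear by blast
    have linP: "linear P"
      by (rule linearI)
        (simp_all add: P_def vec_eq_iff linear_add[OF linear_q[OF z]] linear_cmul[OF linear_q[OF z]]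
          linear_add[OF linL] linear_cmul[OF linL])
    have "u = 0" if "P u = 0" for u
    proof -
      have "L (inv \<beta> x) (q z u) = 0" for x using that by (simp add: P_def vec_eq_iff)
      from this[of "Inl _"] this[of "Inr _"] have "q z u = 0"
        by (simp add: L_def \<beta>_inv prod_eq_iff vec_eq_iff)
      then show ?thesis using inj_q[OF z] by (simp add: linear_injective_0[OF linear_q[OF z]])
    qed
    then have injP: "inj P" by (simp add: linear_injective_0[OF linP])
    have "\<i> *s (\<i> *s u) = - u" for u :: "complex^'m" by (simp add: vec_eq_iff)
    then have "\<bar>det (\<chi> i j. metric_of F z (X i) (X j))\<bar> = (det (\<chi> i. P (X i)))\<^sup>2"
      by (intro gram_det_symplectic[where P = P and I = "\<lambda>u. \<i> *s u" and s = s and e = e,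
            OF linP injP _ linear_mult_i _ s e])
        (simp_all add: card metric_sum[OF z] P_def)
    \<comment> \<open>The transversal row is the unit vector of the index \<open>None\<close>, so
      the potential drops out of the determinant and only the affine coordinates remain.\<close>
    moreover have "induced_volume \<phi> \<xi> z X = det (\<chi> i. P (X i))"
      unfolding induced_volume_def \<xi>_def det_option_block
      by (rule arg_cong[where f = det]) (simp add: vec_eq_iff d_Some[OF z] P_def)
    ultimately show ?thesis by simp
  qed
  have xi0: "ddir \<xi> z u = 0" for z u unfolding \<xi>_def[abs_def] by simp
  have "Blaschke_on U \<phi> \<xi> Gam (metric_of F) (\<lambda>x v. 0)"
    by (rule Blaschke_onI[OF _ open_U sm _ xi0 connection_Gam bilinear_metric metric_nondegenerate gauss vol])
      (simp_all add: card \<xi>_def[abs_def] smooth_on_const)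
  then show ?thesis
    unfolding sphere_of_function_def using is_connection_Gam by blast
qed

end

section \<open>Symplectic linear algebra and the inverse function theorem\<close>

definition symplectic_family :: "('e \<Rightarrow> 'e \<Rightarrow> real) \<Rightarrow> nat \<Rightarrow> (nat \<Rightarrow> 'e) \<Rightarrow> (nat \<Rightarrow> 'e) \<Rightarrow> bool" where
  "symplectic_family B k e f \<longleftrightarrow> (\<forall>i<k. \<forall>j<k. B (e i) (f j) = (if i = j then 1 else 0) \<and>
     B (f j) (e i) = (if i = j then - 1 else 0) \<and> B (e i) (e j) = 0 \<and> B (f i) (f j) = 0)"

text \<open>A hyperbolic pair is added by Gram-Schmidt. A vector outside the span of \<zeta> and the
  2 k vectors so far stays outside the span of \<zeta> after projection, so it is not in the kernel
  of B and has a partner.\<close>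

lemma symplectic_family_exists:
  fixes B :: "'e::euclidean_space \<Rightarrow> 'e \<Rightarrow> real"
  assumes B: "bilinear B" and skew: "\<And>a b. B a b = - B b a"
    and ker: "\<And>a. (\<And>b. B a b = 0) \<Longrightarrow> a \<in> span {\<zeta>}" and dim: "2 * k < DIM('e)"
  shows "\<exists>e f. symplectic_family B k e f"
  using dim
proof (induction k)
  case 0
  then show ?case by (simp add: symplectic_family_def)
next
  case (Suc k)
  have linl: "linear (\<lambda>a. B a b)" and linr: "linear (\<lambda>b. B a b)" for a b
    using B by (auto simp: bilinear_def)
  note simps = linear_add[OF linl] linear_cmul[OF linl] linear_diff[OF linl] linear_sum[OF linl]
    linear_add[OF linr] linear_cmul[OF linr] linear_diff[OF linr] linear_sum[OF linr]
  have "\<exists>e f. symplectic_family B k e f" using Suc by simp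
  then obtain e f where ef: "symplectic_family B k e f" by blast
  \<comment> \<open>The projection onto the B-orthogonal complement of the family; the signs follow
    from B(e i, f i) = 1 and B(f i, e i) = - 1.\<close>
  define pr where "pr v = v - (\<Sum>i<k. B v (f i) *\<^sub>R e i) + (\<Sum>i<k. B v (e i) *\<^sub>R f i)" for v
  have pr_e: "B (pr v) (e j) = 0" and pr_f: "B (pr v) (f j) = 0" if j: "j < k" for v j
  proof -
    have "B (pr v) (e j) = B v (e j) - (\<Sum>i<k. B v (f i) * B (e i) (e j)) + (\<Sum>i<k. B v (e i) * B (f i) (e j))"
      by (simp add: pr_def simps)
    also have "(\<Sum>i<k. B v (f i) * B (e i) (e j)) = 0"
      using ef j by (intro sum.neutral) (simp add: symplectic_family_def)
    also have "(\<Sum>i<k. B v (e i) * B (f i) (e j)) = (\<Sum>i<k. if i = j then - B v (e j) else 0)"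
      using ef j by (intro sum.cong) (auto simp: symplectic_family_def)
    finally show "B (pr v) (e j) = 0" using j by simp
    have "B (pr v) (f j) = B v (f j) - (\<Sum>i<k. B v (f i) * B (e i) (f j)) + (\<Sum>i<k. B v (e i) * B (f i) (f j))"
      by (simp add: pr_def simps)
    also have "(\<Sum>i<k. B v (e i) * B (f i) (f j)) = 0"
      using ef j by (intro sum.neutral) (simp add: symplectic_family_def)
    also have "(\<Sum>i<k. B v (f i) * B (e i) (f j)) = (\<Sum>i<k. if i = j then B v (f j) else 0)"
      using ef j by (intro sum.cong) (auto simp: symplectic_family_def)
    finally show "B (pr v) (f j) = 0" using j by simp
  qed
  define S where "S = {\<zeta>} \<union> (e ` {..<k} \<union> f ` {..<k})"
  have "card S \<le> 1 + (k + k)"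
    unfolding S_def
    by (intro order_trans[OF card_Un_le] add_mono order_trans[OF card_Un_le[of "e ` _"]])
      (simp_all add: order_trans[OF card_image_le])
  moreover have "finite S" by (simp add: S_def)
  ultimately have "dim (span S) \<le> 1 + (k + k)"
    using dim_le_card'[of S] by simp
  then have "dim (span S) < DIM('e)" using Suc.prems by simp
  then have "span S \<noteq> UNIV" by (metis dim_UNIV less_irrefl)
  then obtain v where v: "v \<notin> span S" by blast
  have "pr v \<notin> span {\<zeta>}"
  proof
    assume "pr v \<in> span {\<zeta>}"
    then have "pr v \<in> span S" using span_mono[of "{\<zeta>}" S] by (auto simp: S_def)
    moreover have "(\<Sum>i<k. B v (f i) *\<^sub>R e i) \<in> span S" "(\<Sum>i<k. B v (e i) *\<^sub>R f i) \<in> span S"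
      by (rule span_sum, rule span_scale, rule span_base, simp add: S_def)+
    ultimately have "pr v + (\<Sum>i<k. B v (f i) *\<^sub>R e i) - (\<Sum>i<k. B v (e i) *\<^sub>R f i) \<in> span S"
      by (intro span_diff span_add)
    then show False using v by (simp add: pr_def)
  qed
  then obtain u where u: "B (pr v) u \<noteq> 0" using ker by blast
  have prpr: "B (pr v) (pr u) = B (pr v) u"
  proof -
    have "B (pr v) (pr u) = B (pr v) u - (\<Sum>i<k. B u (f i) * B (pr v) (e i)) + (\<Sum>i<k. B u (e i) * B (pr v) (f i))"
      unfolding pr_def[of u] by (simp add: simps)
    then show ?thesis by (simp add: pr_e pr_f)
  qed
  define v' where "v' = pr v"
  define u' where "u' = (1 / B (pr v) u) *\<^sub>R pr u"
  have new: "B v' u' = 1" using u by (simp add: v'_def u'_def simps prpr)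
  have diag: "B w w = 0" for w using skew[of w w] by simp
  have orth: "B v' (e j) = 0" "B v' (f j) = 0" "B u' (e j) = 0" "B u' (f j) = 0"
    "B (e j) v' = 0" "B (f j) v' = 0" "B (e j) u' = 0" "B (f j) u' = 0" if "j < k" for j
    using pr_e[OF that] pr_f[OF that] skew[of "e j"] skew[of "f j"] by (simp_all add: v'_def u'_def simps)
  have "B u' v' = - 1" using skew[of u' v'] new by simp
  then have "symplectic_family B (Suc k) (e(k := v')) (f(k := u'))"
    using ef new diag orth by (auto simp: symplectic_family_def less_Suc_eq)
  then show ?case by blast
qed

text \<open>Pairing with the family recovers all coefficients except that of \<zeta>, so the family
  together with \<zeta> is independent; there are 2 m + 1 vectors, hence a basis. In this basis the
  coordinates are values of B itself.\<close>

lemma darboux_basis: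
  fixes B :: "'e::euclidean_space \<Rightarrow> 'e \<Rightarrow> real"
  assumes B: "bilinear B" and skew: "\<And>a b. B a b = - B b a" and \<zeta>: "\<zeta> \<noteq> 0" "\<And>b. B \<zeta> b = 0"
    and ker: "\<And>a. (\<And>b. B a b = 0) \<Longrightarrow> a \<in> span {\<zeta>}" and dim: "DIM('e) = 2 * CARD('m::finite) + 1"
  shows "\<exists>e f :: 'm \<Rightarrow> 'e.
    (\<forall>a b. B a b = (\<Sum>i\<in>UNIV. B a (f i) * B (e i) b - B a (e i) * B (f i) b)) \<and>
    (\<forall>a. (\<forall>i. B a (e i) = 0 \<and> B a (f i) = 0) \<longrightarrow> (\<exists>t. a = t *\<^sub>R \<zeta>))"
proof -
  obtain e0 f0 where ef0: "symplectic_family B CARD('m) e0 f0"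
    using symplectic_family_exists[OF B skew ker, of "CARD('m)"] dim by auto
  obtain h :: "'m \<Rightarrow> nat" where h: "bij_betw h UNIV {0..<CARD('m)}"
    using ex_bij_betw_finite_nat[of "UNIV :: 'm set"] by auto
  then have h1: "h i < CARD('m)" "(h i = h j) = (i = j)" for i j
    by (auto simp: bij_betw_def inj_on_def)
  define e where "e i = e0 (h i)" for i
  define f where "f i = f0 (h i)" for i
  have ef: "B (e i) (f j) = (if i = j then 1 else 0)" "B (f i) (e j) = (if i = j then - 1 else 0)"
    "B (e i) (e j) = 0" "B (f i) (f j) = 0" for i j
    using ef0 h1 unfolding symplectic_family_def e_def f_def by metis+
  have linl: "linear (\<lambda>a. B a b)" for b
    using B by (auto simp: bilinear_def)
  note simps = linear_add[OF linl] linear_cmul[OF linl] linear_sum[OF linl]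
  define \<Xi> :: "real \<times> (real^'m) \<times> (real^'m) \<Rightarrow> 'e"
    where "\<Xi> p = fst p *\<^sub>R \<zeta> + (\<Sum>i\<in>UNIV. fst (snd p) $ i *\<^sub>R e i) + (\<Sum>i\<in>UNIV. snd (snd p) $ i *\<^sub>R f i)" for p
  have \<Xi>f: "B (\<Xi> p) (f j) = fst (snd p) $ j" for p j
    by (simp add: \<Xi>_def simps ef \<zeta> if_distrib[of "\<lambda>x. _ * x"] cong: if_cong)
  have \<Xi>e: "B (\<Xi> p) (e j) = - snd (snd p) $ j" for p j
    by (simp add: \<Xi>_def simps ef \<zeta> if_distrib[of "\<lambda>x. _ * x"] cong: if_cong)
  have "linear \<Xi>"
    by (rule linearI) (simp_all add: \<Xi>_def scaleR_add_left sum.distrib scaleR_add_right scaleR_sum_right)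
  moreover have "inj \<Xi>"
  proof (subst linear_injective_0[OF \<open>linear \<Xi>\<close>], intro allI impI)
    fix p assume p: "\<Xi> p = 0"
    have "fst (snd p) = 0" "snd (snd p) = 0"
      using \<Xi>f[of p] \<Xi>e[of p] linear_0[OF linl] by (simp_all add: p vec_eq_iff)
    then show "p = 0" using p \<zeta> by (simp add: \<Xi>_def prod_eq_iff)
  qed
  ultimately have "surj \<Xi>"
    by (rule linear_injective_imp_surj) (simp add: dim)
  have expand: "\<exists>t. a = t *\<^sub>R \<zeta> + (\<Sum>i\<in>UNIV. B a (f i) *\<^sub>R e i) + (\<Sum>i\<in>UNIV. - B a (e i) *\<^sub>R f i)" for a
  proof -
    obtain p where p: "a = \<Xi> p" using surjD[OF \<open>surj \<Xi>\<close>] by blast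
    have "a = fst p *\<^sub>R \<zeta> + (\<Sum>i\<in>UNIV. B a (f i) *\<^sub>R e i) + (\<Sum>i\<in>UNIV. - B a (e i) *\<^sub>R f i)"
      unfolding p \<Xi>f \<Xi>e by (simp add: \<Xi>_def)
    then show ?thesis by blast
  qed
  show ?thesis
  proof (rule exI[of _ e], rule exI[of _ f], intro conjI allI)
    fix a b
    obtain t where t: "a = t *\<^sub>R \<zeta> + (\<Sum>i\<in>UNIV. B a (f i) *\<^sub>R e i) + (\<Sum>i\<in>UNIV. - B a (e i) *\<^sub>R f i)"
      using expand by blast
    have "B a b = B (t *\<^sub>R \<zeta> + (\<Sum>i\<in>UNIV. B a (f i) *\<^sub>R e i) + (\<Sum>i\<in>UNIV. - B a (e i) *\<^sub>R f i)) b"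
      by (rule arg_cong[OF t, of "\<lambda>a. B a b"])
    also have "\<dots> = (\<Sum>i\<in>UNIV. B a (f i) * B (e i) b) + (\<Sum>i\<in>UNIV. - B a (e i) * B (f i) b)"
      by (simp only: simps \<zeta> real_scaleR_def mult_zero_right add_0_left)
    finally show "B a b = (\<Sum>i\<in>UNIV. B a (f i) * B (e i) b - B a (e i) * B (f i) b)"
      by (simp add: sum_subtractf sum_negf)
  next
    show "(\<forall>i. B a (e i) = 0 \<and> B a (f i) = 0) \<longrightarrow> (\<exists>t. a = t *\<^sub>R \<zeta>)" for a
    proof
      assume "\<forall>i. B a (e i) = 0 \<and> B a (f i) = 0"
      then show "\<exists>t. a = t *\<^sub>R \<zeta>" using expand[of a] by simp
    qed
  qed
qed

section \<open>Exchanging conjugate coordinates\<close>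

definition swap_at :: "'m::finite set \<Rightarrow> 'm cotangent \<Rightarrow> 'm cotangent" where
  "swap_at K X = ((\<chi> i. if i \<in> K then fst X $ i else snd X $ i), (\<chi> i. if i \<in> K then snd X $ i else - fst X $ i))"

definition unswap_at :: "'m::finite set \<Rightarrow> 'm cotangent \<Rightarrow> 'm cotangent" where
  "unswap_at K X = ((\<chi> i. if i \<in> K then fst X $ i else - snd X $ i), (\<chi> i. if i \<in> K then snd X $ i else fst X $ i))"

lemma unswap_swap: "unswap_at K (swap_at K X) = X" and swap_unswap: "swap_at K (unswap_at K X) = X"
  by (simp_all add: swap_at_def unswap_at_def prod_eq_iff vec_eq_iff)

lemma bounded_linear_swap_at: "bounded_linear (swap_at K)"
  by (rule linear_conv_bounded_linear[THEN iffD1], rule linearI) (auto simp: swap_at_def prod_eq_iff vec_eq_iff)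

lemma swap_at_cscale: "swap_at K (cscale c X) = cscale c (swap_at K X)"
  by (simp add: swap_at_def cscale_def prod_eq_iff vec_eq_iff)

lemma Omega_swap_at: "Omega (swap_at K X) (swap_at K Y) = Omega X Y"
  unfolding Omega_def by (rule sum.cong) (auto simp: swap_at_def)

lemma hermitian_form_swap_at: "hermitian_form (swap_at K X) (swap_at K Y) = hermitian_form X Y"
proof -
  have "conjugation (swap_at K Y) = swap_at K (conjugation Y)"
    by (simp add: conjugation_def swap_at_def prod_eq_iff vec_eq_iff)
  then show ?thesis by (simp add: hermitian_form_def Omega_swap_at)
qed

lemma real_symplectic_unswap_at: "real_symplectic (unswap_at K)"
  unfolding real_symplectic_def
proof (intro conjI allI)
  show "linear (unswap_at K)"
    by (rule linearI) (auto simp: unswap_at_def prod_eq_iff vec_eq_iff)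
  show "Omega (unswap_at K X) (unswap_at K Y) = Omega X Y" for X Y
    using Omega_swap_at[of K "unswap_at K X" "unswap_at K Y"] by (simp add: swap_unswap)
qed (simp_all add: unswap_at_def conjugation_def prod_eq_iff vec_eq_iff)

text \<open>A Lagrangian subspace is a graph over the base after a suitable exchange: take \<open>K\<close> maximal such
  that the coordinates \<open>z\<^sup>i\<close>, \<open>i \<in> K\<close>, are independent on it.\<close>

lemma Lagrangian_graph:
  fixes \<eta> :: "'e::real_vector \<Rightarrow> 'm::finite cotangent"
  assumes \<eta>: "linear \<eta>" "inj \<eta>" and J: "\<And>u. \<eta> (J u) = cscale \<i> (\<eta> u)"
    and Lag: "\<And>u v. Omega (\<eta> u) (\<eta> v) = 0"
  obtains K where "inj (\<lambda>u. fst (swap_at K (\<eta> u)))"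
proof -
  define P where "P K \<longleftrightarrow> (\<forall>t. \<exists>u. \<forall>i\<in>K. fst (\<eta> u) $ i = t i)" for K
  have "P {}" by (simp add: P_def)
  then obtain K where K: "P K" "\<And>K'. P K' \<Longrightarrow> K \<subseteq> K' \<Longrightarrow> K' = K"
    using finite_has_maximal2[of "Collect P" "{}"] by auto
  \<comment> \<open>Were some other z^j nonzero at u, complex multiples of u, available through J,
    could adjust z^j freely without touching the indices in K, contrary to maximality.\<close>
  have z0: "fst (\<eta> u) = 0" if u: "\<And>i. i \<in> K \<Longrightarrow> fst (\<eta> u) $ i = 0" for u
  proof (rule ccontr)
    assume "fst (\<eta> u) \<noteq> 0"
    then obtain j where j: "fst (\<eta> u) $ j \<noteq> 0" by (auto simp: vec_eq_iff)
    then have jK: "j \<notin> K" using u by auto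
    have "P (insert j K)"
      unfolding P_def
    proof
      fix t
      obtain u0 where u0: "\<And>i. i \<in> K \<Longrightarrow> fst (\<eta> u0) $ i = t i" using K(1) unfolding P_def by blast
      define c where "c = (t j - fst (\<eta> u0) $ j) / fst (\<eta> u) $ j"
      have "\<eta> (Re c *\<^sub>R u + Im c *\<^sub>R J u) = cscale c (\<eta> u)"
        by (simp add: linear_add[OF \<eta>(1)] linear_cmul[OF \<eta>(1)] J cscale_def prod_eq_iff vec_eq_iff)
          (simp add: complex_eq_iff)
      then have "fst (\<eta> (u0 + (Re c *\<^sub>R u + Im c *\<^sub>R J u))) $ i = fst (\<eta> u0) $ i + c * fst (\<eta> u) $ i" for i
        by (simp add: linear_add[OF \<eta>(1)] cscale_def)
      then have "\<forall>i\<in>insert j K. fst (\<eta> (u0 + (Re c *\<^sub>R u + Im c *\<^sub>R J u))) $ i = t i"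
        using u0 u j by (auto simp: c_def)
      then show "\<exists>u. \<forall>i\<in>insert j K. fst (\<eta> u) $ i = t i" by blast
    qed
    then show False using K(2)[of "insert j K"] jK by auto
  qed
  have "u = 0" if u: "fst (swap_at K (\<eta> u)) = 0" for u
  proof -
    have "(if i \<in> K then fst (\<eta> u) $ i else snd (\<eta> u) $ i) = 0" for i
      using u by (simp add: swap_at_def vec_eq_iff)
    then have zK: "i \<in> K \<Longrightarrow> fst (\<eta> u) $ i = 0" and wK: "i \<notin> K \<Longrightarrow> snd (\<eta> u) $ i = 0" for i
      by metis+
    note z = z0[OF zK]
    \<comment> \<open>Prescribing the conjugates of w_i makes \<Omega>(\<eta> u, \<eta> v) minus a
      sum of squares, so the Lagrangian condition kills all w_i.\<close>
    obtain v where v: "\<And>i. i \<in> K \<Longrightarrow> fst (\<eta> v) $ i = cnj (snd (\<eta> u) $ i)"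
      using K(1)[unfolded P_def, rule_format, of "\<lambda>i. cnj (snd (\<eta> u) $ i)"] by blast
    have "snd (\<eta> u) $ i * fst (\<eta> v) $ i = of_real ((cmod (snd (\<eta> u) $ i))\<^sup>2)" for i
      using v wK complex_norm_square by (cases "i \<in> K") auto
    then have "Omega (\<eta> u) (\<eta> v) = - of_real (\<Sum>i\<in>UNIV. (cmod (snd (\<eta> u) $ i))\<^sup>2)"
      by (simp add: Omega_def z sum_negf)
    then have "(\<Sum>i\<in>UNIV. (cmod (snd (\<eta> u) $ i))\<^sup>2) = 0"
      using Lag[of u v] by (simp del: of_real_sum of_real_power)
    then have "snd (\<eta> u) = 0"
      by (simp add: sum_nonneg_eq_0_iff vec_eq_iff)
    then show "u = 0" using z \<eta> by (simp add: linear_injective_0 prod_eq_iff)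
  qed
  moreover have "linear (\<lambda>u. fst (swap_at K (\<eta> u)))"
    using linear_compose[OF \<eta>(1) bounded_linear.linear[OF bounded_linear_compose[OF bounded_linear_fst bounded_linear_swap_at]]]
    by (simp add: o_def)
  ultimately have "inj (\<lambda>u. fst (swap_at K (\<eta> u)))" by (simp add: linear_injective_0)
  then show ?thesis by (rule that)
qed

section \<open>Smooth local inverses\<close>

lemma smooth_inverse:
  fixes h :: "'a::euclidean_space \<Rightarrow> 'b::euclidean_space"
  assumes UV: "open U" "open V" "\<kappa> ` V \<subseteq> U" and h: "smooth_on U h"
    and k: "CARD('k::finite) = DIM('a)" and dim: "DIM('b) = DIM('a)"
    and inj: "\<And>x. x \<in> U \<Longrightarrow> inj (ddir h x)"
    and D: "\<And>y. y \<in> V \<Longrightarrow> (\<kappa> has_derivative inv (ddir h (\<kappa> y))) (at y)"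
  shows "smooth_on V \<kappa>"
proof -
  have lin: "linear (ddir h x)" if "x \<in> U" for x by (rule smooth_on_linear_ddir[OF h that])
  have N: "smooth_on U (\<lambda>x. inv (ddir h x) v)" for v
  proof (rule smooth_on_linear_solve[where 'k = 'k and q = "ddir h" and h = "\<lambda>_. v", OF UV(1) k dim lin inj smooth_on_ddir[OF h] smooth_on_const])
    show "ddir h x (inv (ddir h x) v) = v" if "x \<in> U" for x
      by (rule surj_f_inv_f[OF linear_injective_imp_surj[OF lin[OF that] inj[OF that] dim]])
  qed
  show ?thesis
    unfolding smooth_on_def
  proof
    fix k show "Ck_on k V \<kappa>"
    proof (induction k)
      case 0
      then show ?case
        by (simp, intro continuous_at_imp_continuous_on ballI has_derivative_continuous[OF D])
    next
      \<comment> \<open>Bootstrapping: the derivative of \<kappa> is the smooth map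
        \<open>inv (ddir h x) v\<close> composed with \<kappa>, so each order of differentiability
        yields the next.\<close>
      case (Suc k)
      have "Ck_on k V (\<lambda>y. ddir \<kappa> y v)" for v
      proof (rule Ck_on_congI[OF UV(2)])
        show "Ck_on k V (\<lambda>y. inv (ddir h (\<kappa> y)) v)"
          using N unfolding smooth_on_def
          by (intro Ck_on_compose[where g = "\<lambda>x. inv (ddir h x) v", OF UV(2,1,3) _ Suc]) blast
      qed (simp add: ddir_eqI[OF D])
      then show ?case using D by (auto simp: differentiable_def)
    qed
  qed
qed

text \<open>The linear identification \<beta> turns h into a self-map of one space for the inverse
  function theorem, and \<kappa> undoes it. Besides the inverse, the conclusion records injectivity
  of the derivative on all of U.\<close>

lemma smooth_inverse_function:
  fixes h :: "'a::euclidean_space \<Rightarrow> 'b::euclidean_space"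
  assumes S: "open S" "x0 \<in> S" and h: "smooth_on S h" and inj: "inj (ddir h x0)"
    and k: "CARD('k::finite) = DIM('a)" and dim: "DIM('b) = DIM('a)"
  obtains U V \<kappa> where "open U" "U \<subseteq> S" "x0 \<in> U" "open V" "homeomorphism U V h \<kappa>" "smooth_on V \<kappa>"
    "\<And>x. x \<in> U \<Longrightarrow> inj (ddir h x)"
proof -
  obtain \<beta> :: "'b \<Rightarrow> 'a" and \<beta>' where \<beta>: "linear \<beta>" "linear \<beta>'" "\<And>v. \<beta>' (\<beta> v) = v" "\<And>v. \<beta> (\<beta>' v) = v"
    using ex_linear_isomorphism[OF dim] by blast
  have bl: "bounded_linear \<beta>" "bounded_linear \<beta>'" using \<beta>(1,2) linear_conv_bounded_linear by blast+
  define h1 where "h1 x = \<beta> (h x)" for x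
  define f' where "f' x = Blinfun (\<lambda>u. \<beta> (ddir h x u))" for x
  have f'u: "blinfun_apply (f' x) = (\<lambda>u. \<beta> (ddir h x u))" if "x \<in> S" for x
    unfolding f'_def
    by (rule bounded_linear_Blinfun_apply[OF bounded_linear_compose[OF bl(1) has_derivative_bounded_linear[OF smooth_onD[OF h that]]]])
  have D: "(h1 has_derivative blinfun_apply (f' x)) (at x)" if "x \<in> S" for x
    unfolding h1_def f'u[OF that] by (rule bounded_linear.has_derivative[OF bl(1) smooth_onD[OF h that]])
  have cont: "continuous_on S f'"
  proof (rule continuous_on_blinfun_componentwise)
    fix i
    have "continuous_on S (\<lambda>x. \<beta> (ddir h x i))"
      by (rule smooth_on_continuous[OF smooth_on_linear[OF bl(1) S(1) smooth_on_ddir[OF h]]])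
    then show "continuous_on S (\<lambda>x. blinfun_apply (f' x) i)"
      by (rule continuous_on_eq) (simp add: f'u)
  qed
  have lin0: "linear (ddir h x0)" by (rule smooth_on_linear_ddir[OF h S(2)])
  have lin1: "linear (\<lambda>u. \<beta> (ddir h x0 u))" using linear_compose[OF lin0 \<beta>(1)] by (simp add: o_def)
  have inj1: "inj (\<lambda>u. \<beta> (ddir h x0 u))"
    using inj_compose[OF inj_on_inverseI[of UNIV \<beta>' \<beta>] inj] \<beta>(3) by (simp add: o_def)
  obtain g0 where g0: "linear g0" "g0 \<circ> (\<lambda>u. \<beta> (ddir h x0 u)) = id"
    using linear_injective_left_inverse[OF lin1 inj1] by blast
  have bg0: "bounded_linear g0" using g0(1) linear_conv_bounded_linear by blast
  have invf: "Blinfun g0 o\<^sub>L f' x0 = id_blinfun"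
    using g0(2) by (intro blinfun_eqI) (simp add: bounded_linear_Blinfun_apply[OF bg0] f'u[OF S(2)] fun_eq_iff)
  obtain U V g g' where UV: "open U" "U \<subseteq> S" "x0 \<in> U" "open V" "h1 x0 \<in> V" "homeomorphism U V h1 g"
    and dg: "\<And>y. y \<in> V \<Longrightarrow> (g has_derivative (g' y)) (at y)"
    and g': "\<And>y. y \<in> V \<Longrightarrow> g' y = inv (blinfun_apply (f' (g y)))"
    and bij: "\<And>y. y \<in> V \<Longrightarrow> bij (blinfun_apply (f' (g y)))"
    by (rule inverse_function_theorem[OF S(1) D cont S(2) invf]) (assumption, rule that)
  note hom = homeomorphism_apply1[OF UV(6)] homeomorphism_apply2[OF UV(6)] homeomorphism_image1[OF UV(6)] homeomorphism_image2[OF UV(6)]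
  have injU: "inj (ddir h x)" if x: "x \<in> U" for x
  proof -
    have "h1 x \<in> V" using x hom(3) by blast
    from bij[OF this] have "bij (\<lambda>u. \<beta> (ddir h x u))"
      using x UV(2) by (simp add: hom(1) f'u subset_eq)
    then have "inj (\<beta> \<circ> ddir h x)" by (simp add: bij_is_inj o_def)
    then show ?thesis by (rule inj_on_imageI2)
  qed
  define V' where "V' = \<beta>' ` V"
  have V'eq: "V' = \<beta> -` V"
    unfolding V'_def using \<beta>(3,4) by (auto simp: image_iff) metis
  have oV': "open V'"
    unfolding V'eq using UV(4) linear_continuous_on[OF bl(1), of UNIV] by (simp add: open_vimage continuous_on_eq_continuous_at)
  define \<kappa> where "\<kappa> y = g (\<beta> y)" for y
  have homeo: "homeomorphism U V' h \<kappa>"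
  proof (rule homeomorphismI)
    show "continuous_on U h" using smooth_on_continuous[OF h] UV(2) continuous_on_subset by blast
    have "continuous_on V' \<beta>" by (rule linear_continuous_on[OF bl(1)])
    then show "continuous_on V' \<kappa>"
      unfolding \<kappa>_def by (rule continuous_on_compose2[OF homeomorphism_cont2[OF UV(6)]]) (auto simp: V'eq)
    show "h ` U \<subseteq> V'" using hom(3) by (auto simp: V'eq h1_def)
    show "\<kappa> ` V' \<subseteq> U" using hom(4) by (auto simp: V'eq \<kappa>_def)
    show "\<kappa> (h x) = x" if "x \<in> U" for x using hom(1)[OF that] by (simp add: \<kappa>_def h1_def)
    show "h (\<kappa> y) = y" if "y \<in> V'" for y
    proof -
      have "\<beta> (h (\<kappa> y)) = \<beta> y" using hom(2)[of "\<beta> y"] that by (simp add: \<kappa>_def h1_def V'eq)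
      then show ?thesis by (metis \<beta>(3))
    qed
  qed
  have "smooth_on V' \<kappa>"
  proof (rule smooth_inverse[where 'k = 'k, OF UV(1) oV' _ smooth_on_subset[OF h UV(2)] k dim injU])
    show "\<kappa> ` V' \<subseteq> U" using homeomorphism_image2[OF homeo] by simp
    show "(\<kappa> has_derivative inv (ddir h (\<kappa> y))) (at y)" if y: "y \<in> V'" for y
    proof -
      have yV: "\<beta> y \<in> V" using y by (simp add: V'eq)
      have xU: "\<kappa> y \<in> U" using homeomorphism_image2[OF homeo] y by blast
      have "(\<kappa> has_derivative (\<lambda>v. g' (\<beta> y) (\<beta> v))) (at y)"
        unfolding \<kappa>_def
        by (rule has_derivative_compose[where f = \<beta> and g = g, OF bounded_linear_imp_has_derivative[OF bl(1)] dg[OF yV]])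
      moreover have "g' (\<beta> y) (\<beta> v) = inv (ddir h (\<kappa> y)) v" for v
      proof -
        have lin: "linear (ddir h (\<kappa> y))" using smooth_on_linear_ddir[OF h] xU UV(2) by blast
        have eq: "blinfun_apply (f' (g (\<beta> y))) = (\<lambda>u. \<beta> (ddir h (\<kappa> y) u))"
          using xU UV(2) f'u[of "\<kappa> y"] by (auto simp: \<kappa>_def)
        obtain u where u: "v = ddir h (\<kappa> y) u"
          using surjD[OF linear_injective_imp_surj[OF lin injU[OF xU] dim], of v] by blast
        have "inv (\<lambda>u. \<beta> (ddir h (\<kappa> y) u)) (\<beta> (ddir h (\<kappa> y) u)) = u"
          using bij[OF yV] unfolding eq by (simp add: bij_is_inj inv_f_f[of "\<lambda>u. \<beta> (ddir h (\<kappa> y) u)"])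
        then show ?thesis
          by (simp add: g'[OF yV] eq u inv_f_f[OF injU[OF xU]])
      qed
      ultimately show ?thesis by simp
    qed
  qed
  then show ?thesis using that[OF UV(1-3) oV' homeo _ injU] by blast
qed

section \<open>Special parabolic spheres on manifolds\<close>

lemma chart_subset: "is_chart M c \<Longrightarrow> fst c \<subseteq> M"
  unfolding is_chart_def by (meson openin_imp_subset topspace_euclidean_subtopology order_trans order_refl)

lemma chart_image_mem: "p \<in> fst c \<Longrightarrow> snd c p \<in> chart_image c"
  by (simp add: chart_image_def)

lemma chart_inverse:
  assumes "is_chart M c"
  shows "p \<in> fst c \<Longrightarrow> inv_into (fst c) (snd c) (snd c p) = p"
    and "x \<in> chart_image c \<Longrightarrow> inv_into (fst c) (snd c) x \<in> fst c"
    and "x \<in> chart_image c \<Longrightarrow> snd c (inv_into (fst c) (snd c) x) = x"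
proof -
  have h: "homeomorphism (fst c) (chart_image c) (snd c) (inv_into (fst c) (snd c))"
    using assms unfolding is_chart_def by blast
  show "p \<in> fst c \<Longrightarrow> inv_into (fst c) (snd c) (snd c p) = p"
    by (rule homeomorphism_apply1[OF h])
  show "x \<in> chart_image c \<Longrightarrow> inv_into (fst c) (snd c) x \<in> fst c"
    using homeomorphism_image2[OF h] by blast
  show "x \<in> chart_image c \<Longrightarrow> snd c (inv_into (fst c) (snd c) x) = x"
    by (rule homeomorphism_apply2[OF h])
qed

lemma in_chart_apply: "is_chart M c \<Longrightarrow> p \<in> fst c \<Longrightarrow> in_chart c h (snd c p) = h p"
  by (simp add: in_chart_def chart_inverse(1))

lemma open_chart_image: "is_chart M c \<Longrightarrow> open (chart_image c)"
  unfolding is_chart_def by blast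

lemma chart_image_open:
  assumes c: "is_chart M c" and V: "openin (top_of_set M) V"
  shows "open (snd c ` (fst c \<inter> V))"
proof -
  have h: "homeomorphism (fst c) (chart_image c) (snd c) (inv_into (fst c) (snd c))"
    using c unfolding is_chart_def by blast
  obtain T where T: "open T" "V = M \<inter> T" using V by (auto simp: openin_open)
  have "fst c \<inter> V = fst c \<inter> T" using T chart_subset[OF c] by auto
  then have "openin (top_of_set (fst c)) (fst c \<inter> V)"
    using T by (auto simp: openin_open)
  then have "openin (top_of_set (chart_image c)) (snd c ` (fst c \<inter> V))"
    by (rule homeomorphism_imp_open_map[OF h])
  then show ?thesis using open_chart_image[OF c] by (simp add: openin_open_eq)
qed

lemma chart_preimage_open:
  assumes c: "is_chart M c" and T: "open T"
  shows "openin (top_of_set M) {p \<in> fst c. snd c p \<in> T}"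
proof -
  have h: "homeomorphism (fst c) (chart_image c) (snd c) (inv_into (fst c) (snd c))"
    and o: "openin (top_of_set M) (fst c)"
    using c unfolding is_chart_def by blast+
  have "openin (top_of_set (fst c)) (fst c \<inter> snd c -` T)"
    by (rule continuous_openin_preimage_gen[OF homeomorphism_cont1[OF h] T])
  then have "openin (top_of_set M) (fst c \<inter> snd c -` T)"
    using o openin_trans by blast
  moreover have "fst c \<inter> snd c -` T = {p \<in> fst c. snd c p \<in> T}" by auto
  ultimately show ?thesis by simp
qed

lemma smooth_manifoldD:
  assumes "smooth_manifold M A"
  shows "c \<in> A \<Longrightarrow> is_chart M c" and "c \<in> A \<Longrightarrow> d \<in> A \<Longrightarrow> smooth_transition c d"
    and "p \<in> M \<Longrightarrow> \<exists>c\<in>A. p \<in> fst c"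
  using assms unfolding smooth_manifold_def by blast+

text \<open>A vanishing derivative is used on balls inside chart images, giving local constancy on
  M; connectedness of M does the rest.\<close>

lemma manifold_constant:
  fixes h :: "'a::{t2_space,second_countable_topology} \<Rightarrow> 'b::real_normed_vector"
  assumes M: "smooth_manifold M (A :: ('a, 'e::euclidean_space) chart set)" "connected M"
    and D: "\<And>c x. c \<in> A \<Longrightarrow> x \<in> chart_image c \<Longrightarrow> (in_chart c h has_derivative (\<lambda>u. 0)) (at x)"
    and pq: "p \<in> M" "q \<in> M"
  shows "h p = h q"
proof (rule connected_local_const[OF M(2) pq])
  show "\<forall>a\<in>M. \<forall>\<^sub>F b in at a within M. h a = h b"
  proof
    fix a assume "a \<in> M"
    then obtain c where c: "c \<in> A" "a \<in> fst c" using smooth_manifoldD(3)[OF M(1)] by blast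
    note ch = smooth_manifoldD(1)[OF M(1) c(1)]
    obtain r where r: "r > 0" "ball (snd c a) r \<subseteq> chart_image c"
      using openE[OF open_chart_image[OF ch] chart_image_mem[OF c(2)]] by blast
    have "h a = h b" if b: "b \<in> fst c" "snd c b \<in> ball (snd c a) r" for b
    proof -
      have "in_chart c h (snd c a) = in_chart c h (snd c b)"
      proof (rule has_derivative_zero_unique_connected[where f = "in_chart c h" and s = "ball (snd c a) r"])
        show "connected (ball (snd c a) r)" by simp
        show "(in_chart c h has_derivative (\<lambda>x. 0)) (at x)" if "x \<in> ball (snd c a) r" for x
          by (rule D[OF c(1)]) (use that r in blast)
      qed (use b r in simp_all)
      then show ?thesis by (simp add: in_chart_apply[OF ch] c b)
    qed
    moreover obtain T where T: "open T" "{p \<in> fst c. snd c p \<in> ball (snd c a) r} = M \<inter> T"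
      using chart_preimage_open[OF ch open_ball[of "snd c a" r]] by (auto simp: openin_open)
    moreover have "a \<in> {p \<in> fst c. snd c p \<in> ball (snd c a) r}" using c r by simp
    ultimately show "\<forall>\<^sub>F b in at a within M. h a = h b"
      unfolding eventually_at_topological by (intro exI[of _ T]) blast
  qed
qed

section \<open>Conormal map and Kaehler form on the whole sphere\<close>

locale special_sphere =
  fixes M :: "'a::{t2_space,second_countable_topology} set" and A :: "('a, 'e::euclidean_space) chart set"
    and \<phi> \<xi> :: "'a \<Rightarrow> real^('n::finite) option" and \<Gamma> g J
  assumes parabolic: "parabolic_sphere M A \<phi> \<xi> \<Gamma> g" and ac: "almost_complex_structure A J"
    and hermitian: "\<And>c x u v. c \<in> A \<Longrightarrow> x \<in> chart_image c \<Longrightarrow> g c x (J c x u) (J c x v) = g c x u v"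
    and parallel: "\<And>c. c \<in> A \<Longrightarrow> parallel_2form (chart_image c) (\<Gamma> c) (\<lambda>x u v. g c x (J c x u) v)"
    and conn: "connected M"
begin

lemma manifold: "smooth_manifold M A"
  and Blaschke: "c \<in> A \<Longrightarrow> Blaschke_on (chart_image c) (in_chart c \<phi>) (in_chart c \<xi>) (\<Gamma> c) (g c) (\<lambda>x v. 0 *\<^sub>R v)"
  using parabolic unfolding parabolic_sphere_def affine_hypersphere_def Blaschke_immersion_def by blast+

lemmas chart = smooth_manifoldD(1)[OF manifold]

lemma blaschke_chart_in:
  assumes "c \<in> A"
  shows "blaschke_chart (chart_image c) (in_chart c \<phi>) (in_chart c \<xi>) (\<Gamma> c) (g c) (\<lambda>x v. 0 *\<^sub>R v)"
  using open_chart_image[OF chart[OF assms]] Blaschke[OF assms] by unfold_locales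

lemmas bc = blaschke_chart.smooth_f[OF blaschke_chart_in] blaschke_chart.smooth_xi[OF blaschke_chart_in]

lemma J_linear: "c \<in> A \<Longrightarrow> x \<in> chart_image c \<Longrightarrow> linear (J c x)"
  and J_square: "c \<in> A \<Longrightarrow> x \<in> chart_image c \<Longrightarrow> J c x (J c x v) = - v"
  and J_smooth: "c \<in> A \<Longrightarrow> smooth_on (chart_image c) (\<lambda>x. J c x v)"
  and J_change: "c \<in> A \<Longrightarrow> d \<in> A \<Longrightarrow> p \<in> fst c \<Longrightarrow> p \<in> fst d \<Longrightarrow>
    ddir (in_chart c (snd d)) (snd c p) (J c (snd c p) v) = J d (snd d p) (ddir (in_chart c (snd d)) (snd c p) v)"
  using ac unfolding almost_complex_structure_def by blast+

lemma xi_derivative: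
  assumes c: "c \<in> A" and x: "x \<in> chart_image c"
  shows "ddir (in_chart c \<xi>) x u = 0"
proof -
  interpret blaschke_chart "chart_image c" "in_chart c \<phi>" "in_chart c \<xi>" "\<Gamma> c" "g c" "\<lambda>x v. 0 *\<^sub>R v"
    by (rule blaschke_chart_in[OF c])
  show ?thesis using weingarten[OF x] linear_0[OF linear_df[OF x]] by simp
qed

lemma xi_constant: "p \<in> M \<Longrightarrow> q \<in> M \<Longrightarrow> \<xi> p = \<xi> q"
proof (rule manifold_constant[OF manifold conn])
  show "(in_chart c \<xi> has_derivative (\<lambda>u. 0)) (at x)" if "c \<in> A" "x \<in> chart_image c" for c x
  proof -
    have "ddir (in_chart c \<xi>) x = (\<lambda>u. 0)" using xi_derivative[OF that] by (intro ext)
    then show ?thesis using smooth_onD[OF bc(2)[OF that(1)] that(2)] by simp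
  qed
qed

lemma chart_change:
  fixes h :: "'a \<Rightarrow> 'z::real_normed_vector"
  assumes c: "c \<in> A" "p \<in> fst c" and d: "d \<in> A" "p \<in> fst d" and h: "smooth_on (chart_image d) (in_chart d h)"
  shows "ddir (in_chart c h) (snd c p) u = ddir (in_chart d h) (snd d p) (ddir (in_chart c (snd d)) (snd c p) u)"
proof -
  let ?O = "snd c ` (fst c \<inter> fst d)"
  have o: "open ?O"
    using chart_image_open[OF chart[OF c(1)], of "fst d"] chart[OF d(1)] unfolding is_chart_def by blast
  have p: "snd c p \<in> ?O" using c d by blast
  have sm: "smooth_on ?O (in_chart c (snd d))"
    using smooth_manifoldD(2)[OF manifold c(1) d(1)] unfolding smooth_transition_def .
  have eq: "in_chart c h y = in_chart d h (in_chart c (snd d) y)" if y: "y \<in> ?O" for y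
  proof -
    obtain q where "q \<in> fst c" "q \<in> fst d" "y = snd c q" using y by blast
    then show ?thesis by (simp add: in_chart_apply[OF chart[OF c(1)]] in_chart_apply[OF chart[OF d(1)]])
  qed
  have pd: "in_chart c (snd d) (snd c p) = snd d p" by (rule in_chart_apply[OF chart[OF c(1)] c(2)])
  have 1: "ddir (in_chart c h) (snd c p) = ddir (\<lambda>y. in_chart d h (in_chart c (snd d) y)) (snd c p)"
    by (rule ddir_cong[OF o p eq])
  have 2: "ddir (\<lambda>y. in_chart d h (in_chart c (snd d) y)) (snd c p) u
      = ddir (in_chart d h) (in_chart c (snd d) (snd c p)) (ddir (in_chart c (snd d)) (snd c p) u)"
    by (rule ddir_compose[OF h sm p]) (simp add: pd chart_image_mem d)
  show ?thesis unfolding 1 2 pd ..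
qed

abbreviation "tv c \<equiv> transversal_part (in_chart c \<phi>) (in_chart c \<xi>)"
abbreviation "tg c \<equiv> tangential_part (in_chart c \<phi>) (in_chart c \<xi>)"

text \<open>The chain rule rewrites the decomposition of a from one chart into the other, and the
  frame coefficients are unique: the transversal part is a function on M and the tangential part
  transforms as a vector.\<close>

lemma parts_change:
  assumes c: "c \<in> A" "p \<in> fst c" and d: "d \<in> A" "p \<in> fst d"
  shows "tv d (snd d p) a = tv c (snd c p) a"
    and "tg d (snd d p) a = ddir (in_chart c (snd d)) (snd c p) (tg c (snd c p) a)"
proof -
  have "tv c (snd c p) a *\<^sub>R in_chart c \<xi> (snd c p) + ddir (in_chart c \<phi>) (snd c p) (tg c (snd c p) a) = a"
    by (rule blaschke_chart.parts[OF blaschke_chart_in[OF c(1)] chart_image_mem[OF c(2)]])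
  then have "tv c (snd c p) a *\<^sub>R in_chart d \<xi> (snd d p)
      + ddir (in_chart d \<phi>) (snd d p) (ddir (in_chart c (snd d)) (snd c p) (tg c (snd c p) a)) = a"
    by (simp add: chart_change[OF c d bc(1)[OF d(1)]] in_chart_apply[OF chart[OF c(1)] c(2)] in_chart_apply[OF chart[OF d(1)] d(2)])
  note this = blaschke_chart.parts_unique[OF blaschke_chart_in[OF d(1)] chart_image_mem[OF d(2)] this]
  then show "tv d (snd d p) a = tv c (snd c p) a"
    and "tg d (snd d p) a = ddir (in_chart c (snd d)) (snd c p) (tg c (snd c p) a)" .
qed

text \<open>An arbitrary chart, needed only to write down functions on M;
  \<open>conormal_chart\<close> and \<open>kahler_chart\<close> show that the choice has no
  effect.\<close>

definition chart_at :: "'a \<Rightarrow> ('a, 'e) chart" where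
  "chart_at p = (SOME c. c \<in> A \<and> p \<in> fst c)"

lemma chart_at:
  assumes "p \<in> M"
  shows "chart_at p \<in> A \<and> p \<in> fst (chart_at p)"
proof -
  have "\<exists>c. c \<in> A \<and> p \<in> fst c"
    using smooth_manifoldD(3)[OF manifold assms] by blast
  then show ?thesis unfolding chart_at_def by (rule someI_ex)
qed

lemma in_M: "c \<in> A \<Longrightarrow> p \<in> fst c \<Longrightarrow> p \<in> M"
  using chart_subset[OF chart] by blast

definition conormal :: "'a \<Rightarrow> real^'n option \<Rightarrow> real" where
  "conormal p a = tv (chart_at p) (snd (chart_at p) p) a"

lemma conormal_chart: "c \<in> A \<Longrightarrow> p \<in> fst c \<Longrightarrow> conormal p a = tv c (snd c p) a"
  unfolding conormal_def
  by (rule parts_change(1)[OF _ _ conjunct1[OF chart_at[OF in_M]] conjunct2[OF chart_at[OF in_M]]])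

lemma conormal_in_chart:
  assumes "c \<in> A" "x \<in> chart_image c"
  shows "in_chart c (\<lambda>p. conormal p a) x = tv c x a"
  using conormal_chart[OF assms(1) chart_inverse(2)[OF chart[OF assms(1)] assms(2)]]
    chart_inverse(3)[OF chart[OF assms(1)] assms(2)]
  by (simp add: in_chart_def)

lemma smooth_tg: "c \<in> A \<Longrightarrow> smooth_on (chart_image c) (\<lambda>x. tg c x a)"
  and smooth_conormal: "c \<in> A \<Longrightarrow> smooth_on (chart_image c) (in_chart c (\<lambda>p. conormal p a))"
proof -
  assume c: "c \<in> A"
  note * = blaschke_chart.frame_smooth[OF blaschke_chart_in[OF c] smooth_on_const,
      OF blaschke_chart.parts[OF blaschke_chart_in[OF c]]]
  show "smooth_on (chart_image c) (\<lambda>x. tg c x a)" by (rule *(2))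
  show "smooth_on (chart_image c) (in_chart c (\<lambda>p. conormal p a))"
    by (rule smooth_on_congI[OF open_chart_image[OF chart[OF c]] *(1)]) (simp_all add: conormal_in_chart[OF c])
qed

lemma conormal_derivative:
  assumes c: "c \<in> A" and x: "x \<in> chart_image c"
  shows "ddir (in_chart c (\<lambda>p. conormal p a)) x u = - g c x u (tg c x a)"
proof -
  have "ddir (in_chart c (\<lambda>p. conormal p a)) x = ddir (\<lambda>x. tv c x a) x"
    by (rule ddir_cong[OF open_chart_image[OF chart[OF c]] x conormal_in_chart[OF c]])
  then show ?thesis
    using blaschke_chart.parallel_frame(1)[OF blaschke_chart_in[OF c] xi_derivative[OF c]
        blaschke_chart.parts[OF blaschke_chart_in[OF c]] x] by simp
qed

lemma tg_derivative:
  assumes c: "c \<in> A" and x: "x \<in> chart_image c"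
  shows "ddir (\<lambda>x. tg c x a) x u = - \<Gamma> c x u (tg c x a)"
  by (rule blaschke_chart.parallel_frame(2)[OF blaschke_chart_in[OF c] xi_derivative[OF c]
        blaschke_chart.parts[OF blaschke_chart_in[OF c]] x])

text \<open>\<open>kahler p\<close> is the form \<open>\<omega>\<close> at \<open>p\<close>, extended to \<open>\<real>\<^sup>n\<^sup>+\<^sup>1\<close> with kernel \<open>\<real>\<xi>\<close>.\<close>

definition kahler :: "'a \<Rightarrow> real^'n option \<Rightarrow> real^'n option \<Rightarrow> real" where
  "kahler p a b = (let c = chart_at p; x = snd c p in g c x (J c x (tg c x a)) (tg c x b))"

text \<open>The form g(J Y_a, Y_b) is minus the derivative of the conormal component of b along J
  Y_a. That component is a function on M and J Y_a transforms as a vector, so chart independence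
  follows from the chain rule without a transformation rule for g.\<close>

lemma kahler_chart:
  assumes c: "c \<in> A" "p \<in> fst c"
  shows "kahler p a b = g c (snd c p) (J c (snd c p) (tg c (snd c p) a)) (tg c (snd c p) b)"
proof -
  define d where "d = chart_at p"
  have d: "d \<in> A" "p \<in> fst d" using chart_at[OF in_M[OF c]] by (auto simp: d_def)
  have *: "g e (snd e p) (J e (snd e p) (tg e (snd e p) a)) (tg e (snd e p) b)
      = - ddir (in_chart e (\<lambda>p. conormal p b)) (snd e p) (J e (snd e p) (tg e (snd e p) a))"
    if "e \<in> A" "p \<in> fst e" for e
    by (simp add: conormal_derivative[OF that(1) chart_image_mem[OF that(2)]])
  have "kahler p a b = - ddir (in_chart d (\<lambda>p. conormal p b)) (snd d p) (J d (snd d p) (tg d (snd d p) a))"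
    unfolding kahler_def Let_def d_def[symmetric] by (rule *[OF d])
  also have "\<dots> = - ddir (in_chart c (\<lambda>p. conormal p b)) (snd c p) (J c (snd c p) (tg c (snd c p) a))"
    unfolding chart_change[OF c d smooth_conormal[OF d(1)]] J_change[OF c(1) d(1) c(2) d(2)] parts_change(2)[OF c d] ..
  also have "\<dots> = g c (snd c p) (J c (snd c p) (tg c (snd c p) a)) (tg c (snd c p) b)"
    by (rule *[OF c, symmetric])
  finally show ?thesis .
qed

text \<open>The tangential parts of constant vectors are parallel fields and \<omega> is a parallel
  form, so its value on them has derivative zero.\<close>

lemma kahler_constant:
  assumes "p \<in> M" "q \<in> M"
  shows "kahler p a b = kahler q a b"
proof (rule manifold_constant[OF manifold conn _ assms])
  fix c x assume c: "c \<in> A" and x: "x \<in> chart_image c"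
  let ?S = "chart_image c"
  interpret blaschke_chart ?S "in_chart c \<phi>" "in_chart c \<xi>" "\<Gamma> c" "g c" "\<lambda>x v. 0 *\<^sub>R v"
    by (rule blaschke_chart_in[OF c])
  define h where "h y = g c y (J c y (tg c y a)) (tg c y b)" for y
  have eq: "in_chart c (\<lambda>p. kahler p a b) y = h y" if "y \<in> ?S" for y
    using kahler_chart[OF c chart_inverse(2)[OF chart[OF c] that]] chart_inverse(3)[OF chart[OF c] that]
    by (simp add: in_chart_def h_def)
  have JY: "smooth_on ?S (\<lambda>y. J c y (tg c y a))"
    by (rule smooth_on_linear_family[where q = "J c", OF open_S J_linear[OF c] J_smooth[OF c] smooth_tg[OF c]])
  have 1: "smooth_on ?S (\<lambda>y. g c y (J c y (tg c y a)) v)" for v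
    by (rule smooth_on_linear_family[where q = "\<lambda>y u. g c y u v", OF open_S _ smooth_g JY])
      (use bilinear_g in \<open>auto simp: bilinear_def\<close>)
  have h: "smooth_on ?S h"
    unfolding h_def[abs_def]
    by (rule smooth_on_linear_family[where q = "\<lambda>y v. g c y (J c y (tg c y a)) v", OF open_S _ 1 smooth_tg[OF c]])
      (use bilinear_g in \<open>auto simp: bilinear_def\<close>)
  have "ddir h x = (\<lambda>u. 0)"
  proof
    fix u
    have "\<forall>X Y Z. smooth_on ?S X \<longrightarrow> smooth_on ?S Y \<longrightarrow> smooth_on ?S Z \<longrightarrow>
        (\<forall>x\<in>?S. ddir (\<lambda>y. g c y (J c y (Y y)) (Z y)) x (X x)
          = g c x (J c x (cov (\<Gamma> c) X Y x)) (Z x) + g c x (J c x (Y x)) (cov (\<Gamma> c) X Z x))"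
      using parallel[OF c] unfolding parallel_2form_def .
    from this[rule_format, of "\<lambda>_. u" "\<lambda>y. tg c y a" "\<lambda>y. tg c y b", OF smooth_on_const smooth_tg[OF c] smooth_tg[OF c] x]
    show "ddir h x u = 0"
      using linear_0[OF J_linear[OF c x]] bilinear_lzero[OF bilinear_g[OF x]] bilinear_rzero[OF bilinear_g[OF x]]
      by (simp add: h_def[abs_def] cov_def tg_derivative[OF c x])
  qed
  then have "(h has_derivative (\<lambda>u. 0)) (at x)"
    using smooth_onD[OF h x] by simp
  then show "(in_chart c (\<lambda>p. kahler p a b) has_derivative (\<lambda>u. 0)) (at x)"
    by (rule has_derivative_transform_within_open[OF _ open_S x]) (simp add: eq)
qed

end

lemma Re_Omega:
  "Re (Omega X Y) = real_form (re_part X) (re_part Y) - real_form (re_part (cscale \<i> X)) (re_part (cscale \<i> Y))"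
  by (simp add: Omega_def real_form_def re_part_def cscale_def flip: sum_subtractf) (simp add: algebra_simps)

text \<open>Real and imaginary parts of v give its expansion in the vectors \<open>axis j 1\<close>
  and i times these; compatibility with i recombines the two. It converts real derivatives into the
  form required by \<open>holomorphic_fun_on\<close>.\<close>

lemma complex_linear_expand:
  fixes l :: "complex^'m::finite \<Rightarrow> complex"
  assumes l: "linear l" and i: "\<And>v. l (\<i> *s v) = \<i> * l v"
  shows "l v = (\<Sum>j\<in>UNIV. l (axis j 1) * v $ j)"
proof -
  have "v = (\<Sum>j\<in>UNIV. Re (v $ j) *\<^sub>R axis j 1 + Im (v $ j) *\<^sub>R (\<i> *s axis j 1))"
  proof (rule vec_eq_iff[THEN iffD2], rule allI)
    fix k
    have "(\<Sum>j\<in>UNIV. Re (v $ j) *\<^sub>R axis j 1 + Im (v $ j) *\<^sub>R (\<i> *s axis j 1)) $ k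
      = (\<Sum>j\<in>UNIV. if j = k then v $ k else 0)"
      unfolding sum_component by (rule sum.cong) (auto simp: axis_def complex_eq_iff)
    then show "v $ k = (\<Sum>j\<in>UNIV. Re (v $ j) *\<^sub>R axis j 1 + Im (v $ j) *\<^sub>R (\<i> *s axis j 1)) $ k" by simp
  qed
  then have "l v = l (\<Sum>j\<in>UNIV. Re (v $ j) *\<^sub>R axis j 1 + Im (v $ j) *\<^sub>R (\<i> *s axis j 1))"
    by (rule arg_cong)
  also have "\<dots> = (\<Sum>j\<in>UNIV. Re (v $ j) *\<^sub>R l (axis j 1) + Im (v $ j) *\<^sub>R (\<i> * l (axis j 1)))"
    by (simp only: linear_sum[OF l] linear_add[OF l] linear_cmul[OF l] i)
  also have "\<dots> = (\<Sum>j\<in>UNIV. l (axis j 1) * v $ j)"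
    by (rule sum.cong) (auto simp: complex_eq_iff algebra_simps)
  finally show ?thesis .
qed

definition swap_real :: "'m::finite set \<Rightarrow> (real^'m) \<times> (real^'m) \<Rightarrow> (real^'m) \<times> (real^'m)" where
  "swap_real K X = ((\<chi> i. if i \<in> K then fst X $ i else snd X $ i), (\<chi> i. if i \<in> K then snd X $ i else - fst X $ i))"

lemma re_part_swap_at: "re_part (swap_at K X) = swap_real K (re_part X)"
  by (simp add: re_part_def swap_at_def swap_real_def prod_eq_iff vec_eq_iff)

lemma bounded_linear_swap_real: "bounded_linear (swap_real K)"
  by (rule linear_conv_bounded_linear[THEN iffD1], rule linearI) (auto simp: swap_real_def prod_eq_iff vec_eq_iff)

lemma swap_real_eq_0: "swap_real K X = 0 \<Longrightarrow> X = 0"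
proof -
  assume "swap_real K X = 0"
  then have "(if i \<in> K then fst X $ i else snd X $ i) = 0" "(if i \<in> K then snd X $ i else - fst X $ i) = 0" for i
    by (auto simp: swap_real_def prod_eq_iff vec_eq_iff)
  then have "fst X $ i = 0 \<and> snd X $ i = 0" for i
    by (cases "i \<in> K") (metis neg_equal_0_iff_equal)+
  then show "X = 0" by (simp add: prod_eq_iff vec_eq_iff)
qed

context special_sphere
begin

lemma g_bilinear: "c \<in> A \<Longrightarrow> x \<in> chart_image c \<Longrightarrow> bilinear (g c x)"
  by (rule blaschke_chart.bilinear_g[OF blaschke_chart_in])

lemma g_linear: "c \<in> A \<Longrightarrow> x \<in> chart_image c \<Longrightarrow> linear (\<lambda>u. g c x u v)" "c \<in> A \<Longrightarrow> x \<in> chart_image c \<Longrightarrow> linear (g c x u)"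
  using g_bilinear[of c x] by (auto simp: bilinear_def)

lemma g_J: "c \<in> A \<Longrightarrow> x \<in> chart_image c \<Longrightarrow> g c x (J c x u) v = - g c x (J c x v) u"
  using hermitian[of c x "J c x u" v] linear_neg[OF g_linear(1)[of c x], of u "J c x v"]
    blaschke_chart.g_symmetric[OF blaschke_chart_in, of c x u "J c x v"]
  by (simp add: J_square)

lemma dphi_linear: "c \<in> A \<Longrightarrow> x \<in> chart_image c \<Longrightarrow> linear (ddir (in_chart c \<phi>) x)"
  by (rule blaschke_chart.linear_df[OF blaschke_chart_in])

lemma parts_tangent:
  assumes "c \<in> A" "x \<in> chart_image c"
  shows "tg c x (ddir (in_chart c \<phi>) x v) = v" and "tv c x (ddir (in_chart c \<phi>) x v) = 0"
  using blaschke_chart.parts_unique[OF blaschke_chart_in assms(2), of 0 v, OF assms(1)] by auto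

lemma parts_xi:
  assumes "c \<in> A" "x \<in> chart_image c"
  shows "tg c x (t *\<^sub>R in_chart c \<xi> x) = 0" and "tv c x (t *\<^sub>R in_chart c \<xi> x) = t"
  using blaschke_chart.parts_unique[OF blaschke_chart_in assms(2), of t 0, OF assms(1)]
    linear_0[OF dphi_linear[OF assms]] by auto

lemma parts_linear:
  assumes c: "c \<in> A" and x: "x \<in> chart_image c"
  shows "linear (tg c x)" and "linear (tv c x)"
proof -
  note p = blaschke_chart.parts[OF blaschke_chart_in[OF c] x]
  note u = blaschke_chart.parts_unique[OF blaschke_chart_in[OF c] x]
  have 1: "(tv c x a + tv c x b) *\<^sub>R in_chart c \<xi> x + ddir (in_chart c \<phi>) x (tg c x a + tg c x b) = a + b" for a b
    using p[of a] p[of b] by (simp add: linear_add[OF dphi_linear[OF c x]] algebra_simps)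
  have 2: "(t * tv c x a) *\<^sub>R in_chart c \<xi> x + ddir (in_chart c \<phi>) x (t *\<^sub>R tg c x a) = t *\<^sub>R a" for t a
    using arg_cong[OF p[of a], of "(*\<^sub>R) t"] by (simp add: linear_cmul[OF dphi_linear[OF c x]] scaleR_add_right)
  show "linear (tg c x)" "linear (tv c x)"
    by (auto intro!: linearI simp: u[OF 1] u[OF 2])
qed

lemma kahler_tangent:
  assumes p0: "p0 \<in> M" and c: "c \<in> A" and x: "x \<in> chart_image c"
  shows "kahler p0 (ddir (in_chart c \<phi>) x u) b = g c x (J c x u) (tg c x b)"
proof -
  let ?p = "inv_into (fst c) (snd c) x"
  have p: "?p \<in> fst c" "snd c ?p = x" using chart_inverse(2,3)[OF chart[OF c] x] by auto
  have "kahler p0 a b = kahler ?p a b" for a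
    by (rule kahler_constant[OF p0 in_M[OF c p(1)]])
  then show ?thesis using kahler_chart[OF c p(1)] by (simp add: p(2) parts_tangent[OF c x])
qed

lemma kahler_properties:
  assumes p: "p \<in> M"
  shows "bilinear (kahler p)" and "kahler p a b = - kahler p b a" and "kahler p (\<xi> p) b = 0"
    and "(\<And>b. kahler p a b = 0) \<Longrightarrow> a \<in> span {\<xi> p}" and "\<xi> p \<noteq> 0"
proof -
  define c where "c = chart_at p"
  have c: "c \<in> A" "p \<in> fst c" using chart_at[OF p] by (auto simp: c_def)
  define x where "x = snd c p"
  have x: "x \<in> chart_image c" unfolding x_def by (rule chart_image_mem[OF c(2)])
  have xi: "in_chart c \<xi> x = \<xi> p" unfolding x_def by (rule in_chart_apply[OF chart[OF c(1)] c(2)])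
  interpret blaschke_chart "chart_image c" "in_chart c \<phi>" "in_chart c \<xi>" "\<Gamma> c" "g c" "\<lambda>x v. 0 *\<^sub>R v"
    by (rule blaschke_chart_in[OF c(1)])
  have k: "kahler p a b = g c x (J c x (tg c x a)) (tg c x b)" for a b
    unfolding x_def by (rule kahler_chart[OF c])
  note lin = parts_linear(1)[OF c(1) x] J_linear[OF c(1) x] g_linear(1)[OF c(1) x] g_linear(2)[OF c(1) x]
  show "bilinear (kahler p)"
    unfolding bilinear_def
    by (auto intro!: linearI simp: k linear_add[OF lin(1)] linear_cmul[OF lin(1)] linear_add[OF lin(2)] linear_cmul[OF lin(2)]
        linear_add[OF lin(3)] linear_cmul[OF lin(3)] linear_add[OF lin(4)] linear_cmul[OF lin(4)])
  show skew: "kahler p a b = - kahler p b a" for a b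
    unfolding k by (rule g_J[OF c(1) x])
  have tx: "tg c x (\<xi> p) = 0" using parts_xi(1)[OF c(1) x, of 1] by (simp add: xi)
  show "kahler p (\<xi> p) b = 0"
    by (simp add: k tx linear_0[OF lin(2)] linear_0[OF lin(3)])
  show "\<xi> p \<noteq> 0"
    using transversal[OF x] linear_0[OF linear_df[OF x]] xi by (metis rangeI)
  show "a \<in> span {\<xi> p}" if z: "\<And>b. kahler p a b = 0"
  proof -
    \<comment> \<open>The values b range over all tangent vectors J v, and J is g-orthogonal, so the
      form g itself is seen to vanish on the tangential part of a.\<close>
    have "g c x v (tg c x a) = 0" for v
    proof -
      have "g c x (J c x (tg c x a)) (J c x v) = 0"
        using z[of "ddir (in_chart c \<phi>) x (J c x v)"] by (simp add: k parts_tangent[OF c(1) x])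
      then show ?thesis using hermitian[OF c(1) x, of "tg c x a" v] g_symmetric[OF x, of v] by simp
    qed
    then have "tg c x a = 0" by (rule nondegenerate[OF x])
    then have "a = tv c x a *\<^sub>R \<xi> p"
      using parts[OF x, of a] linear_0[OF linear_df[OF x]] by (simp add: xi)
    then show ?thesis by (metis span_base span_scale singletonI)
  qed
qed

end

text \<open>In Darboux coordinates for \<open>\<omega>\<close>, the affine coordinates of \<open>\<phi>\<close> are completed to holomorphic functions
  by the components of the conormal map.\<close>

locale special_sphere_darboux = special_sphere +
  fixes p0 and e f :: "'m::finite \<Rightarrow> real^'c option"
  assumes p0: "p0 \<in> M" and card: "CARD('c) = 2 * CARD('m)"
    and expand: "\<And>a b. kahler p0 a b = (\<Sum>i\<in>UNIV. kahler p0 a (f i) * kahler p0 (e i) b - kahler p0 a (e i) * kahler p0 (f i) b)"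
    and kernel: "\<And>a. (\<And>i. kahler p0 a (e i) = 0) \<Longrightarrow> (\<And>i. kahler p0 a (f i) = 0) \<Longrightarrow> \<exists>t. a = t *\<^sub>R \<xi> p0"
begin

abbreviation "om \<equiv> kahler p0"
abbreviation "dphi c x \<equiv> ddir (in_chart c \<phi>) x"

lemma om_linear: "linear (\<lambda>a. om a b)"
  using kahler_properties(1)[OF p0] by (simp add: bilinear_def)

lemma om_bounded_linear: "bounded_linear (\<lambda>a. om a b)"
  using om_linear linear_conv_bounded_linear by blast

definition Z where "Z b p = complex_of_real (om (\<phi> p) b) - \<i> * complex_of_real (conormal p b)"

text \<open>The halves cancel the factor 2 of \<open>Re_hermitian_form\<close>, so that the
  pulled-back metric is exactly g. The order, f for z and e for w, fixes the sign in
  \<open>real_form_qq\<close>.\<close>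

definition immersion where "immersion p = ((\<chi> i. Z (f i) p / 2), (\<chi> i. Z (e i) p))"

text \<open>A fixed linear map through which the real part of the differential of the immersion
  factors; its kernel is the line of \<xi>.\<close>

definition qq :: "real^'c option \<Rightarrow> (real^'m) \<times> (real^'m)" where
  "qq a = ((\<chi> i. om a (f i) / 2), (\<chi> i. om a (e i)))"

lemma in_chart_Z: "in_chart k (Z b) x = complex_of_real (om (in_chart k \<phi> x) b) - \<i> * complex_of_real (in_chart k (\<lambda>p. conormal p b) x)"
  by (simp add: in_chart_def Z_def)

lemma in_chart_immersion: "in_chart k immersion x = ((\<chi> i. in_chart k (Z (f i)) x / 2), (\<chi> i. in_chart k (Z (e i)) x))"
  by (simp add: in_chart_def immersion_def)

lemma smooth_Z: "k \<in> A \<Longrightarrow> smooth_on (chart_image k) (in_chart k (Z b))"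
  unfolding in_chart_Z[abs_def]
  by (intro smooth_on_diff smooth_on_linear[OF bounded_linear_const_mult[OF bounded_linear_of_real]]
      smooth_on_linear[OF bounded_linear_of_real] smooth_on_linear[OF om_bounded_linear]
      open_chart_image[OF chart] bc(1) smooth_conormal)

lemma smooth_immersion: "k \<in> A \<Longrightarrow> smooth_on (chart_image k) (in_chart k immersion)"
  unfolding in_chart_immersion[abs_def] divide_inverse
  by (intro smooth_on_Pair smooth_on_vec smooth_on_mult smooth_on_const open_chart_image[OF chart] smooth_Z)

text \<open>Since J squares to -1, \<omega>(d\<phi>(J u), b) = - g(u, Y) for the tangential part Y
  of b, which is the derivative of the conormal component. In this form the differential is visibly
  complex linear with respect to J.\<close>

lemma Z_derivative:
  assumes k: "k \<in> A" and x: "x \<in> chart_image k"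
  shows "ddir (in_chart k (Z b)) x u
    = complex_of_real (om (dphi k x u) b) - \<i> * complex_of_real (om (dphi k x (J k x u)) b)"
proof -
  have "((\<lambda>y. complex_of_real (om (in_chart k \<phi> y) b) - \<i> * complex_of_real (in_chart k (\<lambda>p. conormal p b) y)) has_derivative
      (\<lambda>u. complex_of_real (om (dphi k x u) b) - \<i> * complex_of_real (ddir (in_chart k (\<lambda>p. conormal p b)) x u))) (at x)"
    by (intro has_derivative_diff has_derivative_mult_right bounded_linear.has_derivative[OF bounded_linear_of_real]
        bounded_linear.has_derivative[OF om_bounded_linear] smooth_onD[OF bc(1)[OF k] x] smooth_onD[OF smooth_conormal[OF k] x])
  moreover have "om (dphi k x (J k x u)) b = - g k x u (tg k x b)"
    by (simp add: kahler_tangent[OF p0 k x] J_square[OF k x] linear_neg[OF g_linear(1)[OF k x]])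
  ultimately show ?thesis
    unfolding in_chart_Z[abs_def] by (simp add: ddir_eqI conormal_derivative[OF k x])
qed

abbreviation "eta k x \<equiv> ddir (in_chart k immersion) x"

lemma eta_components:
  assumes k: "k \<in> A" and x: "x \<in> chart_image k"
  shows "fst (eta k x u) $ i = (complex_of_real (om (dphi k x u) (f i)) - \<i> * complex_of_real (om (dphi k x (J k x u)) (f i))) / 2"
    and "snd (eta k x u) $ i = complex_of_real (om (dphi k x u) (e i)) - \<i> * complex_of_real (om (dphi k x (J k x u)) (e i))"
proof -
  have 1: "ddir (\<lambda>y. fst (in_chart k immersion y) $ i) x u = fst (eta k x u) $ i"
    by (rule ddir_bounded_linear[OF bounded_linear_compose[OF bounded_linear_vec_nth bounded_linear_fst] smooth_immersion[OF k] x])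
  have "ddir (\<lambda>y. in_chart k (Z (f i)) y / 2) x u = ddir (in_chart k (Z (f i))) x u / 2"
    by (rule ddir_bounded_linear[OF bounded_linear_divide smooth_Z[OF k] x])
  with 1 show "fst (eta k x u) $ i = (complex_of_real (om (dphi k x u) (f i)) - \<i> * complex_of_real (om (dphi k x (J k x u)) (f i))) / 2"
    by (simp add: in_chart_immersion Z_derivative[OF k x])
  have 2: "ddir (\<lambda>y. snd (in_chart k immersion y) $ i) x u = snd (eta k x u) $ i"
    by (rule ddir_bounded_linear[OF bounded_linear_compose[OF bounded_linear_vec_nth bounded_linear_snd] smooth_immersion[OF k] x])
  then show "snd (eta k x u) $ i = complex_of_real (om (dphi k x u) (e i)) - \<i> * complex_of_real (om (dphi k x (J k x u)) (e i))"
    by (simp add: in_chart_immersion Z_derivative[OF k x])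
qed

lemma eta_linear: "k \<in> A \<Longrightarrow> x \<in> chart_image k \<Longrightarrow> linear (eta k x)"
  by (rule smooth_on_linear_ddir[OF smooth_immersion])

lemma re_part_eta: "k \<in> A \<Longrightarrow> x \<in> chart_image k \<Longrightarrow> re_part (eta k x u) = qq (dphi k x u)"
  by (simp add: re_part_def qq_def eta_components vec_eq_iff)

lemma eta_J:
  assumes k: "k \<in> A" and x: "x \<in> chart_image k"
  shows "eta k x (J k x u) = cscale \<i> (eta k x u)"
  by (simp add: prod_eq_iff vec_eq_iff cscale_def eta_components[OF k x] J_square[OF k x]
      linear_neg[OF dphi_linear[OF k x]] linear_neg[OF om_linear] algebra_simps flip: mult.assoc)

lemma linear_qq: "linear qq"
  by (rule linearI) (simp_all add: qq_def vec_eq_iff linear_add[OF om_linear] linear_cmul[OF om_linear] add_divide_distrib)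

lemma real_form_qq: "real_form (qq a) (qq b) = - om a b / 2"
proof -
  have "om a b = (\<Sum>i\<in>UNIV. - (om a (f i) * om b (e i)) + om a (e i) * om b (f i))"
    by (subst expand, rule sum.cong) (simp_all add: kahler_properties(2)[OF p0, of _ b])
  moreover have "real_form (qq a) (qq b) = (\<Sum>i\<in>UNIV. (om a (f i) * om b (e i) - om a (e i) * om b (f i)) / 2)"
    by (simp add: real_form_def qq_def diff_divide_distrib)
  moreover have "(\<Sum>i\<in>UNIV. (om a (f i) * om b (e i) - om a (e i) * om b (f i)) / 2)
      = - (\<Sum>i\<in>UNIV. - (om a (f i) * om b (e i)) + om a (e i) * om b (f i)) / 2"
    by (simp add: sum_divide_distrib[symmetric] sum_negf[symmetric])
  ultimately show ?thesis by simp
qed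

lemma qq_kernel: "qq a = 0 \<Longrightarrow> \<exists>t. a = t *\<^sub>R \<xi> p0"
  by (rule kernel) (simp_all add: qq_def prod_eq_iff vec_eq_iff)

lemma eta_real_form:
  assumes k: "k \<in> A" and x: "x \<in> chart_image k"
  shows "real_form (re_part (eta k x u)) (re_part (eta k x v)) = - g k x (J k x u) v / 2"
  by (simp add: re_part_eta[OF k x] real_form_qq kahler_tangent[OF p0 k x] parts_tangent[OF k x])

text \<open>The real part of \<Omega> is a difference of two values of \<omega>, one with both
  arguments rotated by J, and vanishes because g is Hermitian. Rotating u by J then disposes of the
  imaginary part.\<close>

lemma eta_Lagrangian:
  assumes k: "k \<in> A" and x: "x \<in> chart_image k"
  shows "Omega (eta k x u) (eta k x v) = 0"
proof -
  have Re0: "Re (Omega (eta k x u) (eta k x v)) = 0" for u v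
    by (simp add: Re_Omega eta_J[OF k x, symmetric] eta_real_form[OF k x] hermitian[OF k x])
  have "Omega (eta k x (J k x u)) (eta k x v) = \<i> * Omega (eta k x u) (eta k x v)"
    by (simp add: eta_J[OF k x] Omega_cscale)
  then have "Im (Omega (eta k x u) (eta k x v)) = 0"
    using Re0[of "J k x u" v] by simp
  then show ?thesis using Re0 by (simp add: complex_eq_iff)
qed

lemma eta_metric:
  assumes k: "k \<in> A" and x: "x \<in> chart_image k"
  shows "Re (hermitian_form (eta k x u) (eta k x v)) = g k x u v"
  by (simp add: Re_hermitian_form[OF eta_Lagrangian[OF k x]] eta_J[OF k x, symmetric] eta_real_form[OF k x]
      J_square[OF k x] linear_neg[OF g_linear(1)[OF k x]])

lemma xi_in_chart: "k \<in> A \<Longrightarrow> x \<in> chart_image k \<Longrightarrow> in_chart k \<xi> x = \<xi> p0"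
  using xi_constant[OF in_M[OF _ chart_inverse(2)[OF chart]] p0] by (simp add: in_chart_def)

text \<open>A vector in the kernel is mapped by d\<phi> into the kernel of \<open>qq\<close>, the
  line of \<xi>, to which \<phi> is transversal.\<close>

lemma eta_inj:
  assumes k: "k \<in> A" and x: "x \<in> chart_image k"
  shows "inj (eta k x)"
proof -
  have "u = 0" if u: "eta k x u = 0" for u
  proof -
    have "qq (dphi k x u) = re_part 0"
      using re_part_eta[OF k x, of u] by (simp add: u)
    also have "\<dots> = 0" by (rule linear_0[OF linear_re_part])
    finally have "qq (dphi k x u) = 0" .
    then obtain t where "dphi k x u = t *\<^sub>R \<xi> p0" using qq_kernel by blast
    then have "tg k x (dphi k x u) = 0"
      using parts_xi(1)[OF k x, of t] by (simp add: xi_in_chart[OF k x])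
    then show "u = 0" by (simp add: parts_tangent[OF k x])
  qed
  then show ?thesis by (simp add: linear_injective_0[OF eta_linear[OF k x]])
qed

end

section \<open>A graph chart and its generating function\<close>

locale local_graph = special_sphere_darboux +
  fixes c K U \<kappa> z0 r
  assumes c: "c \<in> A" and U: "open U" "U \<subseteq> chart_image c"
    and smooth_kappa: "smooth_on (ball z0 r) \<kappa>" and kappa_U: "\<And>y. y \<in> ball z0 r \<Longrightarrow> \<kappa> y \<in> U"
    and z_kappa: "\<And>y. y \<in> ball z0 r \<Longrightarrow> fst (swap_at K (in_chart c immersion (\<kappa> y))) = y"
    and kappa_z: "\<And>x. x \<in> U \<Longrightarrow> \<kappa> (fst (swap_at K (in_chart c immersion x))) = x"
    and inj_z: "\<And>x. x \<in> U \<Longrightarrow> inj (\<lambda>u. fst (swap_at K (eta c x u)))"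
    and r: "0 < r"
begin

abbreviation "ball0 \<equiv> ball z0 r"

definition zc where "zc x = fst (swap_at K (in_chart c immersion x))"

definition graph_map where "graph_map y = swap_at K (in_chart c immersion (\<kappa> y))"

lemma kappa_in: "y \<in> ball0 \<Longrightarrow> \<kappa> y \<in> chart_image c"
  using kappa_U U by blast

lemma smooth_zc: "smooth_on (chart_image c) zc"
  unfolding zc_def[abs_def]
  by (rule smooth_on_linear[OF bounded_linear_compose[OF bounded_linear_fst bounded_linear_swap_at]
        open_chart_image[OF chart[OF c]] smooth_immersion[OF c]])

lemma smooth_graph_map: "smooth_on ball0 graph_map"
  unfolding graph_map_def[abs_def]
  by (rule smooth_on_linear[OF bounded_linear_swap_at open_ball
        smooth_on_compose[OF open_ball open_chart_image[OF chart[OF c]] _ smooth_immersion[OF c] smooth_kappa]])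
    (use kappa_in in auto)

lemma graph_map_derivative:
  assumes y: "y \<in> ball0"
  shows "ddir graph_map y v = swap_at K (eta c (\<kappa> y) (ddir \<kappa> y v))"
proof -
  have 1: "smooth_on ball0 (\<lambda>y. in_chart c immersion (\<kappa> y))"
    by (rule smooth_on_compose[OF open_ball open_chart_image[OF chart[OF c]] _ smooth_immersion[OF c] smooth_kappa])
      (use kappa_in in auto)
  have "ddir graph_map y v = swap_at K (ddir (\<lambda>y. in_chart c immersion (\<kappa> y)) y v)"
    unfolding graph_map_def[abs_def] by (rule ddir_bounded_linear[OF bounded_linear_swap_at 1 y])
  also have "ddir (\<lambda>y. in_chart c immersion (\<kappa> y)) y v = eta c (\<kappa> y) (ddir \<kappa> y v)"
    by (rule ddir_compose[OF smooth_immersion[OF c] smooth_kappa y kappa_in[OF y]])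
  finally show ?thesis .
qed

lemma fst_graph_map: "y \<in> ball0 \<Longrightarrow> fst (graph_map y) = y"
  unfolding graph_map_def by (rule z_kappa)

lemma fst_graph_map_derivative:
  assumes y: "y \<in> ball0"
  shows "fst (ddir graph_map y v) = v"
proof -
  have "fst (ddir graph_map y v) = ddir (\<lambda>y. fst (graph_map y)) y v"
    by (rule ddir_bounded_linear[OF bounded_linear_fst smooth_graph_map y, symmetric])
  also have "ddir (\<lambda>y. fst (graph_map y)) y = ddir (\<lambda>y. y) y"
    by (rule ddir_cong[OF open_ball y fst_graph_map])
  finally show ?thesis by simp
qed

lemma kappa_derivative_linear: "y \<in> ball0 \<Longrightarrow> linear (ddir \<kappa> y)"
  by (rule smooth_on_linear_ddir[OF smooth_kappa])

text \<open>The differential of \<kappa> inverts a map that takes J to multiplication by i, so it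
  takes i back to J; the comparison is made after applying that injective map.\<close>

lemma kappa_derivative_J:
  assumes y: "y \<in> ball0"
  shows "ddir \<kappa> y (\<i> *s v) = J c (\<kappa> y) (ddir \<kappa> y v)"
proof (rule injD[OF inj_z[OF kappa_U[OF y]]])
  have "fst (swap_at K (eta c (\<kappa> y) (ddir \<kappa> y w))) = w" for w
    using fst_graph_map_derivative[OF y, of w] by (simp add: graph_map_derivative[OF y])
  then show "fst (swap_at K (eta c (\<kappa> y) (ddir \<kappa> y (\<i> *s v)))) = fst (swap_at K (eta c (\<kappa> y) (J c (\<kappa> y) (ddir \<kappa> y v))))"
    by (simp add: eta_J[OF c kappa_in[OF y]] swap_at_cscale) (simp add: cscale_def)
qed

lemma graph_map_derivative_i:
  assumes y: "y \<in> ball0"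
  shows "ddir graph_map y (\<i> *s v) = cscale \<i> (ddir graph_map y v)"
  by (simp add: graph_map_derivative[OF y] kappa_derivative_J[OF y] eta_J[OF c kappa_in[OF y]] swap_at_cscale)

lemma graph_map_Lagrangian: "y \<in> ball0 \<Longrightarrow> Omega (ddir graph_map y u) (ddir graph_map y v) = 0"
  by (simp add: graph_map_derivative Omega_swap_at eta_Lagrangian[OF c kappa_in])

lemma graph_component_derivative:
  assumes y: "y \<in> ball0"
  shows "((\<lambda>y. snd (graph_map y) $ i) has_derivative (\<lambda>v. \<Sum>j\<in>UNIV. snd (ddir graph_map y (axis j 1)) $ i * v $ j)) (at y)"
proof -
  have bl: "bounded_linear (\<lambda>X. snd X $ i)"
    by (rule bounded_linear_compose[OF bounded_linear_vec_nth bounded_linear_snd])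
  have D: "((\<lambda>y. snd (graph_map y) $ i) has_derivative (\<lambda>v. snd (ddir graph_map y v) $ i)) (at y)"
    by (rule bounded_linear.has_derivative[OF bl smooth_onD[OF smooth_graph_map y]])
  show ?thesis
    by (rule has_derivative_eq_rhs[OF D], rule ext, rule complex_linear_expand[OF has_derivative_linear[OF D]])
      (simp add: graph_map_derivative_i[OF y] cscale_def)
qed

text \<open>The base components of the derivative of \<open>graph_map\<close> along the axes are the
  axes themselves, so the vanishing of \<Omega> on them says that the derivatives of the fibre
  components are symmetric. On a ball this closed form has a primitive.\<close>

lemma generating_function:
  obtains F where "holomorphic_fun_on F ball0" "\<And>y. y \<in> ball0 \<Longrightarrow> dF_immersion F y = graph_map y"
proof -
  define w where "w i y = snd (graph_map y) $ i" for i y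
  have w: "holomorphic_fun_on (w i) ball0" for i
    unfolding w_def by (rule holomorphic_fun_onI[OF graph_component_derivative])
  have pw: "partial (w i) j y = snd (ddir graph_map y (axis j 1)) $ i" if "y \<in> ball0" for i j y
    using partial_eqI[of "w i" "\<chi> j. snd (ddir graph_map y (axis j 1)) $ i" y j] graph_component_derivative[OF that, of i]
    by (simp add: w_def[abs_def])
  have sym: "partial (w i) j y = partial (w j) i y" if y: "y \<in> ball0" for i j y
  proof -
    have "(\<Sum>k\<in>UNIV. axis i 1 $ k * snd (ddir graph_map y (axis j 1)) $ k - snd (ddir graph_map y (axis i 1)) $ k * axis j 1 $ k) = 0"
      using graph_map_Lagrangian[OF y, of "axis i 1" "axis j 1"] by (simp add: Omega_def fst_graph_map_derivative[OF y])
    moreover have "(\<Sum>k\<in>UNIV. axis i 1 $ k * snd (ddir graph_map y (axis j 1)) $ k) = (\<Sum>k\<in>UNIV. if k = i then snd (ddir graph_map y (axis j 1)) $ k else 0)"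
      by (rule sum.cong) (auto simp: axis_def)
    moreover have "(\<Sum>k\<in>UNIV. snd (ddir graph_map y (axis i 1)) $ k * axis j 1 $ k) = (\<Sum>k\<in>UNIV. if k = j then snd (ddir graph_map y (axis i 1)) $ k else 0)"
      by (rule sum.cong) (auto simp: axis_def)
    ultimately show ?thesis by (simp add: sum_subtractf pw[OF y])
  qed
  obtain F where F: "holomorphic_fun_on F ball0" "\<And>i y. y \<in> ball0 \<Longrightarrow> partial F i y = w i y"
    using holomorphic_Poincare[OF w sym] by blast
  have "dF_immersion F y = graph_map y" if "y \<in> ball0" for y
    using F(2)[OF that] fst_graph_map[OF that] by (simp add: dF_immersion_def w_def prod_eq_iff vec_eq_iff)
  with F(1) show ?thesis by (rule that)
qed

text \<open>The domain is cut down to the points on which \<kappa> inverts \<open>zc\<close> over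
  the ball, so that the chart image is exactly the ball.\<close>

definition local_chart where
  "local_chart = ({p \<in> fst c. snd c p \<in> U \<and> zc (snd c p) \<in> ball0}, \<lambda>p. zc (snd c p))"

lemma local_chart_point:
  assumes y: "y \<in> ball0"
  shows "inv_into (fst c) (snd c) (\<kappa> y) \<in> fst local_chart"
    and "snd local_chart (inv_into (fst c) (snd c) (\<kappa> y)) = y"
  using chart_inverse(2,3)[OF chart[OF c] kappa_in[OF y]] z_kappa[OF y] kappa_U[OF y] y
  by (simp_all add: local_chart_def zc_def)

lemma local_chart_back:
  "p \<in> fst local_chart \<Longrightarrow> inv_into (fst c) (snd c) (\<kappa> (snd local_chart p)) = p"
  using kappa_z chart_inverse(1)[OF chart[OF c]] by (simp add: local_chart_def zc_def)

lemma chart_image_local: "chart_image local_chart = ball0"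
proof
  show "chart_image local_chart \<subseteq> ball0" by (auto simp: chart_image_def local_chart_def)
  show "ball0 \<subseteq> chart_image local_chart"
  proof
    fix y assume y: "y \<in> ball0"
    show "y \<in> chart_image local_chart"
      unfolding chart_image_def
      by (rule image_eqI[where x = "inv_into (fst c) (snd c) (\<kappa> y)"]) (simp_all add: local_chart_point[OF y])
  qed
qed

lemma inv_local_chart: "y \<in> ball0 \<Longrightarrow> inv_into (fst local_chart) (snd local_chart) y = inv_into (fst c) (snd c) (\<kappa> y)"
proof (rule inv_into_f_eq)
  show "inj_on (snd local_chart) (fst local_chart)"
    by (rule inj_on_inverseI) (rule local_chart_back)
qed (rule local_chart_point, assumption)+

lemma in_local_chart: "y \<in> ball0 \<Longrightarrow> in_chart local_chart h y = in_chart c h (\<kappa> y)"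
  by (simp add: in_chart_def inv_local_chart)

lemma open_z_domain: "open {x \<in> U. zc x \<in> ball0}"
proof -
  have "continuous_on U zc"
    using smooth_on_continuous[OF smooth_zc] U(2) continuous_on_subset by blast
  then have "open (U \<inter> zc -` ball0)"
    using U(1) by (intro continuous_open_preimage) auto
  moreover have "U \<inter> zc -` ball0 = {x \<in> U. zc x \<in> ball0}" by auto
  ultimately show ?thesis by simp
qed

lemma is_chart_local: "is_chart M local_chart"
  unfolding is_chart_def
proof (intro conjI)
  show "openin (top_of_set M) (fst local_chart)"
    using chart_preimage_open[OF chart[OF c] open_z_domain] by (simp add: local_chart_def)
  show "open (chart_image local_chart)" by (simp add: chart_image_local)
  have hc: "homeomorphism (fst c) (chart_image c) (snd c) (inv_into (fst c) (snd c))"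
    using chart[OF c] unfolding is_chart_def by blast
  show "homeomorphism (fst local_chart) (chart_image local_chart) (snd local_chart)
      (inv_into (fst local_chart) (snd local_chart))"
  proof (rule homeomorphismI)
    have "continuous_on (fst local_chart) (\<lambda>p. zc (snd c p))"
      by (rule continuous_on_compose2[OF smooth_on_continuous[OF smooth_zc] continuous_on_subset[OF homeomorphism_cont1[OF hc]]])
        (auto simp: local_chart_def chart_image_def)
    then show "continuous_on (fst local_chart) (snd local_chart)" by (simp add: local_chart_def)
    have "continuous_on ball0 (\<lambda>y. inv_into (fst c) (snd c) (\<kappa> y))"
      by (rule continuous_on_compose2[OF homeomorphism_cont2[OF hc] smooth_on_continuous[OF smooth_kappa]])
        (use kappa_in in blast)
    then show "continuous_on (chart_image local_chart) (inv_into (fst local_chart) (snd local_chart))"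
      unfolding chart_image_local by (rule continuous_on_eq) (simp add: inv_local_chart)
    show "snd local_chart ` fst local_chart \<subseteq> chart_image local_chart" by (simp add: chart_image_def)
    show "inv_into (fst local_chart) (snd local_chart) ` chart_image local_chart \<subseteq> fst local_chart"
      unfolding chart_image_local using inv_local_chart local_chart_point(1) by auto
    show "inv_into (fst local_chart) (snd local_chart) (snd local_chart p) = p" if "p \<in> fst local_chart" for p
    proof -
      have "snd local_chart p \<in> ball0" using that by (simp add: local_chart_def)
      then show ?thesis using local_chart_back[OF that] by (simp add: inv_local_chart)
    qed
    show "snd local_chart (inv_into (fst local_chart) (snd local_chart) y) = y" if "y \<in> chart_image local_chart" for y
      using that unfolding chart_image_local by (simp add: inv_local_chart local_chart_point)
  qed
qed

text \<open>Transitions factor through c: from the new chart they are \<kappa> followed by a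
  transition of c, towards it a transition to c followed by \<open>zc\<close>.\<close>

lemma compatible_local: "compatible_chart M A local_chart"
  unfolding compatible_chart_def
proof (intro conjI ballI)
  show "is_chart M local_chart" by (rule is_chart_local)
  fix k assume k: "k \<in> A"
  have ok: "openin (top_of_set M) (fst k)" and ol: "openin (top_of_set M) (fst local_chart)"
    using chart[OF k] is_chart_local unfolding is_chart_def by blast+
  have oc: "openin (top_of_set M) (fst c)" using chart[OF c] unfolding is_chart_def by blast
  show "smooth_transition local_chart k"
    unfolding smooth_transition_def
  proof (rule smooth_on_congI)
    let ?O = "snd local_chart ` (fst local_chart \<inter> fst k)"
    show o: "open ?O" by (rule chart_image_open[OF is_chart_local ok])
    have "?O \<subseteq> ball0" by (auto simp: local_chart_def)
    have sub: "\<kappa> ` ?O \<subseteq> snd c ` (fst c \<inter> fst k)"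
    proof
      fix x assume "x \<in> \<kappa> ` ?O"
      then obtain p where p: "p \<in> fst local_chart" "p \<in> fst k" "x = \<kappa> (snd local_chart p)" by blast
      have "x = snd c p" using p kappa_z by (simp add: local_chart_def zc_def)
      then show "x \<in> snd c ` (fst c \<inter> fst k)" using p by (auto simp: local_chart_def)
    qed
    show "smooth_on ?O (\<lambda>y. in_chart c (snd k) (\<kappa> y))"
      by (rule smooth_on_compose[OF o chart_image_open[OF chart[OF c] ok] sub _ smooth_on_subset[OF smooth_kappa \<open>?O \<subseteq> ball0\<close>]])
        (use smooth_manifoldD(2)[OF manifold c k] in \<open>simp add: smooth_transition_def\<close>)
    show "in_chart c (snd k) (\<kappa> y) = in_chart local_chart (snd k) y" if "y \<in> ?O" for y
    proof -
      have "y \<in> ball0" using that \<open>?O \<subseteq> ball0\<close> by blast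
      then show ?thesis by (rule in_local_chart[symmetric])
    qed
  qed
  show "smooth_transition k local_chart"
    unfolding smooth_transition_def
  proof (rule smooth_on_congI)
    let ?O = "snd k ` (fst k \<inter> fst local_chart)"
    show o: "open ?O" by (rule chart_image_open[OF chart[OF k] ol])
    have "?O \<subseteq> snd k ` (fst k \<inter> fst c)" by (auto simp: local_chart_def)
    have sm: "smooth_on (snd k ` (fst k \<inter> fst c)) (in_chart k (snd c))"
      using smooth_manifoldD(2)[OF manifold k c] by (simp add: smooth_transition_def)
    have sub: "in_chart k (snd c) ` ?O \<subseteq> chart_image c"
      using in_chart_apply[OF chart[OF k], where h = "snd c"] chart_image_mem[of _ c] by (auto simp: local_chart_def)
    show "smooth_on ?O (\<lambda>y. zc (in_chart k (snd c) y))"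
      by (rule smooth_on_compose[OF o open_chart_image[OF chart[OF c]] sub smooth_zc
            smooth_on_subset[OF sm \<open>?O \<subseteq> snd k ` (fst k \<inter> fst c)\<close>]])
    show "zc (in_chart k (snd c) y) = in_chart k (snd local_chart) y" for y
      by (simp add: in_chart_def local_chart_def)
  qed
qed

end

section \<open>The generating function defines the given sphere\<close>

locale local_function = local_graph +
  fixes F
  assumes F: "holomorphic_fun_on F ball0" and dF: "\<And>y. y \<in> ball0 \<Longrightarrow> dF_immersion F y = graph_map y"
begin

lemma dF_ddir: "y \<in> ball0 \<Longrightarrow> ddir (dF_immersion F) y = ddir graph_map y"
  by (rule ddir_cong[OF open_ball _ dF])

text \<open>Exchanging conjugate pairs preserves \<gamma>, and the immersion was normalised to
  realise g.\<close>

lemma metric_local: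
  assumes y: "y \<in> ball0"
  shows "metric_of F y u v = g c (\<kappa> y) (ddir \<kappa> y u) (ddir \<kappa> y v)"
  by (simp add: metric_of_def pullback_form_def dF_ddir[OF y] graph_map_derivative[OF y] hermitian_form_swap_at
      eta_metric[OF c kappa_in[OF y]])

lemma kappa_derivative_inj:
  assumes y: "y \<in> ball0"
  shows "inj (ddir \<kappa> y)"
proof -
  have "v = 0" if v: "ddir \<kappa> y v = 0" for v
  proof -
    have "v = fst (ddir graph_map y v)" by (rule fst_graph_map_derivative[OF y, symmetric])
    also have "ddir graph_map y v = ddir graph_map y 0"
      by (simp add: graph_map_derivative[OF y] v linear_0[OF kappa_derivative_linear[OF y]])
    also have "fst (ddir graph_map y 0) = 0" by (rule fst_graph_map_derivative[OF y])
    finally show ?thesis .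
  qed
  then show ?thesis by (simp add: linear_injective_0[OF kappa_derivative_linear[OF y]])
qed

lemma dim_e: "DIM('b) = CARD('c)"
  by (rule blaschke_chart.dim[OF blaschke_chart_in[OF c]])

lemma kappa_derivative_surj: "y \<in> ball0 \<Longrightarrow> surj (ddir \<kappa> y)"
  by (rule linear_injective_imp_surj[OF kappa_derivative_linear kappa_derivative_inj])
    (simp_all add: dim_e card dim_complex_vec)

lemma nondegenerate_local: "nondegenerate_on ball0 F"
  unfolding nondegenerate_on_def
proof (intro conjI F ballI allI impI)
  fix y v assume y: "y \<in> ball0" and v: "\<forall>u. pullback_form F y u v = 0"
  have "g c (\<kappa> y) w (ddir \<kappa> y v) = 0" for w
  proof -
    obtain u where u: "w = ddir \<kappa> y u" using surjD[OF kappa_derivative_surj[OF y]] by blast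
    show ?thesis using metric_local[OF y, of u v] v by (simp add: u metric_of_def)
  qed
  then have "ddir \<kappa> y v = 0"
    by (rule blaschke_chart.nondegenerate[OF blaschke_chart_in[OF c] kappa_in[OF y]])
  then show "v = 0"
    using kappa_derivative_inj[OF y] by (simp add: linear_injective_0[OF kappa_derivative_linear[OF y]])
qed

sublocale N: nondegenerate_function ball0 F
  by unfold_locales (simp_all add: nondegenerate_local)

abbreviation "phi' \<equiv> in_chart local_chart \<phi>"
abbreviation "xi' \<equiv> in_chart local_chart \<xi>"

lemma smooth_phi': "smooth_on ball0 phi'"
proof (rule smooth_on_congI[OF open_ball])
  show "smooth_on ball0 (\<lambda>y. in_chart c \<phi> (\<kappa> y))"
    by (rule smooth_on_compose[OF open_ball open_chart_image[OF chart[OF c]] _ bc(1)[OF c] smooth_kappa])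
      (use kappa_in in auto)
qed (simp add: in_local_chart)

lemma phi'_derivative:
  assumes y: "y \<in> ball0"
  shows "ddir phi' y v = dphi c (\<kappa> y) (ddir \<kappa> y v)"
proof -
  have "ddir phi' y = ddir (\<lambda>y. in_chart c \<phi> (\<kappa> y)) y"
    by (rule ddir_cong[OF open_ball y in_local_chart])
  then show ?thesis
    using ddir_compose[OF bc(1)[OF c] smooth_kappa y kappa_in[OF y]] by simp
qed

lemma xi'_constant: "y \<in> ball0 \<Longrightarrow> xi' y = \<xi> p0"
  by (simp add: in_local_chart xi_in_chart[OF c kappa_in])

lemma qq_phi':
  assumes y: "y \<in> ball0"
  shows "N.q y v = swap_real K (qq (ddir phi' y v))"
  by (simp add: N.q_def dF_ddir[OF y] graph_map_derivative[OF y] re_part_swap_at re_part_eta[OF c kappa_in[OF y]]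
      phi'_derivative[OF y])

text \<open>The conormal annihilates tangent vectors. Differentiating this identity expresses the
  conormal component of the second derivative through the derivative of the conormal, so the second
  derivatives of \<kappa> never have to be computed.\<close>

lemma conormal_phi':
  assumes y: "y \<in> ball0"
  shows "tv c (\<kappa> y) (ddir (\<lambda>y. ddir phi' y v) y u) = metric_of F y u v"
proof -
  have ck: "\<kappa> ` ball0 \<subseteq> chart_image c" using kappa_in by blast
  have sn: "smooth_on ball0 (\<lambda>y. tv c (\<kappa> y) a)" for a
  proof (rule smooth_on_congI[OF open_ball])
    show "smooth_on ball0 (\<lambda>y. in_chart c (\<lambda>p. conormal p a) (\<kappa> y))"
      by (rule smooth_on_compose[OF open_ball open_chart_image[OF chart[OF c]] ck smooth_conormal[OF c] smooth_kappa])
  qed (simp add: conormal_in_chart[OF c kappa_in])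
  have dn: "ddir (\<lambda>y. tv c (\<kappa> y) a) y u = - g c (\<kappa> y) (ddir \<kappa> y u) (tg c (\<kappa> y) a)" for a
  proof -
    have "ddir (\<lambda>y. tv c (\<kappa> y) a) y = ddir (\<lambda>y. in_chart c (\<lambda>p. conormal p a) (\<kappa> y)) y"
      by (rule ddir_cong[OF open_ball y]) (simp add: conormal_in_chart[OF c kappa_in])
    then show ?thesis
      using ddir_compose[OF smooth_conormal[OF c] smooth_kappa y kappa_in[OF y]]
      by (simp add: conormal_derivative[OF c kappa_in[OF y]])
  qed
  have "ddir (\<lambda>y. tv c (\<kappa> y) (ddir phi' y v)) y u
      = ddir (\<lambda>z. tv c (\<kappa> z) (ddir phi' y v)) y u + tv c (\<kappa> y) (ddir (\<lambda>y. ddir phi' y v) y u)"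
    by (rule ddir_linear_family[where q = "\<lambda>y. tv c (\<kappa> y)", OF open_ball y parts_linear(2)[OF c kappa_in] sn smooth_on_ddir[OF smooth_phi']])
  moreover have "ddir (\<lambda>y. tv c (\<kappa> y) (ddir phi' y v)) y = ddir (\<lambda>y. 0) y"
    by (rule ddir_cong[OF open_ball y]) (simp add: phi'_derivative parts_tangent[OF c kappa_in])
  ultimately have "tv c (\<kappa> y) (ddir (\<lambda>y. ddir phi' y v) y u) = g c (\<kappa> y) (ddir \<kappa> y u) (tg c (\<kappa> y) (ddir phi' y v))"
    by (simp add: dn)
  then show ?thesis
    by (simp add: phi'_derivative[OF y] parts_tangent[OF c kappa_in[OF y]] metric_local[OF y])
qed

text \<open>By the definition of \<open>Gam\<close>, the difference \<open>?D\<close> is annihilated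
  by \<open>qq\<close>, so it is a multiple of \<xi>. The conormal map reads off the factor, which
  is the metric.\<close>

lemma gauss_local:
  assumes y: "y \<in> ball0"
  shows "ddir (\<lambda>y. ddir phi' y v) y u = ddir phi' y (N.Gam y u v) + metric_of F y u v *\<^sub>R xi' y"
proof -
  let ?D = "ddir (\<lambda>y. ddir phi' y v) y u - ddir phi' y (N.Gam y u v)"
  have bl: "bounded_linear (\<lambda>a. swap_real K (qq a))"
    using bounded_linear_compose[OF bounded_linear_swap_real] linear_qq linear_conv_bounded_linear by blast
  have "ddir (\<lambda>y. N.q y v) y = ddir (\<lambda>y. swap_real K (qq (ddir phi' y v))) y"
    by (rule ddir_cong[OF open_ball y qq_phi'])
  moreover have "ddir (\<lambda>y. swap_real K (qq (ddir phi' y v))) y u = swap_real K (qq (ddir (\<lambda>y. ddir phi' y v) y u))"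
    by (rule ddir_bounded_linear[OF bl smooth_on_ddir[OF smooth_phi'] y])
  ultimately have "swap_real K (qq (ddir phi' y (N.Gam y u v))) = swap_real K (qq (ddir (\<lambda>y. ddir phi' y v) y u))"
    using N.q_Gam[OF y, of u v] by (simp add: qq_phi'[OF y])
  then have "swap_real K (qq ?D) = 0"
    using linear_diff[OF bounded_linear.linear[OF bl]] by simp
  then have "qq ?D = 0" by (rule swap_real_eq_0)
  then obtain t where t: "?D = t *\<^sub>R \<xi> p0" using qq_kernel by blast
  have "tv c (\<kappa> y) ?D = metric_of F y u v"
    using linear_diff[OF parts_linear(2)[OF c kappa_in[OF y]]]
    by (simp add: conormal_phi'[OF y] phi'_derivative[OF y, of "N.Gam y u v"] parts_tangent[OF c kappa_in[OF y]])
  moreover have "tv c (\<kappa> y) (t *\<^sub>R \<xi> p0) = t"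
    using parts_xi(2)[OF c kappa_in[OF y]] by (simp add: xi_in_chart[OF c kappa_in[OF y]])
  ultimately have "t = metric_of F y u v" using t by simp
  then show ?thesis using t by (simp add: xi'_constant[OF y] algebra_simps)
qed

lemma sphere_local: "sphere_of_function ball0 F phi' xi'"
proof -
  have xi0: "ddir xi' y u = 0" if "y \<in> ball0" for y u
  proof -
    have "ddir xi' y = ddir (\<lambda>y. \<xi> p0) y" by (rule ddir_cong[OF open_ball that xi'_constant])
    then show ?thesis by simp
  qed
  have vol: "\<bar>induced_volume phi' xi' y X\<bar> = sqrt \<bar>det (\<chi> i j. metric_of F y (X i) (X j))\<bar>" if y: "y \<in> ball0" for y and X :: "'c \<Rightarrow> _"
  proof -
    \<comment> \<open>The Blaschke normalisation holds for every family of vectors, so it can be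
      used in the chart c on the images under the differential of \<kappa>.\<close>
    have "induced_volume phi' xi' y X = induced_volume (in_chart c \<phi>) (in_chart c \<xi>) (\<kappa> y) (\<lambda>j. ddir \<kappa> y (X j))"
      by (simp add: induced_volume_def phi'_derivative[OF y] in_local_chart[OF y] cong: option.case_cong)
    then show ?thesis
      using blaschke_chart.volume[OF blaschke_chart_in[OF c] kappa_in[OF y], of "\<lambda>j. ddir \<kappa> y (X j)"]
      by (simp add: metric_local[OF y])
  qed
  have "Blaschke_on ball0 phi' xi' N.Gam (metric_of F) (\<lambda>x v. 0)"
    by (rule Blaschke_onI[OF _ open_ball smooth_phi' smooth_on_congI[OF open_ball smooth_on_const xi'_constant[symmetric]]
          xi0 N.connection_Gam N.bilinear_metric N.metric_nondegenerate gauss_local vol])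
      (simp_all add: card dim_complex_vec)
  then show ?thesis
    unfolding sphere_of_function_def using N.is_connection_Gam by blast
qed

lemma immersion_local: "q \<in> fst local_chart \<Longrightarrow> immersion q = unswap_at K (dF_immersion F (snd local_chart q))"
proof -
  assume q: "q \<in> fst local_chart"
  then have "snd local_chart q \<in> ball0" "\<kappa> (snd local_chart q) = snd c q" "q \<in> fst c"
    using kappa_z by (auto simp: local_chart_def zc_def)
  then show ?thesis
    by (simp add: dF graph_map_def unswap_swap in_chart_apply[OF chart[OF c]])
qed

end

context special_sphere_darboux
begin

text \<open>The exchange K is chosen from the Lagrangian subspace at p alone; invertibility of the
  base projection then persists on a neighbourhood. The map \<open>immersion\<close> is the same for
  all p, and T undoes the exchange.\<close>

lemma local_model:
  assumes p: "p \<in> M"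
  shows "\<exists>(d :: ('a, complex^'m) chart) F T. p \<in> fst d \<and> compatible_chart M A d \<and>
    simply_connected_domain (chart_image d) \<and> nondegenerate_on (chart_image d) F \<and>
    real_symplectic T \<and> (\<forall>q\<in>fst d. immersion q = T (dF_immersion F (snd d q))) \<and>
    sphere_of_function (chart_image d) F (in_chart d \<phi>) (in_chart d \<xi>)"
proof -
  obtain c where c: "c \<in> A" "p \<in> fst c" using smooth_manifoldD(3)[OF manifold p] by blast
  let ?S = "chart_image c" and ?x0 = "snd c p"
  have x0: "?x0 \<in> ?S" by (rule chart_image_mem[OF c(2)])
  have S: "open ?S" by (rule open_chart_image[OF chart[OF c(1)]])
  obtain K where K: "inj (\<lambda>u. fst (swap_at K (eta c ?x0 u)))"
    using Lagrangian_graph[OF eta_linear[OF c(1) x0] eta_inj[OF c(1) x0] eta_J[OF c(1) x0] eta_Lagrangian[OF c(1) x0]] .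
  define h where "h x = fst (swap_at K (in_chart c immersion x))" for x
  have bl: "bounded_linear (\<lambda>X. fst (swap_at K X))"
    by (rule bounded_linear_compose[OF bounded_linear_fst bounded_linear_swap_at])
  have h: "smooth_on ?S h"
    unfolding h_def[abs_def] by (rule smooth_on_linear[OF bl S smooth_immersion[OF c(1)]])
  have dh: "ddir h x = (\<lambda>u. fst (swap_at K (eta c x u)))" if "x \<in> ?S" for x
    unfolding h_def[abs_def] by (rule ext) (rule ddir_bounded_linear[OF bl smooth_immersion[OF c(1)] that])
  have dim: "DIM('b) = CARD('c)" by (rule blaschke_chart.dim[OF blaschke_chart_in[OF c(1)]])
  have "inj (ddir h ?x0)" using K by (simp add: dh[OF x0])
  then obtain U V \<kappa> where U: "open U" "U \<subseteq> ?S" "?x0 \<in> U" and V: "open V" and hom: "homeomorphism U V h \<kappa>"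
    and sk: "smooth_on V \<kappa>" and inj: "\<And>x. x \<in> U \<Longrightarrow> inj (ddir h x)"
    using smooth_inverse_function[where 'k = 'c, OF S x0 h] dim card dim_complex_vec[where 'm = 'm] by auto
  have "h ?x0 \<in> V" using homeomorphism_image1[OF hom] U(3) by blast
  then obtain r where r: "r > 0" "ball (h ?x0) r \<subseteq> V" using V openE by blast
  interpret G: local_graph M A \<phi> \<xi> \<Gamma> g J p0 e f c K U \<kappa> "h ?x0" r
  proof unfold_locales
    show "smooth_on (ball (h ?x0) r) \<kappa>" by (rule smooth_on_subset[OF sk r(2)])
    show "\<kappa> y \<in> U" if "y \<in> ball (h ?x0) r" for y
      using homeomorphism_image2[OF hom] that r(2) by blast
    show "fst (swap_at K (in_chart c immersion (\<kappa> y))) = y" if "y \<in> ball (h ?x0) r" for y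
      using homeomorphism_apply2[OF hom, of y] that r(2) by (auto simp: h_def)
    show "\<kappa> (fst (swap_at K (in_chart c immersion x))) = x" if "x \<in> U" for x
      using homeomorphism_apply1[OF hom that] by (simp add: h_def)
    show "inj (\<lambda>u. fst (swap_at K (eta c x u)))" if "x \<in> U" for x
      using inj[OF that] dh[of x] U(2) that by auto
  qed (use c U r in auto)
  obtain F where F: "holomorphic_fun_on F (ball (h ?x0) r)"
    "\<And>y. y \<in> ball (h ?x0) r \<Longrightarrow> dF_immersion F y = G.graph_map y"
    using G.generating_function by blast
  interpret L: local_function M A \<phi> \<xi> \<Gamma> g J p0 e f c K U \<kappa> "h ?x0" r F
    by unfold_locales (use F in auto)
  have "p \<in> fst G.local_chart"
    unfolding G.local_chart_def G.zc_def using c U(3) r by (simp add: h_def)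
  moreover have "simply_connected_domain (ball (h ?x0) r)"
    using r by (simp add: simply_connected_domain_def convex_imp_simply_connected)
  ultimately show ?thesis
    using G.compatible_local L.nondegenerate_local real_symplectic_unswap_at[of K] L.immersion_local L.sphere_local
    by (intro exI[of _ G.local_chart] exI[of _ F] exI[of _ "unswap_at K"]) (simp add: G.chart_image_local)
qed

end

text \<open>Constant loops at two points are freely homotopic in the set, and the homotopy moves the
  base point along a path between them.\<close>

lemma connected_if_simply_connected:
  fixes S :: "'a::topological_space set"
  assumes "simply_connected S"
  shows "connected S"
proof -
  have "path_component S a b" if "a \<in> S" "b \<in> S" for a b
  proof -
    have "homotopic_loops S (\<lambda>_. a) (\<lambda>_. b)"
      using that assms[unfolded simply_connected_def, rule_format, of "\<lambda>_. a" "\<lambda>_. b"]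
      by (auto simp: path_def path_image_def pathstart_def pathfinish_def)
    from homotopic_loops_imp_path_component_value[OF this, of 0] show ?thesis by simp
  qed
  then show ?thesis
    by (intro path_connected_imp_connected) (simp add: path_connected_component)
qed

text \<open>A Darboux basis chosen at a single point p0 serves all of M, because on constant vectors
  \<omega> does not depend on the point.\<close>

lemma special_sphere_arises:
  fixes M :: "'a::{t2_space,second_countable_topology} set" and A :: "('a, 'e::euclidean_space) chart set"
    and \<phi> \<xi> :: "'a \<Rightarrow> real^('n::finite) option"
  assumes card: "CARD('n) = 2 * CARD('m::finite)" and conn: "connected M"
    and sp: "special_parabolic_sphere M A \<phi> \<xi>"
  shows "arises_from_holomorphic_functions TYPE('m) M A \<phi> \<xi>"
proof (cases "M = {}")
  case True
  then show ?thesis by (simp add: arises_from_holomorphic_functions_def)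
next
  case False
  then obtain p0 where p0: "p0 \<in> M" by blast
  obtain \<Gamma> g J where "parabolic_sphere M A \<phi> \<xi> \<Gamma> g" "almost_complex_structure A J"
    "\<forall>c\<in>A. (\<forall>x\<in>chart_image c. \<forall>u v. g c x (J c x u) (J c x v) = g c x u v) \<and>
       parallel_2form (chart_image c) (\<Gamma> c) (\<lambda>x u v. g c x (J c x u) v)"
    using sp unfolding special_parabolic_sphere_def by blast
  then interpret special_sphere M A \<phi> \<xi> \<Gamma> g J
    using conn by unfold_locales auto
  note k = kahler_properties[OF p0]
  have dim: "DIM(real^'n option) = 2 * CARD('m) + 1" using card by simp
  have "\<exists>e f :: 'm \<Rightarrow> real^'n option.
    (\<forall>a b. kahler p0 a b = (\<Sum>i\<in>UNIV. kahler p0 a (f i) * kahler p0 (e i) b - kahler p0 a (e i) * kahler p0 (f i) b)) \<and>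
    (\<forall>a. (\<forall>i. kahler p0 a (e i) = 0 \<and> kahler p0 a (f i) = 0) \<longrightarrow> (\<exists>t. a = t *\<^sub>R \<xi> p0))"
    by (rule darboux_basis[OF k(1) k(2) k(5) k(3) _ dim]) (rule k(4))
  then obtain e f :: "'m \<Rightarrow> real^'n option" where ef:
    "\<forall>a b. kahler p0 a b = (\<Sum>i\<in>UNIV. kahler p0 a (f i) * kahler p0 (e i) b - kahler p0 a (e i) * kahler p0 (f i) b)"
    "\<forall>a. (\<forall>i. kahler p0 a (e i) = 0 \<and> kahler p0 a (f i) = 0) \<longrightarrow> (\<exists>t. a = t *\<^sub>R \<xi> p0)"
    by (elim exE conjE) (rule that)
  interpret D: special_sphere_darboux M A \<phi> \<xi> \<Gamma> g J p0 e f
    by unfold_locales (fact p0, fact card, rule ef(1)[rule_format], use ef(2) in blast)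
  show ?thesis
    unfolding arises_from_holomorphic_functions_def
    using D.local_model by blast
qed

theorem corollary3p7:
  assumes "CARD('n::finite) = 2 * CARD('m::finite)"
  shows
    "(\<forall>(U :: (complex^'m) set) F. simply_connected_domain U \<and> nondegenerate_on U F \<longrightarrow>
        (\<exists>(\<phi> :: complex^'m \<Rightarrow> real^'n option) \<xi>. sphere_of_function U F \<phi> \<xi>) \<and>
        (\<forall>(\<phi> :: complex^'m \<Rightarrow> real^'n option) \<xi> \<psi> \<eta>.
           sphere_of_function U F \<phi> \<xi> \<and> sphere_of_function U F \<psi> \<eta> \<longrightarrow>
             equiaffine_related U \<phi> \<psi>) \<and>
        (\<forall>(\<phi> :: complex^'m \<Rightarrow> real^'n option) \<xi>. sphere_of_function U F \<phi> \<xi> \<longrightarrow>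
           special_parabolic_sphere U {(U, id)} \<phi> \<xi>))
     \<and>
     (\<forall>(M :: 'a::{t2_space,second_countable_topology} set) (A :: ('a, real^'n) chart set)
        (\<phi> :: 'a \<Rightarrow> real^'n option) \<xi>.
        simply_connected M \<and> special_parabolic_sphere M A \<phi> \<xi> \<longrightarrow>
          arises_from_holomorphic_functions TYPE('m) M A \<phi> \<xi>)"
proof (rule conjI; intro allI impI; elim conjE)
  fix U :: "(complex^'m) set" and F
  assume U: "simply_connected_domain U" and F: "nondegenerate_on U F"
  interpret nondegenerate_function U F
    using U F by unfold_locales (simp_all add: simply_connected_domain_def)
  have conn: "connected U"
    using U by (simp add: simply_connected_domain_def simply_connected_imp_connected)
  show "(\<exists>(\<phi> :: complex^'m \<Rightarrow> real^'n option) \<xi>. sphere_of_function U F \<phi> \<xi>) \<and>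
        (\<forall>(\<phi> :: complex^'m \<Rightarrow> real^'n option) \<xi> \<psi> \<eta>.
           sphere_of_function U F \<phi> \<xi> \<and> sphere_of_function U F \<psi> \<eta> \<longrightarrow>
             equiaffine_related U \<phi> \<psi>) \<and>
        (\<forall>(\<phi> :: complex^'m \<Rightarrow> real^'n option) \<xi>. sphere_of_function U F \<phi> \<xi> \<longrightarrow>
           special_parabolic_sphere U {(U, id)} \<phi> \<xi>)"
  proof (intro conjI)
    show "\<exists>(\<phi> :: complex^'m \<Rightarrow> real^'n option) \<xi>. sphere_of_function U F \<phi> \<xi>"
      by (rule sphere_exists[OF assms])
    show "\<forall>(\<phi> :: complex^'m \<Rightarrow> real^'n option) \<xi> \<psi> \<eta>.
        sphere_of_function U F \<phi> \<xi> \<and> sphere_of_function U F \<psi> \<eta> \<longrightarrow> equiaffine_related U \<phi> \<psi>"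
      by (intro allI impI, elim conjE) (rule sphere_unique[OF conn])
    show "\<forall>(\<phi> :: complex^'m \<Rightarrow> real^'n option) \<xi>. sphere_of_function U F \<phi> \<xi> \<longrightarrow>
        special_parabolic_sphere U {(U, id)} \<phi> \<xi>"
      by (intro allI impI) (rule sphere_special)
  qed
next
  fix M :: "'a set" and A :: "('a, real^'n) chart set" and \<phi> \<xi> :: "'a \<Rightarrow> real^'n option"
  assume M: "simply_connected M" and sphere: "special_parabolic_sphere M A \<phi> \<xi>"
  show "arises_from_holomorphic_functions TYPE('m) M A \<phi> \<xi>"
    by (rule special_sphere_arises[OF assms connected_if_simply_connected[OF M] sphere])
qed

end
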